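(* Let $c_3=c_4=7$, $c_5=11$, $c_8=9$ and $c_{12}=13$. For every $n\in\{3,4,5,8,12\}$ and every $n$-cyclotomic model set $\Lambda$, the number $c_n$ is the least natural number $c$ with the property that, for every set $U$ of $c$ pairwise nonparallel $\Lambda$-directions, the convex subsets of $\Lambda$ are determined by the X-rays in the directions of $U$.
   Context: The Euclidean plane is identified with $\mathbb{C}$; natural numbers are positive; $\zeta_n:=e^{2\pi i/n}$. $n$-cyclotomic model sets: Let $n\ge 3$, $K=\mathbb{Q}(\zeta_n)$, $d=[K:\mathbb{Q}]=\phi(n)$ (Euler's totient), $\mathcal{O}_K=\mathbb{Z}[\zeta_n]$ the ring of integers of $K$. All embeddings of $K$ into $\mathbb{C}$ are complex and $s:=d/2\geq 1$. Choose embeddings $\sigma_2,\dots,\sigma_s$, exactly one from each pair of complex conjugate embeddings of $K$ into $\mathbb{C}$ other than the pair consisting of the identity and complex conjugation, and let ${}^\star:\mathcal{O}_K\to\mathbb{C}^{s-1}$, $z\mapsto(\sigma_2(z),\dots,\sigma_s(z))$ (if $s=1$, $\mathbb{C}^{0}=\{0\}$ and ${}^\star$ is the zero map). For any such choice and any relatively compact set $W\subset\mathbb{C}^{s-1}$ with nonempty interior, every translate (by a vector in $\mathbb{C}$) of $\{z\in\mathcal{O}_K : z^\star\in W\}$ is called an $n$-cyclotomic model set. Elements of the unit circle $\mathbb{S}^1\subset\mathbb{C}$ are called directions. A direction is a $\Lambda$-direction if it is parallel to a nonzero element of $\Lambda-\Lambda=\{v-w : v,w\in\Lambda\}$. A convex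 subset of $\Lambda$ is a bounded subset $C\subset\Lambda$ with $C=\operatorname{conv}(C)\cap\Lambda$ (such a set is finite). For a finite set $F\subset\mathbb{C}$ and a direction $u$, the (discrete parallel) X-ray $X_uF$ is the function on the set of lines $\ell$ in $\mathbb{C}$ in direction $u$ given by $X_uF(\ell)=\operatorname{card}(F\cap\ell)$. For a finite set $U$ of directions, the elements of a collection $\mathcal{F}$ of finite subsets of $\mathbb{C}$ are determined by the X-rays in the directions of $U$ if for all $F,F'\in\mathcal{F}$: $X_uF=X_uF'$ for all $u\in U$ implies $F=F'$. *)

theory Defs
  imports "HOL-Analysis.Analysis" "HOL-Computational_Algebra.Polynomial" "HOL-Number_Theory.Totient"
begin

definition root_of_unity :: "nat \<Rightarrow> complex" where
  "root_of_unity n = exp (2 * of_real pi * \<i> / of_nat n)"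

(* Closure under inverse also covers 0, since inverse 0 = 0. *)
definition is_subfield :: "complex set \<Rightarrow> bool" where
  "is_subfield F \<longleftrightarrow> 0 \<in> F \<and> 1 \<in> F \<and>
     (\<forall>x\<in>F. \<forall>y\<in>F. x - y \<in> F \<and> x * y \<in> F) \<and> (\<forall>x\<in>F. inverse x \<in> F)"

definition cyclotomic_field :: "nat \<Rightarrow> complex set" where
  "cyclotomic_field n = \<Inter>{F. is_subfield F \<and> root_of_unity n \<in> F}"

definition cyclotomic_ring :: "nat \<Rightarrow> complex set" where
  "cyclotomic_ring n = range (\<lambda>p :: int poly. poly (map_poly of_int p) (root_of_unity n))"

(* Only the values on the cyclotomic field are meaningful; embeddings are compared on it. *)
definition field_embedding :: "nat \<Rightarrow> (complex \<Rightarrow> complex) \<Rightarrow> bool" where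
  "field_embedding n \<sigma> \<longleftrightarrow> \<sigma> 1 = 1 \<and>
     (\<forall>x\<in>cyclotomic_field n. \<forall>y\<in>cyclotomic_field n.
        \<sigma> (x + y) = \<sigma> x + \<sigma> y \<and> \<sigma> (x * y) = \<sigma> x * \<sigma> y)"

definition same_conjugate_pair ::
    "nat \<Rightarrow> (complex \<Rightarrow> complex) \<Rightarrow> (complex \<Rightarrow> complex) \<Rightarrow> bool" where
  "same_conjugate_pair n \<sigma> \<tau> \<longleftrightarrow>
     (\<forall>z\<in>cyclotomic_field n. \<sigma> z = \<tau> z) \<or> (\<forall>z\<in>cyclotomic_field n. \<sigma> z = cnj (\<tau> z))"

(* The index set {2, ..., s} with s = totient n / 2; it is empty when s = 1. *)
definition star_indices :: "nat \<Rightarrow> nat set" where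
  "star_indices n = {2..totient n div 2}"

definition embedding_choice :: "nat \<Rightarrow> (nat \<Rightarrow> complex \<Rightarrow> complex) \<Rightarrow> bool" where
  "embedding_choice n \<sigma> \<longleftrightarrow>
     (\<forall>i\<in>star_indices n. field_embedding n (\<sigma> i) \<and> \<not> same_conjugate_pair n (\<sigma> i) id) \<and>
     (\<forall>\<tau>. field_embedding n \<tau> \<and> \<not> same_conjugate_pair n \<tau> id \<longrightarrow>
        (\<exists>!i. i \<in> star_indices n \<and> same_conjugate_pair n (\<sigma> i) \<tau>))"

definition star_map :: "nat \<Rightarrow> (nat \<Rightarrow> complex \<Rightarrow> complex) \<Rightarrow> complex \<Rightarrow> nat \<Rightarrow> complex" where
  "star_map n \<sigma> z = (\<lambda>i\<in>star_indices n. \<sigma> i z)"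

(* Complex (s-1)-space, as extensional functions on {2, ..., s};
   it is a one-point space when s = 1. *)
definition internal_space :: "nat \<Rightarrow> (nat \<Rightarrow> complex) topology" where
  "internal_space n = product_topology (\<lambda>_. euclidean) (star_indices n)"

definition cyclotomic_model_set :: "nat \<Rightarrow> complex set \<Rightarrow> bool" where
  "cyclotomic_model_set n \<Lambda> \<longleftrightarrow> n \<ge> 3 \<and>
     (\<exists>\<sigma> W t. embedding_choice n \<sigma> \<and>
        W \<subseteq> topspace (internal_space n) \<and>
        compactin (internal_space n) (internal_space n closure_of W) \<and>
        internal_space n interior_of W \<noteq> {} \<and>
        \<Lambda> = (\<lambda>z. t + z) ` {z \<in> cyclotomic_ring n. star_map n \<sigma> z \<in> W})"

definition parallel :: "complex \<Rightarrow> complex \<Rightarrow> bool" where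
  "parallel u v \<longleftrightarrow> (\<exists>r::real. r \<noteq> 0 \<and> v = r *\<^sub>R u)"

definition set_direction :: "complex set \<Rightarrow> complex \<Rightarrow> bool" where
  "set_direction \<Lambda> u \<longleftrightarrow>
     u \<in> sphere 0 1 \<and> (\<exists>v\<in>\<Lambda>. \<exists>w\<in>\<Lambda>. v - w \<noteq> 0 \<and> parallel u (v - w))"

definition convex_subsets :: "complex set \<Rightarrow> complex set set" where
  "convex_subsets \<Lambda> = {C. C \<subseteq> \<Lambda> \<and> bounded C \<and> C = convex hull C \<inter> \<Lambda>}"

definition lines_in_direction :: "complex \<Rightarrow> complex set set" where
  "lines_in_direction u = range (\<lambda>a. range (\<lambda>r::real. a + r *\<^sub>R u))"

definition xray :: "complex \<Rightarrow> complex set \<Rightarrow> complex set \<Rightarrow> nat" where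
  "xray u F = (\<lambda>l\<in>lines_in_direction u. card (F \<inter> l))"

definition determined_by_xrays :: "complex set set \<Rightarrow> complex set \<Rightarrow> bool" where
  "determined_by_xrays \<F> U \<longleftrightarrow>
     (\<forall>F\<in>\<F>. \<forall>F'\<in>\<F>. (\<forall>u\<in>U. xray u F = xray u F') \<longrightarrow> F = F')"

definition directions_suffice :: "complex set \<Rightarrow> nat \<Rightarrow> bool" where
  "directions_suffice \<Lambda> c \<longleftrightarrow>
     (\<forall>U. finite U \<and> card U = c \<and> (\<forall>u\<in>U. set_direction \<Lambda> u) \<and>
          pairwise (\<lambda>u v. \<not> parallel u v) U \<longrightarrow>
        determined_by_xrays (convex_subsets \<Lambda>) U)"

end

theory Submission
  imports Defs "HOL-Computational_Algebra.Polynomial_Factorial"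
begin

text \<open>
  Let \<open>C\<close> and \<open>C'\<close> be distinct convex subsets with the same X-rays in the directions of \<open>U\<close>.
  The differences \<open>C - C'\<close> and \<open>C' - C\<close> have a common centroid, which is taken as the origin.
  Read in angular order, the points of both differences form an even number \<open>N\<close> of blocks of
  alternating colour. By convexity, matching the points along the lines in a direction \<open>u \<in> U\<close>
  reverses the order of the blocks, so it acts on block indices as \<open>i \<mapsto> a u - i\<close> modulo \<open>N\<close>.
  Hence the real-linear map \<open>\<Phi> u = (\<Sum>x. det (u, x) * \<omega> ^ block x)\<close> with \<open>\<omega> = exp (2 * pi * i / N)\<close> sends
  \<open>u\<close> to a vector whose square has the direction \<open>\<omega> ^ a u\<close>: up to an affine map, the directions
  of \<open>U\<close> are directions of edges of a regular polygon.

  The cross ratios of the roots of unity \<open>\<omega> ^ a u\<close> therefore lie in the real subfield of the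
  cyclotomic field. For \<open>t\<close> prime to the order and congruent to 1 or -1 modulo \<open>n\<close>,
  Galois conjugation shows that \<open>z \<mapsto> z ^ t\<close> preserves these cross ratios, so it agrees with a
  Moebius map on the roots considered, which bounds their number by \<open>t + 1\<close>. The bounds
  6, 6, 10, 8, 12 come from \<open>t\<close> = 5, 5, 9, 7, 11; if the prime dividing \<open>t\<close> divides the order, then
  conjugations that rotate each coset of an index-\<open>p\<close> subgroup give the same or a better bound.

  Conversely, generic orbits of dihedral groups of order 12, 12, 20, 16, 24 show that these bounds
  are attained.
\<close>

section \<open>Galois conjugation of roots of unity\<close>

text \<open>The number of blocks has no bound known in advance, so any prime may divide the order of
  the roots of unity. This is why the exponent is a prime power \<open>p ^ e\<close>, which leaves a
  single exceptional prime, and why that prime is treated by induction on the order. The centroid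
  serves twice: it lies in both hulls, which yields the reversal of the angular order, and the
  differences sum to 0 around it, which excludes blocks of angle at least \<open>pi\<close> and
  zeros of \<open>\<Phi>\<close> on \<open>U\<close>. \<open>\<Phi> u\<close> is a first Fourier
  coefficient in the block index. Partners have equal determinants with \<open>u\<close>, so the
  reflection of indices can only conjugate the coefficient and turn it by a root of unity. In this
  way irregular data yield an exactly regular polygon. The constants satisfy
  \<open>p ^ e = N - 1\<close> for N = 6, 6, 10, 8, 12, where the N-th root of unity lies in the
  ring itself; only for n = 4 is the regular hexagon first carried to the square lattice by a linear
  map. Since 9 is a proper power, the prime 3 needs a count of its own.\<close>

definition ipoly :: "int poly \<Rightarrow> complex \<Rightarrow> complex" where
  "ipoly p x = poly (map_poly of_int p) x"

lemma ipoly_0 [simp]: "ipoly 0 x = 0"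
  and ipoly_pCons [simp]: "ipoly (pCons a p) x = of_int a + x * ipoly p x"
  by (simp_all add: ipoly_def map_poly_pCons)

lemma ipoly_1 [simp]: "ipoly 1 x = 1"
  by (simp add: one_pCons)

lemma ipoly_add [simp]: "ipoly (p + q) x = ipoly p x + ipoly q x"
  by (induction p q rule: poly_induct2) (simp_all add: algebra_simps)

lemma ipoly_smult [simp]: "ipoly (smult a p) x = of_int a * ipoly p x"
  by (induction p) (simp_all add: algebra_simps)

lemma ipoly_uminus [simp]: "ipoly (- p) x = - ipoly p x"
  by (induction p) (simp_all add: algebra_simps)

lemma ipoly_diff [simp]: "ipoly (p - q) x = ipoly p x - ipoly q x"
  using ipoly_add[of p "-q" x] by (simp del: ipoly_add)

lemma ipoly_mult [simp]: "ipoly (p * q) x = ipoly p x * ipoly q x"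
  by (induction p) (simp_all add: algebra_simps)

lemma ipoly_power [simp]: "ipoly (p ^ k) x = ipoly p x ^ k"
  by (induction k) simp_all

lemma ipoly_pcompose: "ipoly (pcompose p q) x = ipoly p (ipoly q x)"
  by (induction p) (simp_all add: pcompose_pCons algebra_simps)

lemma ipoly_monom [simp]: "ipoly (monom c k) x = of_int c * x ^ k"
  by (induction k) (simp_all add: monom_0 monom_Suc)

lemma ipoly_cnj: "ipoly p (cnj x) = cnj (ipoly p x)"
  by (induction p) simp_all

text \<open>Gauss's lemma: contents multiply, so the constant divides the content of the cofactor of
  the primitive \<open>h\<close> and can be cancelled there.\<close>

lemma dvd_smult_cancel_primitive:
  fixes h g :: "int poly"
  assumes "h dvd smult c g" "content h = 1" "c \<noteq> 0"
  shows "h dvd g"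
proof -
  obtain k where k: "smult c g = h * k" using assms(1) by (elim dvdE)
  have "content k = normalize c * content g"
    using arg_cong[OF k, of content] assms(2) by (simp add: content_mult)
  hence "[:c:] dvd k" by (simp add: const_poly_dvd_iff_dvd_content)
  then obtain k' where "k = smult c k'" by (auto elim!: dvdE)
  hence "smult c g = smult c (h * k')" using k by simp
  hence "g = h * k'" using assms(3) smult_cancel by blast
  thus ?thesis by simp
qed

text \<open>Taking the primitive part of an annihilator of least degree keeps divisibility over the
  integers, as the later reduction modulo a prime requires; the constant left by pseudo-division is
  removed by Gauss's lemma.\<close>

lemma integer_minimal_polynomial:
  fixes x :: complex
  assumes f: "ipoly f x = 0" "f \<noteq> 0"
  obtains h where "h \<noteq> 0" "ipoly h x = 0" "\<And>g. ipoly g x = 0 \<Longrightarrow> h dvd g"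
proof -
  define I where "I = {g. g \<noteq> 0 \<and> ipoly g x = 0}"
  have "f \<in> I" using f by (simp add: I_def)
  then obtain h0 where h0: "h0 \<in> I" and min: "\<And>g. g \<in> I \<Longrightarrow> degree h0 \<le> degree g"
    using ex_has_least_nat[of "\<lambda>g. g \<in> I" f degree] by blast
  define h where "h = primitive_part h0"
  have h0': "h0 \<noteq> 0" "ipoly h0 x = 0" using h0 by (auto simp: I_def)
  have split: "h0 = smult (content h0) h" by (simp add: h_def)
  have c: "content h0 \<noteq> 0" using h0' by simp
  have "of_int (content h0) * ipoly h x = 0"
    using split h0'(2) by (metis ipoly_smult)
  hence hx: "ipoly h x = 0" using c by simp
  have hn: "h \<noteq> 0" using h0' by (simp add: h_def)
  have ch: "content h = 1" using h0' by (simp add: h_def)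
  have dh: "degree h = degree h0" by (simp add: h_def)
  have "h dvd g" if g: "ipoly g x = 0" for g
  proof -
    obtain q r where qr: "pseudo_divmod g h = (q, r)" by fastforce
    let ?c = "coeff h (degree h) ^ (Suc (degree g) - degree h)"
    have e: "smult ?c g = h * q + r" "r = 0 \<or> degree r < degree h"
      using pseudo_divmod[OF hn qr] by auto
    have "ipoly r x = 0"
      using arg_cong[OF e(1), of "\<lambda>p. ipoly p x"] g hx by simp
    hence "r = 0" using e(2) min[of r] dh unfolding I_def by fastforce
    hence "h dvd smult ?c g" using e(1) by simp
    thus ?thesis by (rule dvd_smult_cancel_primitive) (use ch hn in auto)
  qed
  thus ?thesis using that hn hx by blast
qed

text \<open>Stated for commutative rings because it is applied both to integers, for Fermat's little
  theorem, and to integer polynomials.\<close>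

lemma prime_dvd_freshman:
  fixes u v :: "'a :: comm_ring_1"
  assumes "prime q"
  shows "of_nat q dvd (u + v) ^ q - (u ^ q + v ^ q)"
proof -
  have q0: "q > 0" using assms prime_gt_0_nat by auto
  have "(u + v) ^ q = (\<Sum>k\<le>q. of_nat (q choose k) * u ^ k * v ^ (q - k))"
    by (rule binomial_ring)
  also have "\<dots> = (\<Sum>k\<in>{..q} - {0,q}. of_nat (q choose k) * u ^ k * v ^ (q - k)) +
     (\<Sum>k\<in>{0,q}. of_nat (q choose k) * u ^ k * v ^ (q - k))"
    by (rule sum.subset_diff) auto
  finally have "(u + v) ^ q - (u ^ q + v ^ q) =
     (\<Sum>k\<in>{..q} - {0,q}. of_nat (q choose k) * u ^ k * v ^ (q - k))"
    using q0 by (simp add: add_ac)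
  moreover have "of_nat q dvd of_nat (q choose k) * u ^ k * v ^ (q - k)"
    if "k \<in> {..q} - {0,q}" for k
  proof -
    have "q dvd (q choose k)" by (rule dvd_choose_prime) (use that assms in auto)
    then obtain m where m: "q choose k = q * m" by blast
    have "(of_nat (q choose k) :: 'a) = of_nat q * of_nat m"
      unfolding m by simp
    thus ?thesis by (metis dvd_mult2 dvd_triv_left)
  qed
  ultimately show ?thesis by (metis (no_types, lifting) dvd_sum)
qed

lemma prime_dvd_power_diff_self:
  fixes a :: int
  assumes "prime q"
  shows "int q dvd a ^ q - a"
proof (induction a rule: int_induct[where k = 0])
  case base
  show ?case using prime_gt_0_nat[OF assms] by (simp add: power_0_left)
next
  case (step1 i)
  have "int q dvd ((i + 1) ^ q - (i ^ q + 1 ^ q)) + (i ^ q - i)"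
    using prime_dvd_freshman[OF assms, of i 1] step1 by (intro dvd_add) simp_all
  thus ?case by (simp add: algebra_simps)
next
  case (step2 i)
  have "int q dvd (i ^ q - i) - ((i - 1 + 1) ^ q - ((i - 1) ^ q + 1 ^ q))"
    by (rule dvd_diff[OF step2(2) prime_dvd_freshman[OF assms]])
  thus ?case by (simp add: algebra_simps)
qed

text \<open>The Frobenius map modulo \<open>q\<close>: Fermat's theorem handles the coefficients and
  the binomial congruence the sum.\<close>

lemma pcompose_monom_prime:
  fixes p :: "int poly"
  assumes "prime q"
  shows "\<exists>g. pcompose p (monom 1 q) = p ^ q + smult (int q) g"
proof (induction p)
  case 0
  show ?case using prime_gt_0_nat[OF assms] by (intro exI[of _ 0]) (simp add: power_0_left)
next
  case (pCons a p)
  then obtain g where g: "pcompose p (monom 1 q) = p ^ q + smult (int q) g" by auto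
  have q0: "q > 0" using assms prime_gt_0_nat by auto
  have "int q dvd a - a ^ q"
    using prime_dvd_power_diff_self[OF assms, of a] by (simp add: dvd_diff_commute)
  then obtain b where b: "a = a ^ q + int q * b" by (metis add.commute diff_add_cancel dvdE)
  obtain s where s: "([:a:] + monom 1 1 * p) ^ q - ([:a:] ^ q + (monom 1 1 * p) ^ q) = [:int q:] * s"
    using prime_dvd_freshman[OF assms, of "[:a:]" "monom 1 1 * p"]
    by (elim dvdE) (simp add: of_nat_poly)
  have pc: "pCons a p = [:a:] + monom 1 1 * p" by (simp add: monom_Suc monom_0)
  have "pcompose (pCons a p) (monom 1 q) = [:a:] + monom 1 q * (p ^ q + smult (int q) g)"
    by (simp add: pcompose_pCons g)
  also have "\<dots> = [:a ^ q + int q * b:] + (monom 1 1 * p) ^ q + smult (int q) (monom 1 q * g)"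
    using b by (simp add: power_mult_distrib monom_power algebra_simps)
  also have "[:a ^ q + int q * b:] = [:a:] ^ q + smult (int q) [:b:]"
    by (simp add: poly_const_pow)
  also have "[:a:] ^ q + smult (int q) [:b:] + (monom 1 1 * p) ^ q + smult (int q) (monom 1 q * g)
     = (pCons a p) ^ q + smult (int q) ([:b:] + monom 1 q * g - s)"
    unfolding pc using s by (simp add: algebra_simps smult_add_right smult_diff_right)
  finally show ?case by blast
qed

text \<open>If \<open>h\<close> is the minimal polynomial of \<open>x\<close> and \<open>h (x ^ q) \<noteq> 0\<close>, then the derivative of \<open>X ^ M - 1\<close> at
  \<open>x ^ q\<close> is divisible by \<open>h (x ^ q) \<equiv> h (x) ^ q = 0\<close> modulo \<open>q\<close>; this would make \<open>q\<close> a divisor of \<open>M\<close>.\<close>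

lemma ipoly_root_power_prime:
  assumes x: "x ^ M = 1" "M > 0" and q: "prime q" "\<not> q dvd M" and f: "ipoly f x = 0"
  shows "ipoly f (x ^ q) = 0"
proof -
  define X where "X = (monom 1 M - 1 :: int poly)"
  have Xx: "ipoly X x = 0" using x by (simp add: X_def)
  have "coeff X M = 1" using x by (simp add: X_def)
  hence X0: "X \<noteq> 0" by (metis coeff_0 zero_neq_one)
  obtain h where h: "h \<noteq> 0" "ipoly h x = 0" "\<And>g. ipoly g x = 0 \<Longrightarrow> h dvd g"
    using integer_minimal_polynomial[OF Xx X0] by blast
  have deg: "degree h > 0"
  proof (rule ccontr)
    assume "\<not> degree h > 0"
    then obtain c where "h = [:c:]" by (metis degree_eq_zeroE gr0I)
    thus False using h by auto
  qed
  obtain k where k: "X = h * k" using h(3)[OF Xx] by blast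
  have dX: "degree X = M"
  proof (rule antisym)
    show "degree X \<le> M" unfolding X_def using degree_diff_le_max[of "monom 1 M" "1::int poly"]
      by (simp add: degree_monom_eq)
    show "M \<le> degree X" using \<open>coeff X M = 1\<close> by (simp add: le_degree)
  qed
  \<comment> \<open>\<open>X\<close> is monic, so the leading coefficient of \<open>h\<close> is a
    unit and pseudo-division by \<open>h\<close> costs only a unit.\<close>
  have "lead_coeff X = lead_coeff h * lead_coeff k" unfolding k by (rule lead_coeff_mult)
  hence "lead_coeff h * lead_coeff k = 1" using \<open>coeff X M = 1\<close> dX by simp
  hence lc: "lead_coeff h dvd 1" by (metis dvd_triv_left)
  have "ipoly h (x ^ q) = 0"
  proof (rule ccontr)
    assume n: "ipoly h (x ^ q) \<noteq> 0"
    obtain g where g: "pcompose h (monom 1 q) = h ^ q + smult (int q) g"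
      using pcompose_monom_prime[OF q(1)] by blast
    have hq: "ipoly h (x ^ q) = of_nat q * ipoly g x"
      using arg_cong[OF g, of "\<lambda>p. ipoly p x"] h(2) prime_gt_0_nat[OF q(1)]
      by (simp add: ipoly_pcompose)
    have "(x ^ q) ^ M = 1" using x by (metis mult.commute power_mult power_one)
    hence Xq: "ipoly X (x ^ q) = 0" by (simp add: X_def)
    hence kq: "ipoly k (x ^ q) = 0" using n k by simp
    have "pderiv X = monom (int M) (M - 1)" by (simp add: X_def pderiv_diff pderiv_monom)
    moreover have "pderiv X = h * pderiv k + k * pderiv h" unfolding k by (rule pderiv_mult)
    ultimately have "ipoly (monom (int M) (M - 1)) (x ^ q) = ipoly (h * pderiv k + k * pderiv h) (x ^ q)"
      by simp
    hence "of_nat M * (x ^ q) ^ (M - 1) = of_nat q * ipoly g x * ipoly (pderiv k) (x ^ q)"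
      using hq kq by simp
    moreover have one: "(x ^ q) ^ (M - 1) * x ^ q = 1"
      using \<open>(x ^ q) ^ M = 1\<close> x(2) by (metis Suc_pred' mult.commute power_Suc)
    ultimately have e1: "of_nat M = of_nat q * ipoly g x * ipoly (pderiv k) (x ^ q) * x ^ q"
      by (metis mult.assoc mult_1_right)
    \<comment> \<open>\<open>a\<close> gathers the factors into one integer polynomial with M equal
      to q times its value at \<open>x\<close>. Reduced modulo \<open>h\<close>, the relation has
      degree below that of \<open>h\<close>, so it holds between coefficients and \<open>q\<close>
      divides \<open>M\<close>.\<close>
    define a where "a = g * pcompose (pderiv k) (monom 1 q) * monom 1 q"
    have ax: "of_nat M = of_nat q * ipoly a x"
      using e1 by (simp add: a_def ipoly_pcompose mult_ac)
    obtain s r where sr: "pseudo_divmod a h = (s, r)" by fastforce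
    define c where "c = coeff h (degree h) ^ (Suc (degree a) - degree h)"
    have e: "smult c a = h * s + r" "r = 0 \<or> degree r < degree h"
      using pseudo_divmod[OF h(1) sr] by (auto simp: c_def)
    have cu: "c dvd 1" unfolding c_def using lc by (metis dvd_power_same power_one)
    have ra: "ipoly r x = of_int c * ipoly a x"
      using arg_cong[OF e(1), of "\<lambda>p. ipoly p x"] h(2) by simp
    have "ipoly ([:c * int M:] - smult (int q) r) x = 0"
      by (simp add: ra ax)
    hence "h dvd [:c * int M:] - smult (int q) r" by (rule h(3))
    moreover have "degree ([:c * int M:] - smult (int q) r) < degree h"
      using e(2) deg by (intro degree_diff_less) auto
    ultimately have "[:c * int M:] - smult (int q) r = 0"
      using dvd_imp_degree_le leD by blast
    hence "coeff ([:c * int M:] - smult (int q) r) 0 = 0" by (metis coeff_0)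
    hence "c * int M = int q * coeff r 0" by simp
    hence "int q dvd c * int M" by simp
    hence "int q dvd int M" using cu
      by (metis dvd_mult_unit_iff' mult.commute)
    thus False using q(2) by simp
  qed
  moreover obtain f' where "f = h * f'" using h(3)[OF f] by blast
  ultimately show ?thesis by simp
qed

text \<open>No automorphism is constructed: conjugation means that every integer relation for
  \<open>x\<close> also holds for \<open>x ^ t\<close>. The prime factors of \<open>t\<close> are
  passed one at a time; \<open>x ^ q\<close> is again an M-th root of unity, so \<open>x\<close>
  stays arbitrary in the induction.\<close>

theorem ipoly_root_power_coprime:
  assumes x: "x ^ M = 1" "M > 0" and "coprime t M" and f: "ipoly f x = 0"
  shows "ipoly f (x ^ t) = 0"
  using assms(3) x(1) f
proof (induction t arbitrary: x rule: prime_divisors_induct)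
  case zero
  hence "M = 1" by simp
  thus ?case using zero.prems by simp
next
  case (unit t)
  thus ?case by simp
next
  case (factor q t)
  have "\<not> q dvd M" using factor.hyps factor.prems(1)
    by (metis coprime_common_divisor coprime_mult_left_iff dvd_refl not_prime_unit)
  hence "ipoly f (x ^ q) = 0"
    using ipoly_root_power_prime factor.prems factor.hyps x(2) by blast
  moreover have "(x ^ q) ^ M = 1" using factor.prems by (metis mult.commute power_mult power_one)
  ultimately have "ipoly f ((x ^ q) ^ t) = 0" using factor by simp
  thus ?case by (simp add: power_mult)
qed

section \<open>Roots of unity with cross ratios in a real cyclotomic field\<close>

text \<open>Equality of the cross ratios before and after \<open>f\<close>, cleared of
  denominators.\<close>

definition same_cross_ratios :: "complex set \<Rightarrow> (complex \<Rightarrow> complex) \<Rightarrow> bool" where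
  "same_cross_ratios S f \<longleftrightarrow> (\<forall>z1\<in>S. \<forall>z2\<in>S. \<forall>z3\<in>S. \<forall>z4\<in>S.
     distinct [z1, z2, z3, z4] \<longrightarrow>
     (z1 - z2) * (z3 - z4) * ((f z1 - f z3) * (f z2 - f z4)) =
     (z1 - z3) * (z2 - z4) * ((f z1 - f z2) * (f z3 - f z4)))"

text \<open>If the fourth point coincides with one of the others, both sides agree anyway. The
  identity is therefore a condition on \<open>z4\<close> that holds on all of \<open>S\<close>, base
  points included, which root counting needs.\<close>

lemma same_cross_ratiosD:
  assumes "same_cross_ratios S f" "z1 \<in> S" "z2 \<in> S" "z3 \<in> S" "z4 \<in> S"
    "distinct [z1, z2, z3]"
  shows "(z1 - z2) * (z3 - z4) * ((f z1 - f z3) * (f z2 - f z4)) =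
     (z1 - z3) * (z2 - z4) * ((f z1 - f z2) * (f z3 - f z4))"
proof (cases "z4 \<in> {z1, z2, z3}")
  case True
  then consider "z4 = z1" | "z4 = z2" | "z4 = z3" by blast
  thus ?thesis by cases (simp_all add: algebra_simps)
next
  case False
  hence "distinct [z1, z2, z3, z4]" using assms(6) by auto
  thus ?thesis using assms(1-5) unfolding same_cross_ratios_def by blast
qed

text \<open>Encodes membership of the cross ratios in the real subfield of the cyclotomic field, as
  quotients of real values of integer polynomials: conjugation is available only for such
  values.\<close>

definition rational_cross_ratios :: "nat \<Rightarrow> complex set \<Rightarrow> bool" where
  "rational_cross_ratios n S \<longleftrightarrow> (\<forall>z1\<in>S. \<forall>z2\<in>S. \<forall>z3\<in>S. \<forall>z4\<in>S.
     distinct [z1, z2, z3, z4] \<longrightarrow>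
     (\<exists>a b. ipoly a (root_of_unity n) \<in> \<real> \<and> ipoly b (root_of_unity n) \<in> \<real> - {0} \<and>
        ipoly a (root_of_unity n) * ((z1 - z3) * (z2 - z4)) =
        ipoly b (root_of_unity n) * ((z1 - z2) * (z3 - z4))))"

lemma root_of_unity_cis: "root_of_unity n = cis (2 * pi / real n)"
  by (simp add: root_of_unity_def cis_conv_exp mult_ac)

lemma root_of_unity_power: "root_of_unity n ^ k = cis (2 * pi * real k / real n)"
  by (simp add: root_of_unity_cis Complex.DeMoivre mult_ac)

lemma root_of_unity_power_self [simp]: "n > 0 \<Longrightarrow> root_of_unity n ^ n = 1"
  by (simp add: root_of_unity_power)

lemma root_of_unity_power_div:
  assumes "n dvd M" "M > 0"
  shows "root_of_unity M ^ (M div n) = root_of_unity n"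
proof -
  obtain k where "M = n * k" using assms by blast
  thus ?thesis using assms by (simp add: root_of_unity_cis Complex.DeMoivre)
qed

lemma root_of_unity_generates:
  assumes "z ^ M = 1" "M > 0"
  obtains e where "e < M" "z = root_of_unity M ^ e"
proof -
  have "z \<in> {z. z ^ M = 1}" using assms by simp
  also have "{z. z ^ M = 1} = {exp (2 * of_real pi * \<i> * of_nat j / of_nat M) |j. j < M}"
    by (rule complex_roots_unity) (use assms in simp)
  finally obtain j where "j < M" "z = exp (2 * of_real pi * \<i> * of_nat j / of_nat M)" by blast
  moreover have "exp (2 * of_real pi * \<i> * of_nat j / of_nat M) = root_of_unity M ^ j"
    by (simp add: root_of_unity_def exp_of_nat_mult [symmetric] mult_ac)
  ultimately show ?thesis using that by blast
qed

lemma norm_root_of_unity [simp]: "norm (root_of_unity n) = 1"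
  by (simp add: root_of_unity_cis)

lemma cnj_root_of_unity: "cnj (root_of_unity n) = inverse (root_of_unity n)"
  by (simp add: root_of_unity_cis cis_cnj)

text \<open>Such exponents act on the n-th cyclotomic field as the identity or as complex
  conjugation, hence fix its real elements. The condition \<open>t > 0\<close> excludes the
  truncated difference \<open>0 - 1 = 0\<close>.\<close>

lemma root_of_unity_power_cong_pm1:
  assumes "n > 0" "n dvd t - 1 \<and> t > 0 \<or> n dvd t + 1"
  shows "root_of_unity n ^ t = root_of_unity n \<or> root_of_unity n ^ t = cnj (root_of_unity n)"
  using assms(2)
proof
  assume "n dvd t - 1 \<and> t > 0"
  then obtain k where "t = n * k + 1" by (metis Suc_diff_1 Suc_eq_plus1 dvdE)
  thus ?thesis using assms(1) by (simp add: power_mult)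
next
  assume "n dvd t + 1"
  then obtain k where k: "t + 1 = n * k" by blast
  have "root_of_unity n ^ (t + 1) = 1" unfolding k using assms(1) by (simp add: power_mult)
  hence "root_of_unity n ^ t * root_of_unity n = 1" by (simp add: mult.commute)
  hence "root_of_unity n ^ t = inverse (root_of_unity n)"
    by (metis inverse_unique mult.commute inverse_inverse_eq)
  thus ?thesis by (simp add: cnj_root_of_unity)
qed

lemma rational_cross_ratios_power:
  assumes S: "\<And>z. z \<in> S \<Longrightarrow> z ^ M = 1" and M: "M > 0" "n dvd M" and t: "coprime t M"
    and pm: "n dvd t - 1 \<and> t > 0 \<or> n dvd t + 1" and r: "rational_cross_ratios n S"
  shows "same_cross_ratios S (\<lambda>z. z ^ t)"
  unfolding same_cross_ratios_def
proof (intro ballI impI)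
  fix z1 z2 z3 z4 assume z: "z1 \<in> S" "z2 \<in> S" "z3 \<in> S" "z4 \<in> S" "distinct [z1, z2, z3, z4]"
  let ?r = "root_of_unity n" and ?R = "root_of_unity M"
  obtain a b where ab: "ipoly a ?r \<in> \<real>" "ipoly b ?r \<in> \<real> - {0}"
    "ipoly a ?r * ((z1 - z3) * (z2 - z4)) = ipoly b ?r * ((z1 - z2) * (z3 - z4))"
    using r z unfolding rational_cross_ratios_def by blast
  obtain e1 where e1: "z1 = ?R ^ e1" using root_of_unity_generates[OF S[OF z(1)] M(1)] by blast
  obtain e2 where e2: "z2 = ?R ^ e2" using root_of_unity_generates[OF S[OF z(2)] M(1)] by blast
  obtain e3 where e3: "z3 = ?R ^ e3" using root_of_unity_generates[OF S[OF z(3)] M(1)] by blast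
  obtain e4 where e4: "z4 = ?R ^ e4" using root_of_unity_generates[OF S[OF z(4)] M(1)] by blast
  let ?m = "\<lambda>e. monom 1 e :: int poly"
  \<comment> \<open>The equation for one cross ratio as a single integer polynomial in
    \<open>root_of_unity M\<close>; the monomial of degree \<open>M div n\<close> stands for
    \<open>root_of_unity n\<close>.\<close>
  define f where "f = pcompose a (?m (M div n)) * ((?m e1 - ?m e3) * (?m e2 - ?m e4))
     - pcompose b (?m (M div n)) * ((?m e1 - ?m e2) * (?m e3 - ?m e4))"
  have "ipoly f ?R = 0"
    using ab(3) by (simp add: f_def ipoly_pcompose root_of_unity_power_div M e1 e2 e3 e4)
  hence "ipoly f (?R ^ t) = 0"
    by (rule ipoly_root_power_coprime[rotated 3]) (use M t in auto)
  moreover have pow: "(?R ^ t) ^ (M div n) = ?r ^ t"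
    using root_of_unity_power_div[OF M(2,1)] by (metis mult.commute power_mult)
  ultimately have f: "ipoly a (?r ^ t) * ((z1 ^ t - z3 ^ t) * (z2 ^ t - z4 ^ t)) =
      ipoly b (?r ^ t) * ((z1 ^ t - z2 ^ t) * (z3 ^ t - z4 ^ t))"
    by (simp add: f_def ipoly_pcompose e1 e2 e3 e4 power_mult [symmetric] mult.commute)
  have n0: "n > 0" using M by (auto intro: Nat.gr0I)
  have fix': "ipoly c (?r ^ t) = ipoly c ?r" if "ipoly c ?r \<in> \<real>" for c
    using root_of_unity_power_cong_pm1[OF n0 pm] that
    by (auto simp: ipoly_cnj Reals_cnj_iff)
  have "ipoly b ?r * ((z1 - z2) * (z3 - z4) * ((z1^t - z3^t) * (z2^t - z4^t)))
     = ipoly a ?r * ((z1 - z3) * (z2 - z4)) * ((z1^t - z3^t) * (z2^t - z4^t))"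
    using ab(3) by simp
  also have "\<dots> = ipoly a ?r * ((z1^t - z3^t) * (z2^t - z4^t)) * ((z1 - z3) * (z2 - z4))"
    by (simp only: mult_ac)
  also have "\<dots> = ipoly b ?r * ((z1^t - z2^t) * (z3^t - z4^t)) * ((z1 - z3) * (z2 - z4))"
    using f ab(1,2) by (simp add: fix')
  also have "\<dots> = ipoly b ?r * ((z1 - z3) * (z2 - z4) * ((z1^t - z2^t) * (z3^t - z4^t)))"
    by (simp only: mult_ac)
  finally show "(z1 - z2) * (z3 - z4) * ((z1^t - z3^t) * (z2^t - z4^t)) =
     (z1 - z3) * (z2 - z4) * ((z1^t - z2^t) * (z3^t - z4^t))"
    using ab(2) by simp
qed

section \<open>Moebius maps that agree with powers or rotations\<close>

lemma power_coprime_eq_1: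
  fixes x :: "'a :: comm_monoid_mult"
  assumes "x ^ a = 1" "x ^ b = 1" "coprime a b"
  shows "x = 1"
proof (cases "b = 1")
  case False
  then obtain u v where "a * u = b * v + 1" using assms(3) coprime_bezout_strong by blast
  hence "(x ^ a) ^ u = (x ^ b) ^ v * x" by (metis power_add power_mult power_one_right)
  thus ?thesis using assms by simp
qed (use assms in simp)

lemma inj_on_coprime_power:
  fixes S :: "complex set"
  assumes "\<And>z. z \<in> S \<Longrightarrow> z ^ M = 1" "M > 0" "coprime t M"
  shows "inj_on (\<lambda>z. z ^ t) S"
proof (rule inj_onI)
  fix x y assume xy: "x \<in> S" "y \<in> S" "x ^ t = y ^ t"
  have "y \<noteq> 0" using assms(1)[OF xy(2)] assms(2) by (auto simp: power_0_left)
  have "(x / y) ^ t = 1" "(x / y) ^ M = 1"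
    using xy assms \<open>y \<noteq> 0\<close> by (simp_all add: power_divide)
  hence "x / y = 1" using power_coprime_eq_1 assms(3) by blast
  thus "x = y" by simp
qed

lemma ex_three_distinct:
  assumes "finite S" "card S \<ge> 3"
  obtains x y z where "x \<in> S" "y \<in> S" "z \<in> S" "distinct [x, y, z]"
proof -
  obtain T where "T \<subseteq> S" "card T = 3" using obtain_subset_with_card_n[OF assms(2)] by blast
  moreover then obtain x y z where "T = {x, y, z}" "x \<noteq> y" "y \<noteq> z" "x \<noteq> z"
    by (metis card_3_iff)
  ultimately show ?thesis using that by auto
qed

text \<open>Three base points fix a Moebius map. That it takes the value \<open>w ^ t\<close> at
  \<open>w\<close> is a polynomial equation of degree at most \<open>t + 1\<close> in
  \<open>w\<close>, and all of \<open>S\<close> solves it.\<close>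

lemma same_cross_ratios_power_bound:
  assumes S: "finite S" "same_cross_ratios S (\<lambda>z. z ^ t)" "inj_on (\<lambda>z. z ^ t) S" and t: "t \<ge> 2"
  shows "card S \<le> t + 1"
proof (cases "card S \<ge> 3")
  case True
  obtain x y z where z: "x \<in> S" "y \<in> S" "z \<in> S" "distinct [x, y, z]"
    using ex_three_distinct[OF S(1) True] by blast
  define \<alpha> \<beta> where "\<alpha> = (x - y) * (x ^ t - z ^ t)" and "\<beta> = (x - z) * (x ^ t - y ^ t)"
  have "x ^ t \<noteq> z ^ t" using S(3) z by (auto dest: inj_onD)
  hence "\<alpha> \<noteq> 0" using z by (simp add: \<alpha>_def)
  define P where "P = smult \<alpha> ([:z, -1:] * ([:y ^ t:] - monom 1 t)) -
     smult \<beta> ([:y, -1:] * ([:z ^ t:] - monom 1 t))"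
  have c1: "coeff ([:c, -1:] * ([:d:] - monom 1 t)) (Suc t) = 1" for c d :: complex
    using t by (auto simp: coeff_pCons split: nat.splits)
  \<comment> \<open>\<open>t \<ge> 2\<close> keeps the linear term of the product away from degree
    \<open>t\<close>.\<close>
  have c2: "coeff ([:c, -1:] * ([:d:] - monom 1 t)) t = - c" for c d :: complex
    using t by (auto simp: coeff_pCons split: nat.splits)
  \<comment> \<open>The two top coefficients cannot both vanish: the first would give
    \<open>\<alpha> = \<beta>\<close>, the second then \<open>y = z\<close>.\<close>
  have "P \<noteq> 0"
  proof
    assume P: "P = 0"
    have "\<alpha> - \<beta> = 0" using arg_cong[OF P, of "\<lambda>p. coeff p (Suc t)"]
      unfolding P_def coeff_diff coeff_smult c1 by simp
    moreover have "\<beta> * y - \<alpha> * z = 0" using arg_cong[OF P, of "\<lambda>p. coeff p t"]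
      unfolding P_def coeff_diff coeff_smult c2 by simp
    ultimately have "\<alpha> * (y - z) = 0" by (simp add: algebra_simps)
    thus False using \<open>\<alpha> \<noteq> 0\<close> z by simp
  qed
  have deg: "degree ([:c, -1:] * ([:d:] - monom 1 t)) \<le> t + 1" for c d :: complex
  proof -
    have "degree ([:d:] - monom 1 t) \<le> t"
      by (intro degree_diff_le) (simp_all add: degree_monom_le)
    thus ?thesis using degree_mult_le[of "[:c, -1:]" "[:d:] - monom 1 t"] by simp
  qed
  have "degree P \<le> t + 1" unfolding P_def
    by (intro degree_diff_le order_trans[OF degree_smult_le] deg)
  moreover have "S \<subseteq> {w. poly P w = 0}"
  proof
    fix w assume w: "w \<in> S"
    have "poly P w = \<alpha> * ((z - w) * (y ^ t - w ^ t)) - \<beta> * ((y - w) * (z ^ t - w ^ t))"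
      by (simp add: P_def poly_monom algebra_simps)
    also have "\<dots> = 0"
      using same_cross_ratiosD[OF S(2) z(1,2,3) w z(4)] by (simp add: \<alpha>_def \<beta>_def mult_ac)
    finally show "w \<in> {w. poly P w = 0}" by simp
  qed
  ultimately show ?thesis
    using card_poly_roots_bound[OF \<open>P \<noteq> 0\<close>] card_mono[OF poly_roots_finite[OF \<open>P \<noteq> 0\<close>], of S]
    by linarith
qed (use t in simp)

text \<open>Three values determine a Moebius map, so agreement with multiplication by
  \<open>d\<close> at three points spreads to \<open>S\<close>.\<close>

lemma same_cross_ratios_rotation:
  assumes S: "same_cross_ratios S f" "a \<in> S" "b \<in> S" "c \<in> S" "distinct [a, b, c]" "z \<in> S"
    and f: "f a = d * a" "f b = d * b" "f c = d * c" "d \<noteq> 0"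
  shows "f z = d * z"
proof -
  have "(a - b) * (c - z) * ((d * a - d * c) * (d * b - f z)) =
     (a - c) * (b - z) * ((d * a - d * b) * (d * c - f z))"
    using same_cross_ratiosD[OF S(1-4,6,5)] f by simp
  hence "d * ((a - b) * ((a - c) * ((b - c) * (f z - d * z)))) = 0" by algebra
  thus ?thesis using S(5) f(4) by simp
qed

text \<open>If one pair is multiplied by \<open>d\<close> and another by \<open>d * x\<close>,
  invariance of the cross ratio of the four points is a quadratic equation for \<open>x\<close>
  whose leading coefficient is not 0.\<close>

lemma same_cross_ratios_two_rotations:
  assumes S: "a \<in> S" "a' \<in> S" "b \<in> S" "b' \<in> S" "distinct [a, a', b, b']" "b \<noteq> 0" "b' \<noteq> 0"
    and I: "finite I" "\<And>x. x \<in> I \<Longrightarrow> x \<noteq> 0 \<and> (\<exists>f d. d \<noteq> 0 \<and> same_cross_ratios S f \<and>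
       f a = d * a \<and> f a' = d * a' \<and> f b = d * x * b \<and> f b' = d * x * b')"
  shows "card I \<le> 2"
proof -
  define P Q where "P = (a - b) * (b' - a')" and "Q = (a - b') * (b - a')"
  define p where "p = smult P ([:a, - b':] * [:- a', b:]) - smult Q ([:a, - b:] * [:- a', b':])"
  have "coeff p 2 = - (b * b' * ((a - a') * (b' - b)))"
    by (simp add: p_def P_def Q_def numeral_2_eq_2) algebra
  hence "p \<noteq> 0" using S by auto
  moreover have "degree p \<le> 2" by (simp add: p_def degree_diff_le)
  moreover have "I \<subseteq> {x. poly p x = 0}"
  proof
    fix x assume "x \<in> I"
    then obtain f d where f: "d \<noteq> 0" "same_cross_ratios S f"
       "f a = d * a" "f a' = d * a'" "f b = d * x * b" "f b' = d * x * b'" using I by blast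
    have "(a - b) * (b' - a') * ((f a - f b') * (f b - f a')) =
      (a - b') * (b - a') * ((f a - f b) * (f b' - f a'))"
      by (rule same_cross_ratiosD[OF f(2)]) (use S in auto)
    hence "d * (d * poly p x) = 0" unfolding f(3-6) p_def P_def Q_def by simp algebra
    thus "x \<in> {x. poly p x = 0}" using f(1) by simp
  qed
  ultimately show ?thesis
    using card_poly_roots_bound[of p] card_mono[OF poly_roots_finite, of p I] by linarith
qed

lemma card_le_if_fibres_le_2:
  assumes S: "finite S" and T: "finite T" "f ` S \<subseteq> T"
    and no3: "\<And>a b c. a \<in> S \<Longrightarrow> b \<in> S \<Longrightarrow> c \<in> S \<Longrightarrow> distinct [a, b, c] \<Longrightarrow> f a = f b \<Longrightarrow> f b \<noteq> f c"
  shows "card S \<le> 2 * card T"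
proof -
  have "card {x \<in> S. f x = y} \<le> 2" for y
  proof (rule ccontr)
    assume "\<not> card {x \<in> S. f x = y} \<le> 2"
    then obtain a b c where "a \<in> {x \<in> S. f x = y}" "b \<in> {x \<in> S. f x = y}" "c \<in> {x \<in> S. f x = y}"
      "distinct [a, b, c]"
      using ex_three_distinct[of "{x \<in> S. f x = y}" thesis] S by fastforce
    thus False using no3[of a b c] by auto
  qed
  moreover have "card S = (\<Sum>y\<in>f ` S. card {x \<in> S. f x = y})"
    unfolding card_eq_sum by (rule sum.image_gen[OF S])
  ultimately have "card S \<le> (\<Sum>y\<in>f ` S. 2)" by (metis (no_types, lifting) sum_mono)
  also have "\<dots> = 2 * card (f ` S)" by simp
  also have "\<dots> \<le> 2 * card T" using card_mono[OF T] by simp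
  finally show ?thesis .
qed

text \<open>Removing one point of a double fibre makes \<open>f\<close> injective: a second double
  fibre would, by \<open>no22\<close>, share its value, and \<open>no3\<close> forbids a third point
  there.\<close>

lemma card_le_if_one_double_fibre:
  assumes S: "finite S" and T: "finite T" "f ` S \<subseteq> T"
    and no3: "\<And>a b c. a \<in> S \<Longrightarrow> b \<in> S \<Longrightarrow> c \<in> S \<Longrightarrow> distinct [a, b, c] \<Longrightarrow> f a = f b \<Longrightarrow> f b \<noteq> f c"
    and no22: "\<And>a a' b b'. a \<in> S \<Longrightarrow> a' \<in> S \<Longrightarrow> b \<in> S \<Longrightarrow> b' \<in> S \<Longrightarrow>
      distinct [a, a', b, b'] \<Longrightarrow> f a = f a' \<Longrightarrow> f b = f b' \<Longrightarrow> f a = f b"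
  shows "card S \<le> card T + 1"
proof (cases "inj_on f S")
  case True
  thus ?thesis using card_mono[OF T] by (simp add: card_image)
next
  case False
  then obtain a a' where a: "a \<in> S" "a' \<in> S" "a \<noteq> a'" "f a = f a'" by (auto simp: inj_on_def)
  have "inj_on f (S - {a'})"
  proof (rule inj_onI, rule ccontr)
    fix b b' assume b: "b \<in> S - {a'}" "b' \<in> S - {a'}" "f b = f b'" "b \<noteq> b'"
    have "f a = f b" if "a \<noteq> b" "a \<noteq> b'" using no22[of a a' b b'] a b that by auto
    hence fa: "f a = f b" by (cases "a = b"; cases "a = b'") (use b in auto)
    obtain c where "c \<in> {b, b'}" "c \<noteq> a" using b by blast
    thus False using no3[of a a' c] a b fa by auto
  qed
  hence "card (S - {a'}) \<le> card T"
    using card_mono[OF T(1), of "f ` (S - {a'})"] T(2) by (auto simp: card_image)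
  thus ?thesis using a S by simp
qed

text \<open>The number is 1 modulo \<open>M div p\<close>, so \<open>p\<close> is the only prime it
  could share with \<open>M\<close>.\<close>

lemma coprime_one_plus_multiple:
  fixes p M :: nat
  assumes "prime p" "p dvd M" "\<not> p dvd 1 + i * (M div p)"
  shows "coprime (1 + i * (M div p)) M"
proof -
  have "coprime (1 + i * (M div p)) (M div p)"
    by (rule coprimeI) (metis dvd_add_left_iff dvd_mult)
  moreover have "coprime (1 + i * (M div p)) p"
    using assms(1,3) by (metis coprime_commute prime_imp_coprime)
  ultimately have "coprime (1 + i * (M div p)) (p * (M div p))" by simp
  thus ?thesis using assms(2) by simp
qed

text \<open>If \<open>p\<close> divides \<open>M\<close>, put m = M div p. Since \<open>p\<close>
  does not divide \<open>n\<close>, the exponents 1 + i m are 1 modulo \<open>n\<close>. They send z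
  to (z ^ m) ^ i * z, so each coset of the m-th roots of unity is rotated by its own angle.
  Invariance under these maps limits the points per coset, and there are \<open>p\<close> cosets; if
  only the trivial coset occurs, the order drops to \<open>m\<close>.\<close>

theorem card_roots_with_rational_cross_ratios:
  fixes n p e M :: nat
  assumes p: "prime p" "\<not> p dvd n" and n: "n > 0" and e: "e > 0"
    and pm: "n dvd p ^ e - 1 \<or> n dvd p ^ e + 1"
    and big: "p \<ge> 5 \<or> p = 3 \<and> e \<ge> 2"
    and M: "M > 0" "n dvd M" and S: "\<And>z. z \<in> S \<Longrightarrow> z ^ M = 1" "1 \<in> S"
    and r: "rational_cross_ratios n S"
  shows "card S \<le> p ^ e + 1"
  using M S(1)
proof (induction M rule: less_induct)
  case (less M)
  have p3: "p \<ge> 3" using big by auto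
  have p_le: "p \<le> p ^ e" using e p3 by (simp add: self_le_power)
  have fin: "finite S"
    by (rule finite_subset[OF _ finite_roots_unity[of M, where 'a = complex]]) (use less.prems in auto)
  show ?case
  proof (cases "p dvd M")
    case False
    hence cop: "coprime (p ^ e) M" using p(1) by (simp add: prime_imp_coprime)
    show ?thesis
    proof (rule same_cross_ratios_power_bound[OF fin])
      show "same_cross_ratios S (\<lambda>z. z ^ (p ^ e))"
        by (rule rational_cross_ratios_power[OF less.prems(3,1,2) cop _ r]) (use pm p3 in auto)
      show "inj_on (\<lambda>z. z ^ (p ^ e)) S"
        by (rule inj_on_coprime_power[OF less.prems(3,1) cop])
      show "2 \<le> p ^ e" using p_le p3 by linarith
    qed
  next
    case True
    define m where "m = M div p"
    have Mm: "M = m * p" using True by (simp add: m_def)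
    have m: "m > 0" "m < M" using less.prems(1) p3 by (auto simp: Mm)
    have "coprime n p" using p by (metis coprime_commute prime_imp_coprime)
    hence nm: "n dvd m" using less.prems(2) by (simp add: Mm coprime_dvd_mult_left_iff)
    show ?thesis
    proof (cases "\<forall>z\<in>S. z ^ m = 1")
      case all1: True
      show ?thesis by (rule less.IH[OF m(2,1) nm]) (use all1 in blast)
    next
      case nontriv: False
      have chip: "(z ^ m) ^ p = 1" if "z \<in> S" for z
        using less.prems(3)[OF that] by (simp add: Mm power_mult)
      have nz: "z \<noteq> 0" if "z \<in> S" for z
        using less.prems(3)[OF that] less.prems(1) by (auto simp: power_0_left)
      \<comment> \<open>An exponent is usable only if prime to \<open>M\<close>; by
        \<open>gap\<close> below, the unusable \<open>i\<close> all agree modulo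
        \<open>p\<close>.\<close>
      define good where "good i \<longleftrightarrow> \<not> p dvd 1 + i * m" for i
      have pow: "z ^ (1 + i * m) = (z ^ m) ^ i * z" for z :: complex and i
        by (simp add: power_mult [symmetric] mult.commute)
      have same: "same_cross_ratios S (\<lambda>z. (z ^ m) ^ i * z)" if "good i" for i
        unfolding pow [symmetric]
        by (rule rational_cross_ratios_power[OF less.prems(3,1,2) _ _ r])
           (use coprime_one_plus_multiple[OF p(1) True] that nm in \<open>auto simp: good_def m_def\<close>)
      have gap: "p dvd j - i" if "\<not> good i" "\<not> good j" "i \<le> j" for i j
      proof -
        have "p dvd (1 + j * m) - (1 + i * m)" using that by (intro dvd_diff_nat) (auto simp: good_def)
        hence "p dvd (j - i) * m" by (simp add: diff_mult_distrib)
        moreover have "\<not> p dvd m"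
        proof
          assume "p dvd m"
          hence "p dvd 1" using that(1) unfolding good_def
            by (metis dvd_add_left_iff dvd_mult)
          thus False using p3 by simp
        qed
        ultimately show ?thesis using p(1) by (simp add: prime_dvd_mult_iff)
      qed
      \<comment> \<open>Three points in one coset force the map to be one rotation on all of
        \<open>S\<close>. As 1 belongs to \<open>S\<close> and stays fixed, that rotation is
        trivial, and every point would be an m-th root of unity.\<close>
      have no3: "b ^ m \<noteq> c ^ m" if abc: "a \<in> S" "b \<in> S" "c \<in> S" "distinct [a, b, c]" "a ^ m = b ^ m" for a b c
      proof
        assume bc: "b ^ m = c ^ m"
        obtain i where i: "good i" "i \<in> {1, 2}" using gap[of 1 2] p3 by auto
        have z1: "(z ^ m) ^ i = (a ^ m) ^ i" if "z \<in> S" for z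
          using same_cross_ratios_rotation[OF same[OF i(1)] abc(1-4) that, of "(a ^ m) ^ i"] abc bc nz that
          by auto
        have zi: "(z ^ m) ^ i = 1" if "z \<in> S" for z
          using z1[OF that] z1[OF S(2)] by simp
        have "odd p" using p(1) p3 prime_odd_nat by fastforce
        hence "coprime i p" using i(2) by auto
        hence "z ^ m = 1" if "z \<in> S" for z
          using power_coprime_eq_1[OF zi chip] that by blast
        thus False using nontriv by blast
      qed
      define T where "T = {w :: complex. w ^ p = 1}"
      have T: "finite T" "card T \<le> p" "(\<lambda>z. z ^ m) ` S \<subseteq> T"
        using finite_roots_unity[of p] card_roots_unity[of p] p3 chip by (auto simp: T_def)
      show ?thesis
      proof (cases "p \<ge> 5")
        \<comment> \<open>For \<open>p = 3\<close> only two usable exponents are guaranteed, too few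
          to exclude two double fibres; since \<open>e \<ge> 2\<close>, two points in each of three
          cosets are within the bound.\<close>
        case False
        hence "p = 3" "e \<ge> 2" using big by auto
        hence "9 \<le> p ^ e" using power_increasing[of 2 e "3::nat"] by simp
        moreover have "card S \<le> 2 * card T" by (rule card_le_if_fibres_le_2[OF fin T(1,3)]) (use no3 in blast)
        ultimately show ?thesis using T(2) \<open>p = 3\<close> by simp
      next
        case p5: True
        have no22: "a ^ m = b ^ m" if ab: "a \<in> S" "a' \<in> S" "b \<in> S" "b' \<in> S"
          "distinct [a, a', b, b']" "a ^ m = a' ^ m" "b ^ m = b' ^ m" for a a' b b'
        proof (rule ccontr)
          assume ne: "a ^ m \<noteq> b ^ m"
          define x where "x = b ^ m / a ^ m"
          have x: "x ^ p = 1" "x \<noteq> 1" "x \<noteq> 0" using chip ab nz ne by (auto simp: x_def power_divide)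
          \<comment> \<open>At least \<open>p - 1 \<ge> 4\<close> usable exponents give distinct
            quotients \<open>x ^ i\<close> of the two rotations, whereas the quadratic equation
            permits two.\<close>
          define J where "J = {i. i < p \<and> good i}"
          have inj: "inj_on (\<lambda>i. x ^ i) {..<p}"
          proof (rule linorder_inj_onI)
            fix i j assume ij: "i < j" "i \<in> {..<p}" "j \<in> {..<p}"
            show "x ^ i \<noteq> x ^ j"
            proof
              assume "x ^ i = x ^ j"
              also have "x ^ j = x ^ i * x ^ (j - i)" using ij by (simp flip: power_add)
              finally have "x ^ (j - i) = 1" using x(3) by simp
              moreover have "\<not> p dvd j - i" using ij by (auto dest: dvd_imp_le)
              hence "coprime (j - i) p" using p(1) by (metis coprime_commute prime_imp_coprime)
              ultimately show False using power_coprime_eq_1 x by blast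
            qed
          qed auto
          have "{..<p} - J \<subseteq> {i}" if "i \<in> {..<p} - J" for i
          proof
            fix j assume j: "j \<in> {..<p} - J"
            have "p dvd j - i" if "i \<le> j" using gap[of i j] that j \<open>i \<in> _\<close> by (auto simp: J_def)
            moreover have "p dvd i - j" if "j \<le> i" using gap[of j i] that j \<open>i \<in> _\<close> by (auto simp: J_def)
            moreover have "j < p" "i < p" using j \<open>i \<in> _\<close> by auto
            ultimately show "j \<in> {i}" by (cases "i \<le> j") (auto dest: dvd_imp_le)
          qed
          hence "card ({..<p} - J) \<le> 1"
            by (metis all_not_in_conv card.empty card_mono finite.emptyI finite_insert is_singletonI is_singleton_altdef le_numeral_extra(4) zero_le)
          moreover have "card ({..<p} - J) = p - card J"
            by (subst card_Diff_subset) (auto simp: J_def)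
          ultimately have "card J \<ge> 4" using p5 by linarith
          moreover have "card ((\<lambda>i. x ^ i) ` J) = card J"
            by (rule card_image, rule inj_on_subset[OF inj]) (auto simp: J_def)
          moreover have "card ((\<lambda>i. x ^ i) ` J) \<le> 2"
          proof (rule same_cross_ratios_two_rotations[OF ab(1-5)])
            show "b \<noteq> 0" "b' \<noteq> 0" using nz ab by auto
            show "finite ((\<lambda>i. x ^ i) ` J)" by (simp add: J_def)
            fix y assume "y \<in> (\<lambda>i. x ^ i) ` J"
            then obtain i where i: "good i" "y = x ^ i" by (auto simp: J_def)
            have "(b ^ m) ^ i = (a ^ m) ^ i * y" using nz ab(1) by (simp add: i(2) x_def power_divide)
            thus "y \<noteq> 0 \<and> (\<exists>f d. d \<noteq> 0 \<and> same_cross_ratios S f \<and>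
              f a = d * a \<and> f a' = d * a' \<and> f b = d * y * b \<and> f b' = d * y * b')"
              using same[OF i(1)] ab nz x(3) i(2)
              by (intro conjI exI[of _ "\<lambda>z. (z ^ m) ^ i * z"] exI[of _ "(a ^ m) ^ i"]) auto
          qed
          ultimately show False by linarith
        qed
        have "card S \<le> card T + 1"
          by (rule card_le_if_one_double_fibre[OF fin T(1,3)]) (use no3 no22 in blast)+
        thus ?thesis using T(2) p_le by linarith
      qed
    qed
  qed
qed

section \<open>The block structure of the differences\<close>

lemma bij_betw_equal_fibres:
  assumes "finite A" "finite B" "\<And>h. card {x\<in>A. f x = h} = card {x\<in>B. f x = h}"
  obtains g where "bij_betw g A B" "\<And>x. x \<in> A \<Longrightarrow> f (g x) = f x"
proof -
  have "\<forall>h. \<exists>g. bij_betw g {x\<in>A. f x = h} {x\<in>B. f x = h}"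
    using assms by (auto intro: finite_same_card_bij)
  then obtain G where G: "\<And>h. bij_betw (G h) {x\<in>A. f x = h} {x\<in>B. f x = h}" by metis
  define g where "g x = G (f x) x" for x
  have gf: "g x \<in> B \<and> f (g x) = f x" if "x \<in> A" for x
    using bij_betwE[OF G[of "f x"]] that by (auto simp: g_def)
  have "bij_betw g A B" unfolding bij_betw_def
  proof
    show "inj_on g A"
    proof (rule inj_onI)
      fix x y assume xy: "x \<in> A" "y \<in> A" "g x = g y"
      hence "f x = f y" using gf by metis
      thus "x = y" using xy bij_betw_imp_inj_on[OF G[of "f x"]] by (auto simp: g_def inj_on_def)
    qed
    show "g ` A = B"
    proof (intro equalityI subsetI)
      fix y assume y: "y \<in> B"
      then obtain x where "x \<in> A" "f x = f y" "G (f y) x = y"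
        using bij_betw_imp_surj_on[OF G[of "f y"]] by (smt (verit, ccfv_SIG) imageE mem_Collect_eq)
      hence "x \<in> A" "g x = y" by (simp_all add: g_def)
      thus "y \<in> g ` A" by blast
    qed (use gf in auto)
  qed
  thus ?thesis using that gf by blast
qed

text \<open>\<open>f\<close> counts the colour changes up to its argument. A new maximum raises the
  count by 0 or 1, so the values fill an interval, which later ensures that no block is
  empty.\<close>

lemma colour_change_count:
  fixes A :: "real set" and c :: "real \<Rightarrow> bool"
  assumes "finite A" "A \<noteq> {}"
  shows "\<exists>f :: real \<Rightarrow> int. mono_on A f \<and> f ` A = {0..f (Max A)} \<and>
    (\<forall>a\<in>A. \<forall>b\<in>A. (c a \<longleftrightarrow> c b) \<longleftrightarrow> even (f a - f b))"
  using assms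
proof (induction A rule: finite_linorder_max_induct)
  case (insert b A)
  show ?case
  proof (cases "A = {}")
    case True
    thus ?thesis by (intro exI[of _ "\<lambda>_. 0"]) (auto simp: mono_on_def)
  next
    case False
    then obtain f :: "real \<Rightarrow> int" where f: "mono_on A f" "f ` A = {0..f (Max A)}"
      "\<And>a a'. a \<in> A \<Longrightarrow> a' \<in> A \<Longrightarrow> (c a \<longleftrightarrow> c a') \<longleftrightarrow> even (f a - f a')" using insert.IH by blast
    have M: "Max A \<in> A" "b \<notin> A" using False insert.hyps by auto
    have Mb: "Max (insert b A) = b" using insert.hyps by (intro Max_eqI) (auto intro: less_imp_le)
    define v where "v = (if c b = c (Max A) then f (Max A) else f (Max A) + 1)"
    define g where "g = f(b := v)"
    have ge: "f (Max A) \<le> v" "v \<le> f (Max A) + 1" by (auto simp: v_def)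
    have fM: "f (Max A) \<ge> 0" using f(2) M by (metis atLeastAtMost_iff imageI)
    have le: "f a \<le> f (Max A)" if "a \<in> A" for a using f(2) that by (metis atLeastAtMost_iff imageI)
    have gA: "g a = f a" if "a \<in> A" for a using that M by (auto simp: g_def)
    have "mono_on (insert b A) g"
    proof (rule mono_onI)
      fix x y assume xy: "x \<in> insert b A" "y \<in> insert b A" "x \<le> y"
      hence "\<not> (x = b \<and> y \<in> A)" using insert.hyps by force
      thus "g x \<le> g y" using xy f(1) le ge gA by (force simp: mono_on_def g_def)
    qed
    moreover have "g ` insert b A = {0..g (Max (insert b A))}"
    proof -
      have "g ` insert b A = insert v (f ` A)" proof -
        have "g ` A = f ` A" by (rule image_cong) (auto simp: gA)
        moreover have "g b = v" by (simp add: g_def)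
        ultimately show ?thesis by simp
      qed
      also have "\<dots> = {0..v}" unfolding f(2) using ge fM by auto
      finally show ?thesis unfolding Mb by (simp add: g_def)
    qed
    moreover have "(c a \<longleftrightarrow> c a') \<longleftrightarrow> even (g a - g a')" if "a \<in> insert b A" "a' \<in> insert b A" for a a'
    proof -
      have "(c a \<longleftrightarrow> c (Max A)) \<longleftrightarrow> even (g a - f (Max A))" if "a \<in> insert b A" for a
        using that f(3)[OF _ M(1)] gA by (cases "a = b") (auto simp: g_def v_def)
      from this[OF that(1)] this[OF that(2)] show ?thesis by auto
    qed
    ultimately show ?thesis by blast
  qed
qed simp

text \<open>Cramer's rule: up to a nonzero factor, \<open>d\<close> is a combination of
  \<open>u\<close> and \<open>v\<close> with these determinants as coefficients.\<close>

lemma zero_if_two_determinants_0: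
  assumes "Im (cnj u * d) = 0" "Im (cnj v * d) = 0" "Im (cnj u * v) \<noteq> 0"
  shows "d = 0"
proof -
  have "of_real (Im (cnj u * v)) * d = of_real (Im (cnj u * d)) * v - of_real (Im (cnj v * d)) * u"
    by (simp add: complex_eq_iff algebra_simps)
  hence "of_real (Im (cnj u * v)) * d = 0"
    by (simp only: assms of_real_0 mult_zero_left diff_self)
  thus ?thesis using assms(3) unfolding mult_eq_0_iff of_real_eq_0_iff by blast
qed

text \<open>\<open>\<tau>\<close> is any real argument of \<open>x\<close>, not reduced modulo a
  full turn, so that the cyclic order around 0 becomes an order of real numbers.\<close>

definition lift :: "complex \<Rightarrow> real \<Rightarrow> bool" where
  "lift x \<tau> \<longleftrightarrow> x = of_real (cmod x) * cis \<tau>"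

lemma lift_Arg2pi: "lift x (Arg2pi x)"
  unfolding lift_def using Arg2pi_eq[of x] by (simp add: cis_conv_exp mult_ac)

lemma lift_add_2pi_iff: "lift x (\<tau> + 2 * pi * of_int k) \<longleftrightarrow> lift x \<tau>"
proof -
  have "cis (2 * pi * of_int k) = 1" by (simp add: cis.ctr complex_eq_iff)
  thus ?thesis by (simp add: lift_def flip: cis_mult)
qed

lemma lift_relative:
  assumes "u \<noteq> 0"
  shows "lift x (Arg2pi u + Arg2pi (x / u))"
proof -
  have "x = u * (x / u)" using assms by simp
  also have "\<dots> = of_real (cmod u) * cis (Arg2pi u) * (of_real (cmod (x / u)) * cis (Arg2pi (x / u)))"
    using lift_Arg2pi[of u] lift_Arg2pi[of "x / u"] unfolding lift_def by metis
  also have "\<dots> = of_real (cmod x) * cis (Arg2pi u + Arg2pi (x / u))"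
    using assms by (simp add: norm_divide flip: cis_mult)
  finally show ?thesis unfolding lift_def .
qed

lemma lift_unique:
  assumes "lift x \<tau>" "lift x \<sigma>" "x \<noteq> 0"
  obtains k :: int where "\<tau> = \<sigma> + 2 * pi * of_int k"
proof -
  have "cis \<tau> = cis \<sigma>" using assms unfolding lift_def by (metis mult_cancel_left norm_eq_zero of_real_eq_0_iff)
  hence "cos (\<tau> - \<sigma>) = 1" by (simp add: cos_diff complex_eq_iff flip: power2_eq_square)
  then obtain k :: int where "\<tau> - \<sigma> = of_int k * 2 * pi" using cos_one_2pi_int by blast
  thus ?thesis using that[of k] by (simp add: algebra_simps)
qed

lemma lift_cross:
  assumes "lift x \<tau>" "lift y \<sigma>"
  shows "Im (cnj x * y) = cmod x * cmod y * sin (\<sigma> - \<tau>)"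
proof -
  have "cnj x * y = cnj (of_real (cmod x) * cis \<tau>) * (of_real (cmod y) * cis \<sigma>)"
    using assms unfolding lift_def by metis
  thus ?thesis by (simp add: sin_diff algebra_simps)
qed

text \<open>\<open>D1\<close> and \<open>D2\<close> are the two differences and \<open>P1\<close>, \<open>P2\<close> the convex hulls of the two sets, all
  translated so that the common centroid of the differences is 0. The real number
  \<open>Im (cnj u * x)\<close> is the determinant of \<open>u\<close> and \<open>x\<close>, which identifies the line through \<open>x\<close> in
  direction \<open>u\<close>.\<close>

locale tomography =
  fixes D1 D2 P1 P2 U :: "complex set"
  assumes fin: "finite D1" "finite D2"
    and conv: "convex P1" "convex P2"
    and zero: "0 \<in> P1" "0 \<in> P2"
    and sub: "D1 \<subseteq> P1" "D2 \<subseteq> P2"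
    and disj: "D1 \<inter> P2 = {}" "D2 \<inter> P1 = {}"
    and lines: "\<And>u h. u \<in> U \<Longrightarrow>
      card {x\<in>D1. Im (cnj u * x) = h} = card {x\<in>D2. Im (cnj u * x) = h}"
    and sums: "(\<Sum>x\<in>D1. x) = 0" "(\<Sum>x\<in>D2. x) = 0"
    and ne: "D1 \<noteq> {}"
    and U: "finite U" "card U \<ge> 3" "\<And>u. u \<in> U \<Longrightarrow> u \<noteq> 0"
      "\<And>u v. u \<in> U \<Longrightarrow> v \<in> U \<Longrightarrow> u \<noteq> v \<Longrightarrow> Im (cnj u * v) \<noteq> 0"
begin

definition D where "D = D1 \<union> D2"

text \<open>For \<open>x\<close> in \<open>D\<close>, this set contains 0 and every point of the
  colour of \<open>x\<close> but no point of the other colour; the convexity arguments trap a point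
  of the other colour in it.\<close>

definition body where "body x = (if x \<in> D1 then P1 else P2)"

definition differ where "differ x y \<longleftrightarrow> x \<in> D \<and> y \<in> D \<and> (x \<in> D1 \<longleftrightarrow> y \<in> D2)"

definition partner where "partner u x y \<longleftrightarrow> differ x y \<and> Im (cnj u * x) = Im (cnj u * y)"

lemma disjD: "x \<in> D1 \<Longrightarrow> x \<notin> D2" using disj sub by blast

lemma finD: "finite D" using fin by (simp add: D_def)

lemma differ_sym: "differ x y \<Longrightarrow> differ y x"
  unfolding differ_def D_def using disjD by blast

lemma partner_sym: "partner u x y \<Longrightarrow> partner u y x"
  unfolding partner_def using differ_sym by auto

lemma differ_notin_body: "differ x y \<Longrightarrow> y \<notin> body x"
  unfolding differ_def body_def D_def using disj disjD sub by auto

lemma differ_body: "differ x y \<Longrightarrow> differ y z \<Longrightarrow> z \<in> body x"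
  unfolding differ_def body_def D_def using disj disjD sub by auto

lemma body: "x \<in> D \<Longrightarrow> x \<in> body x" "0 \<in> body x" "convex (body x)"
  unfolding body_def D_def using sub zero conv by auto

lemma nonzero: "x \<in> D \<Longrightarrow> x \<noteq> 0"
  unfolding D_def using disj zero by auto

lemma ex_partner:
  assumes "u \<in> U" "x \<in> D"
  obtains y where "partner u x y"
proof -
  let ?h = "Im (cnj u * x)"
  have "card {z\<in>D1. Im (cnj u * z) = ?h} = card {z\<in>D2. Im (cnj u * z) = ?h}"
    using lines assms(1) by blast
  moreover have "card {z\<in>D1. Im (cnj u * z) = ?h} > 0" if "x \<in> D1"
    using that fin by (subst card_gt_0_iff) auto
  moreover have "card {z\<in>D2. Im (cnj u * z) = ?h} > 0" if "x \<in> D2"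
    using that fin by (subst card_gt_0_iff) auto
  ultimately have "x \<in> D1 \<Longrightarrow> {z\<in>D2. Im (cnj u * z) = ?h} \<noteq> {}" "x \<in> D2 \<Longrightarrow> {z\<in>D1. Im (cnj u * z) = ?h} \<noteq> {}"
    using card_gt_0_iff by metis+
  thus ?thesis using that assms(2) disjD unfolding partner_def differ_def D_def by fastforce
qed

text \<open>\<open>y'\<close> and \<open>t * x\<close> lie in \<open>body x\<close> and on the line
  through \<open>y\<close> in direction \<open>u\<close>. If \<open>y\<close> were between them, it
  would lie in \<open>body x\<close> despite its colour; hence both are on the same side of
  \<open>y\<close>.\<close>

lemma not_between:
  assumes p: "partner u y y'" and d: "differ x y" and u: "u \<noteq> 0"
    and t: "0 \<le> t" "t \<le> 1" "Im (cnj u * y) = t * Im (cnj u * x)"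
  shows "(Re (cnj u * y) - Re (cnj u * y')) * (Re (cnj u * y) - t * Re (cnj u * x)) > 0"
proof (rule ccontr)
  let ?a = "Re (cnj u * y')" and ?b = "t * Re (cnj u * x)" and ?c = "Re (cnj u * y)"
  assume "\<not> ?thesis"
  hence "(?c - ?a) * (?c - ?b) \<le> 0" by simp
  hence "?c \<in> closed_segment ?a ?b"
    unfolding closed_segment_eq_real_ivl by (auto simp: mult_le_0_iff)
  then obtain s where s: "0 \<le> s" "s \<le> 1" "?c = (1 - s) * ?a + s * ?b"
    by (auto simp: closed_segment_def)
  have "cnj u * y = cnj u * ((1 - s) *\<^sub>R y' + s *\<^sub>R (t *\<^sub>R x))"
  proof (rule complex_eqI)
    show "Re (cnj u * y) = Re (cnj u * ((1 - s) *\<^sub>R y' + s *\<^sub>R (t *\<^sub>R x)))"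
      using s(3) by (simp add: algebra_simps)
    have "Im (cnj u * ((1 - s) *\<^sub>R y' + s *\<^sub>R (t *\<^sub>R x))) =
      (1 - s) * Im (cnj u * y') + s * (t * Im (cnj u * x))" by (simp add: algebra_simps)
    also have "\<dots> = (1 - s) * Im (cnj u * y) + s * Im (cnj u * y)"
      using p t(3) by (simp only: partner_def)
    also have "\<dots> = Im (cnj u * y)" by (simp only: left_diff_distrib mult_1 diff_add_cancel)
    finally show "Im (cnj u * y) = Im (cnj u * ((1 - s) *\<^sub>R y' + s *\<^sub>R (t *\<^sub>R x)))" by simp
  qed
  hence y: "y = (1 - s) *\<^sub>R y' + s *\<^sub>R (t *\<^sub>R x)" using u by simp
  have "y' \<in> body x" using differ_body d p by (auto simp: partner_def)
  moreover have "(1 - t) *\<^sub>R 0 + t *\<^sub>R x \<in> body x"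
    by (rule convexD[OF body(3)]) (use t d body in \<open>auto simp: differ_def\<close>)
  ultimately have "y \<in> body x" unfolding y
    by (intro convexD[OF body(3)]) (use s in auto)
  thus False using differ_notin_body d by blast
qed

text \<open>Seen from the origin, passing to partners reverses the angular order of differently
  coloured points on one side of the line through the origin in direction \<open>u\<close>.\<close>

lemma partner_reverses_cross:
  assumes p: "partner u x x'" "partner u y y'" and d: "differ x y" and u: "u \<noteq> 0"
    and side: "Im (cnj u * x) * Im (cnj u * y) \<ge> 0" "Im (cnj u * x) \<noteq> 0 \<or> Im (cnj u * y) \<noteq> 0"
    and cr: "Im (cnj x * y) > 0"
  shows "Im (cnj y' * x') > 0"
proof -
  define Vx Vy Vx' Vy' Hx Hy where V: "Vx = Re (cnj u * x)" "Vy = Re (cnj u * y)"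
    "Vx' = Re (cnj u * x')" "Vy' = Re (cnj u * y')" "Hx = Im (cnj u * x)" "Hy = Im (cnj u * y)"
  have H': "Im (cnj u * x') = Hx" "Im (cnj u * y') = Hy" using p by (auto simp: partner_def V)
  have d': "differ x' y'" using p d disjD by (auto simp: partner_def differ_def D_def)
  have u2: "(cmod u)\<^sup>2 > 0" using u by simp
  have crs: "(cmod u)\<^sup>2 * Im (cnj a * b) =
      Re (cnj u * a) * Im (cnj u * b) - Im (cnj u * a) * Re (cnj u * b)" for a b
    unfolding cmod_power2 by (simp add: power2_eq_square algebra_simps)
  have c1: "Vx * Hy - Hx * Vy > 0" 
  proof -
    have "0 < (cmod u)\<^sup>2 * Im (cnj x * y)" using cr u2 by simp
    thus ?thesis unfolding crs by (simp only: V)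
  qed
  have "Vy' * Hx - Hy * Vx' > 0"
  \<comment> \<open>Of the two parallel lines, take the one farther from 0: shrinking its points by
    \<open>t\<close> puts them on the nearer line. There \<open>not_between\<close>, used for the
    pair and for its partners, shows that the order is reversed.\<close>
  proof (cases "\<bar>Hx\<bar> \<ge> \<bar>Hy\<bar>")
    case True
    define t where "t = Hy / Hx"
    have Hx: "Hx \<noteq> 0" using True side by (auto simp: V)
    have t: "0 \<le> t" "t \<le> 1" "Hy = t * Hx"
      using True side(1) Hx by (auto simp: t_def divide_simps abs_if V mult_le_0_iff zero_le_mult_iff split: if_splits)
    have "(Vy - Vy') * (Vy - t * Vx) > 0" "(Vy' - Vy) * (Vy' - t * Vx') > 0"
      using not_between[OF p(2) d u t(1,2)] not_between[OF partner_sym[OF p(2)] d' u t(1,2)] t(3) H'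
      by (simp_all add: V)
    moreover have "Hx * (Vy - t * Vx) < 0" using c1 t(3) by (simp add: algebra_simps)
    ultimately have "Hx * (Vy' - t * Vx') > 0"
      unfolding zero_less_mult_iff mult_less_0_iff by linarith
    thus ?thesis using t(3) by (simp add: algebra_simps)
  next
    case False
    define t where "t = Hx / Hy"
    have Hy: "Hy \<noteq> 0" using False by auto
    have t: "0 \<le> t" "t \<le> 1" "Hx = t * Hy"
      using False side(1) Hy by (auto simp: t_def divide_simps abs_if V mult_le_0_iff zero_le_mult_iff split: if_splits)
    have "(Vx - Vx') * (Vx - t * Vy) > 0" "(Vx' - Vx) * (Vx' - t * Vy') > 0"
      using not_between[OF p(1) differ_sym[OF d] u t(1,2)]
        not_between[OF partner_sym[OF p(1)] differ_sym[OF d'] u t(1,2)] t(3) H'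
      by (simp_all add: V)
    moreover have "Hy * (Vx - t * Vy) > 0" using c1 t(3) by (simp add: algebra_simps)
    ultimately have "Hy * (Vx' - t * Vy') < 0"
      unfolding zero_less_mult_iff mult_less_0_iff by linarith
    thus ?thesis using t(3) by (simp add: algebra_simps)
  qed
  hence "(cmod u)\<^sup>2 * Im (cnj y' * x') > 0" unfolding crs H' by (simp add: V mult.commute)
  thus ?thesis using u2 by (simp add: zero_less_mult_iff)
qed

text \<open>On a ray from 0 the nearer point lies on the segment from 0 to the farther one, hence in
  the body of the latter.\<close>

lemma same_ray:
  assumes "lift x \<tau>" "lift y \<tau>" "x \<in> D" "y \<in> D"
  shows "\<not> differ x y"
proof -
  have *: "\<not> differ x y" if "lift x \<tau>" "lift y \<tau>" "x \<in> D" "cmod y \<le> cmod x" for x y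
  proof
    assume d: "differ x y"
    define s where "s = cmod y / cmod x"
    have x: "cmod x > 0" using nonzero that(3) by simp
    have s: "0 \<le> s" "s \<le> 1" using that(4) x by (auto simp: s_def)
    have "y = of_real (cmod y) * cis \<tau>" using that by (simp add: lift_def)
    also have "\<dots> = of_real s * (of_real (cmod x) * cis \<tau>)" using x by (simp add: s_def)
    also have "\<dots> = of_real s * x" using that by (metis lift_def)
    finally have "y = (1 - s) *\<^sub>R 0 + s *\<^sub>R x" by (simp add: scaleR_conv_of_real)
    moreover have "(1 - s) *\<^sub>R 0 + s *\<^sub>R x \<in> body x"
      by (rule convexD[OF body(3)]) (use s that body in auto)
    ultimately show False using differ_notin_body[OF d] by simp
  qed
  show ?thesis using *[of x y] *[of y x] differ_sym assms by (cases "cmod y \<le> cmod x") auto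
qed

text \<open>The circle is cut at argument 0 and colour changes are counted from there; each further
  full turn adds \<open>N\<close>.\<close>

lemma ex_block_index:
  obtains N :: int and F :: "complex \<Rightarrow> real \<Rightarrow> int" where "N > 0" "even N"
    "\<And>x \<tau> y \<sigma>. x \<in> D \<Longrightarrow> y \<in> D \<Longrightarrow> lift x \<tau> \<Longrightarrow> lift y \<sigma> \<Longrightarrow> \<tau> \<le> \<sigma> \<Longrightarrow> F x \<tau> \<le> F y \<sigma>"
    "\<And>x \<tau> k. F x (\<tau> + 2 * pi * of_int k) = F x \<tau> + N * k"
    "\<And>x \<tau> y \<sigma>. x \<in> D \<Longrightarrow> y \<in> D \<Longrightarrow> lift x \<tau> \<Longrightarrow> lift y \<sigma> \<Longrightarrow> differ x y \<longleftrightarrow> odd (F x \<tau> + F y \<sigma>)"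
    "\<And>v. \<exists>x\<in>D. \<exists>\<tau>. lift x \<tau> \<and> F x \<tau> = v"
proof -
  define A where "A = Arg2pi ` D"
  define c where "c a \<longleftrightarrow> (\<exists>x\<in>D1. Arg2pi x = a)" for a
  have A: "finite A" "A \<noteq> {}" using ne finD by (auto simp: A_def D_def)
  have c: "c (Arg2pi x) \<longleftrightarrow> x \<in> D1" if x: "x \<in> D" for x
  proof
    assume "c (Arg2pi x)"
    then obtain y where y: "y \<in> D1" "Arg2pi y = Arg2pi x" by (auto simp: c_def)
    have "\<not> differ y x" using same_ray[of y "Arg2pi x" x] lift_Arg2pi x y by (metis D_def UnI1)
    thus "x \<in> D1" using x y by (auto simp: differ_def D_def)
  qed (use that in \<open>auto simp: c_def\<close>)
  obtain f :: "real \<Rightarrow> int" where f: "mono_on A f" "f ` A = {0..f (Max A)}"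
    "\<And>a b. a \<in> A \<Longrightarrow> b \<in> A \<Longrightarrow> (c a \<longleftrightarrow> c b) \<longleftrightarrow> even (f a - f b)"
    using colour_change_count[OF A, of c] by blast
  define m where "m = f (Max A)"
  \<comment> \<open>The indices 0 to \<open>m\<close> occur on one turn. If \<open>m\<close> is
    even, the first and the last run have the same colour and form one block across the cut, so
    there are \<open>m\<close> blocks; otherwise there are \<open>m + 1\<close>.\<close>
  define N where "N = (if even m then m else m + 1)"
  have range: "0 \<le> f (Arg2pi x)" "f (Arg2pi x) \<le> m" if "x \<in> D" for x
    using f(2) that by (auto simp: A_def m_def)
  have dif: "differ x y \<longleftrightarrow> odd (f (Arg2pi x) + f (Arg2pi y))" if "x \<in> D" "y \<in> D" for x y
    using f(3)[of "Arg2pi x" "Arg2pi y"] c[OF that(1)] c[OF that(2)] that disjD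
    by (auto simp: A_def differ_def D_def)
  have m0: "m \<ge> 0" using range ne by (metis D_def Un_empty all_not_in_conv order_trans)
  have "m \<noteq> 0"
  proof
    assume "m = 0"
    obtain x where x: "x \<in> D1" using ne by blast
    have "U \<noteq> {}" using U(2) by auto
    then obtain y where "differ x y" using ex_partner[of _ x] x by (auto simp: partner_def D_def)
    moreover have "x \<in> D" "y \<in> D" using calculation by (auto simp: differ_def)
    ultimately show False using dif range \<open>m = 0\<close> by (metis add_0 antisym even_zero)
  qed
  hence N: "N > 0" "even N" "m \<le> N" "N \<le> m + 1" using m0 by (auto simp: N_def)
  define F where "F x \<tau> = f (Arg2pi x) + N * \<lfloor>\<tau> / (2 * pi)\<rfloor>" for x \<tau>
  have fl: "\<tau> = Arg2pi x + 2 * pi * of_int \<lfloor>\<tau> / (2 * pi)\<rfloor>" if l: "lift x \<tau>" "x \<in> D" for x \<tau>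
  proof -
    obtain k :: int where k: "\<tau> = Arg2pi x + 2 * pi * of_int k"
      using lift_unique[OF l(1) lift_Arg2pi nonzero[OF l(2)]] by blast
    have "\<lfloor>\<tau> / (2 * pi)\<rfloor> = k"
      using Arg2pi[of x] by (intro floor_unique) (auto simp: k field_simps)
    thus ?thesis using k by simp
  qed
  show ?thesis
  proof (rule that[of N F])
    fix x \<tau> y \<sigma> assume xy: "x \<in> D" "y \<in> D" "lift x \<tau>" "lift y \<sigma>"
    show "differ x y \<longleftrightarrow> odd (F x \<tau> + F y \<sigma>)" using dif xy N(2) by (auto simp: F_def)
    assume le: "\<tau> \<le> \<sigma>"
    define j k where jk: "j = \<lfloor>\<tau> / (2 * pi)\<rfloor>" "k = \<lfloor>\<sigma> / (2 * pi)\<rfloor>"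
    have eq: "\<tau> = Arg2pi x + 2 * pi * of_int j" "\<sigma> = Arg2pi y + 2 * pi * of_int k"
      using fl xy by (auto simp: jk)
    have "j \<le> k" unfolding jk using le by (intro floor_mono divide_right_mono) auto
    show "F x \<tau> \<le> F y \<sigma>"
    proof (cases "j = k")
      case True
      hence "Arg2pi x \<le> Arg2pi y" using eq le by simp
      hence "f (Arg2pi x) \<le> f (Arg2pi y)" using f(1) xy by (auto simp: mono_on_def A_def)
      thus ?thesis using True by (simp add: F_def flip: jk)
    next
      case False
      hence "N * (j + 1) \<le> N * k" using \<open>j \<le> k\<close> N(1) by (intro mult_left_mono) auto
      thus ?thesis using range[OF xy(1)] range[OF xy(2)] N(3)
        by (simp add: F_def distrib_left flip: jk)
    qed
  next
    fix x \<tau> and k :: int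
    have "(\<tau> + 2 * pi * of_int k) / (2 * pi) = \<tau> / (2 * pi) + of_int k" by (simp add: field_simps)
    thus "F x (\<tau> + 2 * pi * of_int k) = F x \<tau> + N * k" by (simp add: F_def distrib_left)
  next
    fix v :: int
    have "v mod N \<in> {0..m}" using N pos_mod_bound[OF N(1), of v] pos_mod_sign[OF N(1), of v] by simp
    hence "v mod N \<in> f ` A" using f(2) by (simp add: m_def)
    then obtain x where x: "x \<in> D" "f (Arg2pi x) = v mod N" by (auto simp: A_def)
    have "\<lfloor>(Arg2pi x + 2 * pi * of_int (v div N)) / (2 * pi)\<rfloor> = v div N"
      using Arg2pi[of x] by (intro floor_unique) (auto simp: field_simps)
    hence "F x (Arg2pi x + 2 * pi * of_int (v div N)) = v" by (simp add: F_def x(2))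
    thus "\<exists>x\<in>D. \<exists>\<tau>. lift x \<tau> \<and> F x \<tau> = v"
      using x(1) lift_add_2pi_iff lift_Arg2pi by blast
  qed (use N in auto)
qed

end

text \<open>\<open>F x \<tau>\<close> is the index of the block of \<open>x\<close>, where the argument of \<open>x\<close> is lifted to the real number \<open>\<tau>\<close>;
  a full turn adds the number \<open>N\<close> of blocks.\<close>

locale tomography_blocks = tomography +
  fixes N :: int and F :: "complex \<Rightarrow> real \<Rightarrow> int"
  assumes N: "N > 0" "even N"
    and F_mono: "\<And>x \<tau> y \<sigma>. x \<in> D \<Longrightarrow> y \<in> D \<Longrightarrow> lift x \<tau> \<Longrightarrow> lift y \<sigma> \<Longrightarrow> \<tau> \<le> \<sigma> \<Longrightarrow> F x \<tau> \<le> F y \<sigma>"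
    and F_period: "\<And>x \<tau> k. F x (\<tau> + 2 * pi * of_int k) = F x \<tau> + N * k"
    and F_parity: "\<And>x \<tau> y \<sigma>. x \<in> D \<Longrightarrow> y \<in> D \<Longrightarrow> lift x \<tau> \<Longrightarrow> lift y \<sigma> \<Longrightarrow> differ x y \<longleftrightarrow> odd (F x \<tau> + F y \<sigma>)"
    and F_onto: "\<And>v. \<exists>x\<in>D. \<exists>\<tau>. lift x \<tau> \<and> F x \<tau> = v"
begin

lemma F_less: "x \<in> D \<Longrightarrow> y \<in> D \<Longrightarrow> lift x \<tau> \<Longrightarrow> lift y \<sigma> \<Longrightarrow> F x \<tau> < F y \<sigma> \<Longrightarrow> \<tau> < \<sigma>"
  using F_mono[of y x \<sigma> \<tau>] by fastforce

text \<open>Partners with their arguments lifted so that, measured from the argument of \<open>u\<close>, the half-turn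
  with number \<open>k\<close> corresponds to the half-turn with number \<open>- k\<close>.\<close>

definition rel where
  "rel u x \<tau> y \<sigma> \<longleftrightarrow> partner u x y \<and> lift x \<tau> \<and> lift y \<sigma> \<and>
     (\<exists>k::int. (even k \<longleftrightarrow> Im (cnj u * x) \<ge> 0) \<and> \<tau> - Arg2pi u \<in> {k * pi..k * pi + pi} \<and>
        \<sigma> - Arg2pi u \<in> {- k * pi..- k * pi + pi})"

lemma rel_sym: "rel u x \<tau> y \<sigma> \<Longrightarrow> rel u y \<sigma> x \<tau>"
proof -
  assume r: "rel u x \<tau> y \<sigma>"
  then obtain k :: int where "(even k \<longleftrightarrow> Im (cnj u * x) \<ge> 0)" "\<tau> - Arg2pi u \<in> {k * pi..k * pi + pi}"
        "\<sigma> - Arg2pi u \<in> {- k * pi..- k * pi + pi}" unfolding rel_def by blast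
  thus ?thesis using r partner_sym unfolding rel_def partner_def by (intro conjI exI[of _ "-k"]) auto
qed

lemma ex_rel:
  assumes u: "u \<in> U" and xy: "partner u x y" and x: "lift x \<tau>"
  obtains \<sigma> where "rel u x \<tau> y \<sigma>"
proof -
  have u0: "u \<noteq> 0" using u U by blast
  have D: "x \<in> D" "y \<in> D" using xy by (auto simp: partner_def differ_def)
  obtain j :: int where j: "\<tau> = Arg2pi u + Arg2pi (x / u) + 2 * pi * j"
    using lift_unique[OF x lift_relative[OF u0] nonzero[OF D(1)]] by blast
  have im: "Im (cnj u * z) \<ge> 0 \<longleftrightarrow> Arg2pi (z / u) \<le> pi" for z
  proof -
    have "cnj u * z = of_real ((cmod u)\<^sup>2) * (z / u)"
      unfolding complex_norm_square using u0 by (simp add: field_simps)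
    hence "Im (cnj u * z) = (cmod u)\<^sup>2 * Im (z / u)" by (metis Im_complex_of_real Re_complex_of_real add.right_neutral mult_zero_left times_complex.simps(2))
    thus ?thesis using u0 by (simp add: Arg2pi_le_pi zero_le_mult_iff)
  qed
  have ran: "0 \<le> Arg2pi z" "Arg2pi z < 2 * pi" for z using Arg2pi[of z] by auto
  have same: "Im (cnj u * x) = Im (cnj u * y)" using xy by (simp add: partner_def)
  \<comment> \<open>\<open>k\<close> is the number of the half-turn containing
    \<open>\<tau>\<close>; \<open>i\<close> is the full turn that puts \<open>y\<close> into
    half-turn \<open>- k\<close>. For odd \<open>k\<close> this is \<open>- j - 1\<close>, because
    -(2j + 1) = 2(-j - 1) + 1.\<close>
  define k where "k = (if Im (cnj u * x) \<ge> 0 then 2 * j else 2 * j + 1)"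
  define i where "i = (if Im (cnj u * x) \<ge> 0 then - j else - j - 1)"
  define \<sigma> where "\<sigma> = Arg2pi u + Arg2pi (y / u) + 2 * pi * i"
  have "lift y \<sigma>" unfolding \<sigma>_def lift_add_2pi_iff by (rule lift_relative[OF u0])
  moreover have "even k \<longleftrightarrow> Im (cnj u * x) \<ge> 0" by (simp add: k_def)
  moreover have "\<tau> - Arg2pi u \<in> {k * pi..k * pi + pi} \<and> \<sigma> - Arg2pi u \<in> {- k * pi..- k * pi + pi}"
    using im[of x] im[of y] ran[of "x / u"] ran[of "y / u"] same
    by (auto simp: j \<sigma>_def k_def i_def algebra_simps)
  ultimately show ?thesis using that xy x unfolding rel_def by blast
qed

text \<open>Distinct half-turns are exchanged in reverse order by the choice of lifts. Within one
  half-turn the reversal is that of cross products, except when all points lie on the line through 0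
  in direction \<open>u\<close>.\<close>

lemma rel_reverses:
  assumes r: "rel u x1 \<tau>1 y1 \<sigma>1" "rel u x2 \<tau>2 y2 \<sigma>2" and d: "differ x1 x2" and lt: "\<tau>1 < \<tau>2"
    and u: "u \<in> U"
  shows "\<sigma>2 \<le> \<sigma>1"
proof -
  have u0: "u \<noteq> 0" using u U by blast
  define \<beta> where "\<beta> = Arg2pi u"
  obtain k1 :: int where k1: "even k1 \<longleftrightarrow> Im (cnj u * x1) \<ge> 0" "\<tau>1 - \<beta> \<in> {k1 * pi..k1 * pi + pi}"
     "\<sigma>1 - \<beta> \<in> {- k1 * pi..- k1 * pi + pi}" using r(1) unfolding rel_def \<beta>_def by blast
  obtain k2 :: int where k2: "even k2 \<longleftrightarrow> Im (cnj u * x2) \<ge> 0" "\<tau>2 - \<beta> \<in> {k2 * pi..k2 * pi + pi}"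
     "\<sigma>2 - \<beta> \<in> {- k2 * pi..- k2 * pi + pi}" using r(2) unfolding rel_def \<beta>_def by blast
  have l: "lift x1 \<tau>1" "lift y1 \<sigma>1" "lift x2 \<tau>2" "lift y2 \<sigma>2" "lift u \<beta>"
    using r lift_Arg2pi by (auto simp: rel_def \<beta>_def)
  have p: "partner u x1 y1" "partner u x2 y2" using r by (auto simp: rel_def)
  have D: "x1 \<in> D" "y1 \<in> D" "x2 \<in> D" "y2 \<in> D" using p by (auto simp: partner_def differ_def)
  have nz: "cmod x1 > 0" "cmod y1 > 0" "cmod x2 > 0" "cmod y2 > 0" "cmod u > 0"
    using nonzero[OF D(1)] nonzero[OF D(2)] nonzero[OF D(3)] nonzero[OF D(4)] u0 by auto
  consider "k1 + 1 \<le> k2" | "k2 + 1 \<le> k1" | "k1 = k2" by linarith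
  thus ?thesis
  proof cases
    case 1
    hence "(k1 + 1) * pi \<le> k2 * pi" using pi_gt_zero by (intro mult_right_mono) auto
    thus ?thesis using k1 k2 by (simp add: algebra_simps)
  next
    case 2
    hence "(k2 + 1) * pi \<le> k1 * pi" using pi_gt_zero by (intro mult_right_mono) auto
    thus ?thesis using k1 k2 lt by (simp add: algebra_simps)
  next
    case k: 3
    show ?thesis
    proof (rule ccontr)
      assume "\<not> \<sigma>2 \<le> \<sigma>1"
      hence s: "0 < \<sigma>2 - \<sigma>1" "\<sigma>2 - \<sigma>1 \<le> pi" using k1(3) k2(3) k by auto
      have t: "0 < \<tau>2 - \<tau>1" "\<tau>2 - \<tau>1 \<le> pi" using k1(2) k2(2) k lt by auto
      show False
      proof (cases "Im (cnj u * x1) = 0 \<and> Im (cnj u * x2) = 0")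
        case False
        \<comment> \<open>A difference of \<open>pi\<close> would put both points at the ends of the
          half-turn, that is, on the line through 0.\<close>
        have "\<tau>2 - \<tau>1 \<noteq> pi"
        proof
          assume "\<tau>2 - \<tau>1 = pi"
          hence "\<tau>1 - \<beta> = of_int k1 * pi" "\<tau>2 - \<beta> = of_int (k1 + 1) * pi"
            using k1(2) k2(2) k by (auto simp: algebra_simps)
          hence "sin (\<tau>1 - \<beta>) = 0" "sin (\<tau>2 - \<beta>) = 0" using sin_zero_iff_int2 by blast+
          thus False using False unfolding lift_cross[OF l(5) l(1)] lift_cross[OF l(5) l(3)] by simp
        qed
        hence "sin (\<tau>2 - \<tau>1) > 0" using t by (intro sin_gt_zero) auto
        hence c: "Im (cnj x1 * x2) > 0" using nz unfolding lift_cross[OF l(1,3)] by simp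
        have "Im (cnj u * x1) * Im (cnj u * x2) \<ge> 0" using k1(1) k2(1) k
          by (metis linorder_le_cases mult_nonneg_nonneg mult_nonpos_nonpos)
        hence "Im (cnj y2 * y1) > 0"
          using partner_reverses_cross[OF p d u0] c False by blast
        hence "sin (\<sigma>1 - \<sigma>2) > 0" using nz unfolding lift_cross[OF l(4,2)]
          by (elim zero_less_mult_pos) simp
        moreover have "sin (\<sigma>2 - \<sigma>1) \<ge> 0" using s by (intro sin_ge_zero) auto
        ultimately show False using sin_minus[of "\<sigma>2 - \<sigma>1"] by simp
      next
        case True
        \<comment> \<open>Now every lift is an end of its half-turn. The strict inequalities put
          \<open>\<tau>1\<close> and \<open>\<sigma>1\<close> at the starts, which differ by full
          turns, so \<open>x1\<close> and its partner share a ray although their colours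
          differ.\<close>
        have two: "a = n * pi \<or> a = n * pi + pi" if "a \<in> {n * pi..n * pi + pi}" "sin a = 0" for a and n :: int
        proof -
          obtain i :: int where i: "a = i * pi" using \<open>sin a = 0\<close> sin_zero_iff_int2 by blast
          have "n * pi \<le> i * pi" "i * pi \<le> of_int (n + 1) * pi"
            using that(1) by (auto simp: i algebra_simps)
          hence "n \<le> i" "i \<le> n + 1"
            by (simp_all only: mult_le_cancel_right_pos[OF pi_gt_zero] of_int_le_iff)
          hence "i = n \<or> i = n + 1" by linarith
          thus ?thesis unfolding i by (auto simp: distrib_right)
        qed
        have "sin (\<tau>1 - \<beta>) = 0" "sin (\<tau>2 - \<beta>) = 0" "sin (\<sigma>1 - \<beta>) = 0" "sin (\<sigma>2 - \<beta>) = 0"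
          using True p nz unfolding partner_def lift_cross[OF l(5) l(1)] lift_cross[OF l(5) l(2)]
            lift_cross[OF l(5) l(3)] lift_cross[OF l(5) l(4)] by simp_all
        hence "\<tau>1 - \<beta> = k1 * pi \<or> \<tau>1 - \<beta> = k1 * pi + pi" "\<tau>2 - \<beta> = k1 * pi \<or> \<tau>2 - \<beta> = k1 * pi + pi"
          "\<sigma>1 - \<beta> = - k1 * pi \<or> \<sigma>1 - \<beta> = - k1 * pi + pi" "\<sigma>2 - \<beta> = - k1 * pi \<or> \<sigma>2 - \<beta> = - k1 * pi + pi"
          using two[of "\<tau>1 - \<beta>" k1] two[of "\<tau>2 - \<beta>" k1] two[of "\<sigma>1 - \<beta>" "- k1"] two[of "\<sigma>2 - \<beta>" "- k1"] k1 k2 k by auto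
        hence e: "\<tau>1 - \<beta> = k1 * pi" "\<sigma>1 - \<beta> = - k1 * pi" using s t by auto
        have "\<tau>1 = \<sigma>1 + 2 * pi * of_int k1" using e by (simp add: algebra_simps)
        hence "lift y1 \<tau>1" using lift_add_2pi_iff l(2) by simp
        thus False using same_ray[OF l(1) _ D(1,2)] p(1) by (simp add: partner_def)
      qed
    qed
  qed
qed

text \<open>Every index in between is occupied, so one can move block by block. Neighbouring blocks
  differ in colour, so their order is reversed, and parity makes each decrease of the partner index
  strict.\<close>

lemma rel_F_reverse:
  assumes u: "u \<in> U" and r: "rel u x1 \<tau>1 y1 \<sigma>1" "rel u x2 \<tau>2 y2 \<sigma>2" and lt: "F x1 \<tau>1 < F x2 \<tau>2"
  shows "F y1 \<sigma>1 - F y2 \<sigma>2 \<ge> F x2 \<tau>2 - F x1 \<tau>1"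
  using r lt
proof (induction "nat (F x2 \<tau>2 - F x1 \<tau>1)" arbitrary: x2 \<tau>2 y2 \<sigma>2 rule: less_induct)
  case less
  have DL: "x \<in> D \<and> y \<in> D \<and> lift x \<tau> \<and> lift y \<sigma> \<and> differ x y" if "rel u x \<tau> y \<sigma>" for x \<tau> y \<sigma>
    using that by (auto simp: rel_def partner_def differ_def)
  have step: "F y2 \<sigma>2 < F y1 \<sigma>1" if r: "rel u x1 \<tau>1 y1 \<sigma>1" "rel u x2 \<tau>2 y2 \<sigma>2" "F x2 \<tau>2 = F x1 \<tau>1 + 1"
    for x1 \<tau>1 y1 \<sigma>1 x2 \<tau>2 y2 \<sigma>2
  proof -
    note d = DL[OF r(1)] DL[OF r(2)]
    have "\<tau>1 < \<tau>2" using F_less[of x1 x2 \<tau>1 \<tau>2] d r(3) by simp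
    moreover have dx: "differ x1 x2" using F_parity[of x1 x2 \<tau>1 \<tau>2] d r(3) by simp
    ultimately have "\<sigma>2 \<le> \<sigma>1" by (rule rel_reverses[OF r(1,2) _ _ u, rotated])
    hence "F y2 \<sigma>2 \<le> F y1 \<sigma>1" using F_mono[of y2 y1 \<sigma>2 \<sigma>1] d by simp
    moreover have "differ y2 y1" using dx d disjD by (auto simp: differ_def D_def)
    hence "odd (F y2 \<sigma>2 + F y1 \<sigma>1)" using F_parity[of y2 y1 \<sigma>2 \<sigma>1] d by simp
    hence "F y2 \<sigma>2 \<noteq> F y1 \<sigma>1" by auto
    ultimately show ?thesis by simp
  qed
  show ?case
  proof (cases "F x2 \<tau>2 = F x1 \<tau>1 + 1")
    case True
    thus ?thesis using step less.prems by fastforce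
  next
    case False
    obtain x \<tau> where x: "x \<in> D" "lift x \<tau>" "F x \<tau> = F x2 \<tau>2 - 1" using F_onto by blast
    obtain y where "partner u x y" using ex_partner[OF u x(1)] by blast
    then obtain \<sigma> where r: "rel u x \<tau> y \<sigma>" using ex_rel[OF u _ x(2)] by blast
    have "F y1 \<sigma>1 - F y \<sigma> \<ge> F x \<tau> - F x1 \<tau>1"
      by (rule less.hyps) (use less.prems x False r in auto)
    moreover have "F y2 \<sigma>2 < F y \<sigma>" using step[OF r less.prems(2)] x(3) by simp
    ultimately show ?thesis using x(3) by linarith
  qed
qed

text \<open>The relation is symmetric, so \<open>rel_F_reverse\<close> holds in both directions and
  its inequality becomes an equality: matching acts on indices as a reflection.\<close>

lemma rel_F_sum:
  assumes u: "u \<in> U" and r: "rel u x1 \<tau>1 y1 \<sigma>1" "rel u x2 \<tau>2 y2 \<sigma>2"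
  shows "F x1 \<tau>1 + F y1 \<sigma>1 = F x2 \<tau>2 + F y2 \<sigma>2"
proof -
  have *: "F x1 \<tau>1 + F y1 \<sigma>1 = F x2 \<tau>2 + F y2 \<sigma>2"
    if r: "rel u x1 \<tau>1 y1 \<sigma>1" "rel u x2 \<tau>2 y2 \<sigma>2" and lt: "F x1 \<tau>1 < F x2 \<tau>2"
    for x1 \<tau>1 y1 \<sigma>1 x2 \<tau>2 y2 \<sigma>2
    using rel_F_reverse[OF u r lt] rel_F_reverse[OF u rel_sym[OF r(2)] rel_sym[OF r(1)]] lt by linarith
  consider "F x1 \<tau>1 < F x2 \<tau>2" | "F x2 \<tau>2 < F x1 \<tau>1" | "F x1 \<tau>1 = F x2 \<tau>2" by linarith
  thus ?thesis
  proof cases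
    case 1
    thus ?thesis using *[OF r] by simp
  next
    case 2
    thus ?thesis using *[OF r(2,1)] by simp
  next
    case 3
    have "\<not> F y1 \<sigma>1 < F y2 \<sigma>2" "\<not> F y2 \<sigma>2 < F y1 \<sigma>1"
      using *[OF rel_sym[OF r(1)] rel_sym[OF r(2)]] *[OF rel_sym[OF r(2)] rel_sym[OF r(1)]] 3 by auto
    thus ?thesis using 3 by simp
  qed
qed

definition axis :: "complex \<Rightarrow> int" where
  "axis u = (SOME a. \<forall>x \<tau> y \<sigma>. rel u x \<tau> y \<sigma> \<longrightarrow> F x \<tau> + F y \<sigma> = a)"

lemma rel_axis:
  assumes "u \<in> U" "rel u x \<tau> y \<sigma>"
  shows "F x \<tau> + F y \<sigma> = axis u"
proof -
  have "\<exists>a. \<forall>x \<tau> y \<sigma>. rel u x \<tau> y \<sigma> \<longrightarrow> F x \<tau> + F y \<sigma> = a"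
    by (intro exI[of _ "F x \<tau> + F y \<sigma>"] allI impI) (rule rel_F_sum[OF assms(1) _ assms(2)])
  hence "\<forall>x \<tau> y \<sigma>. rel u x \<tau> y \<sigma> \<longrightarrow> F x \<tau> + F y \<sigma> = axis u"
    unfolding axis_def by (rule someI_ex)
  thus ?thesis using assms(2) by simp
qed

lemma F_lift_cong:
  assumes "x \<in> D" "lift x \<tau>" "lift x \<sigma>"
  shows "F x \<tau> mod N = F x \<sigma> mod N"
proof -
  obtain k :: int where "\<tau> = \<sigma> + 2 * pi * of_int k"
    using lift_unique[OF assms(2,3) nonzero[OF assms(1)]] by blast
  thus ?thesis by (simp add: F_period)
qed

lemma partner_axis:
  assumes "u \<in> U" "partner u x y" "lift x \<tau>" "lift y \<sigma>"
  shows "(F x \<tau> + F y \<sigma>) mod N = axis u mod N"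
proof -
  obtain \<sigma>' where r: "rel u x \<tau> y \<sigma>'" using ex_rel[OF assms(1-3)] by blast
  have "F y \<sigma> mod N = F y \<sigma>' mod N"
    using F_lift_cong[OF _ assms(4)] r assms(2) by (auto simp: rel_def partner_def differ_def)
  hence "(F x \<tau> + F y \<sigma>) mod N = (F x \<tau> + F y \<sigma>') mod N" by (metis mod_add_right_eq)
  thus ?thesis using rel_axis[OF assms(1) r] by simp
qed

lemma axis_odd:
  assumes "u \<in> U"
  shows "odd (axis u)"
proof -
  obtain x where "x \<in> D" using ne by (auto simp: D_def)
  obtain y where y: "partner u x y" using ex_partner[OF assms \<open>x \<in> D\<close>] by blast
  have "odd (F x (Arg2pi x) + F y (Arg2pi y))"
    using F_parity[of x y "Arg2pi x" "Arg2pi y"] y lift_Arg2pi by (auto simp: partner_def differ_def)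
  thus ?thesis using partner_axis[OF assms y lift_Arg2pi lift_Arg2pi] N(2)
    by (metis dvd_mod_iff)
qed

end

section \<open>From directions to roots of unity\<close>

text \<open>A sector narrower than a half-plane is a convex cone. After rotation to its bisector
  with half-opening \<open>w\<close>, it is described by a positive real part and a slope of modulus
  at most \<open>tan w\<close>, and both survive sums.\<close>

lemma lift_sum:
  assumes B: "finite B" "B \<noteq> {}" and x: "\<And>x. x \<in> B \<Longrightarrow> x \<noteq> 0 \<and> lift x (t x) \<and> t x \<in> {t1..t2}"
    and w: "t2 - t1 < pi"
  obtains \<psi> where "\<psi> \<in> {t1..t2}" "lift (\<Sum>x\<in>B. x) \<psi>" "(\<Sum>x\<in>B. x) \<noteq> 0"
proof -
  define c where "c = (t1 + t2) / 2"
  define w where "w = (t2 - t1) / 2"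
  define s where "s = (\<Sum>x\<in>B. x)"
  define z where "z = s * cis (- c)"
  have w2: "w < pi / 2" using w by (simp add: w_def)
  have th: "\<bar>t x - c\<bar> \<le> w" if "x \<in> B" for x
    using x[OF that] unfolding c_def w_def by (auto simp: abs_le_iff field_simps)
  have w0: "w \<ge> 0" using th B(2) by (metis abs_ge_zero all_not_in_conv order_trans)
  have xc: "x * cis (- c) = of_real (cmod x) * cis (t x - c)" if "x \<in> B" for x
  proof -
    have "x * cis (- c) = of_real (cmod x) * cis (t x) * cis (- c)"
      using x[OF that] unfolding lift_def by metis
    thus ?thesis by (simp add: cis_mult mult.assoc)
  qed
  have z: "z = (\<Sum>x\<in>B. of_real (cmod x) * cis (t x - c))"
    unfolding z_def s_def sum_distrib_right by (rule sum.cong) (simp_all add: xc)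
  have cpos: "cos (t x - c) > 0" if "x \<in> B" for x
    using th[OF that] w2 by (intro cos_gt_zero_pi) auto
  have Re: "Re z > 0" unfolding z Re_sum
    by (rule sum_pos[OF B]) (use x cpos in auto)
  have tan: "\<bar>sin (t x - c)\<bar> \<le> tan w * cos (t x - c)" if "x \<in> B" for x
  proof -
    have "\<bar>tan (t x - c)\<bar> \<le> tan w"
    proof -
      have "tan (t x - c) \<le> tan w" "tan (- w) \<le> tan (t x - c)"
        using th[OF that] w2 tan_mono_le[of "t x - c" w] tan_mono_le[of "- w" "t x - c"] by auto
      thus ?thesis by auto
    qed
    hence "\<bar>tan (t x - c)\<bar> * cos (t x - c) \<le> tan w * cos (t x - c)"
      using cpos[OF that] by (intro mult_right_mono) auto
    thus ?thesis using cpos[OF that] by (simp add: tan_def abs_divide)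
  qed
  have "\<bar>Im z\<bar> \<le> (\<Sum>x\<in>B. cmod x * (tan w * cos (t x - c)))"
    unfolding z Im_sum by (rule order_trans[OF sum_abs], rule sum_mono) (use tan in \<open>simp add: abs_mult mult_left_mono\<close>)
  also have "\<dots> = tan w * Re z" unfolding z Re_sum by (simp add: sum_distrib_left mult_ac)
  finally have "\<bar>Im z / Re z\<bar> \<le> tan w" using Re by (simp add: abs_divide divide_simps)
  hence "- tan w \<le> Im z / Re z" "Im z / Re z \<le> tan w"
    using abs_le_iff[of "Im z / Re z" "tan w"] by linarith+
  hence "arctan (tan (- w)) \<le> arctan (Im z / Re z)" "arctan (Im z / Re z) \<le> arctan (tan w)"
    by (simp_all only: arctan_le_iff tan_minus)
  moreover have "arctan (tan w) = w" "arctan (tan (- w)) = - w"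
    using arctan_tan[of w] w0 w2 by (simp_all add: arctan_minus)
  moreover have "Arg z = arctan (Im z / Re z)" by (rule arg_conv_arctan[OF Re])
  ultimately have A: "- w \<le> Arg z" "Arg z \<le> w" by auto
  have z0: "z \<noteq> 0" using Re by auto
  have "s = z * cis c" by (simp add: z_def cis_mult mult.assoc)
  also have "\<dots> = of_real (cmod z) * cis (Arg z) * cis c"
    using rcis_cmod_Arg[of z] by (simp add: rcis_def)
  also have "\<dots> = of_real (cmod s) * cis (Arg z + c)" by (simp add: z_def norm_mult cis_mult mult.assoc)
  finally have "lift s (Arg z + c)" by (simp add: lift_def)
  moreover have "Arg z + c \<in> {t1..t2}" using A by (simp add: c_def w_def field_simps)
  moreover have "s \<noteq> 0" using z0 by (auto simp: z_def)
  ultimately show ?thesis using that s_def by blast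
qed

lemma ex_lift_from:
  obtains \<sigma> where "lift y \<sigma>" "\<tau> \<le> \<sigma>" "\<sigma> < \<tau> + 2 * pi"
proof -
  define k where "k = \<lceil>(\<tau> - Arg2pi y) / (2 * pi)\<rceil>"
  have "(\<tau> - Arg2pi y) / (2 * pi) \<le> k" "k < (\<tau> - Arg2pi y) / (2 * pi) + 1"
    unfolding k_def by linarith+
  hence "\<tau> \<le> Arg2pi y + 2 * pi * k" "Arg2pi y + 2 * pi * k < \<tau> + 2 * pi"
    by (simp_all add: field_simps)
  thus ?thesis using that lift_add_2pi_iff lift_Arg2pi by blast
qed

context tomography_blocks
begin

text \<open>Were a block to span an angle of at least \<open>pi\<close>, all points of the other
  colour would lie strictly on one side of a line through 0, although their sum is 0.\<close>

lemma block_width: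
  assumes x: "x \<in> D" "lift x \<tau>" "x' \<in> D" "lift x' \<tau>'" "F x \<tau> = F x' \<tau>'"
  shows "\<tau>' - \<tau> < pi"
proof (rule ccontr)
  assume "\<not> ?thesis"
  hence ge: "\<tau>' \<ge> \<tau> + pi" by simp
  define E where "E = (if x \<in> D1 then D2 else D1)"
  have E: "(\<Sum>y\<in>E. y) = 0" "finite E" using sums fin by (auto simp: E_def)
  have dE: "differ x y" if "y \<in> E" for y
    using that x(1) disjD by (auto simp: E_def differ_def D_def split: if_splits)
  have "E \<noteq> {}"
  proof -
    obtain u where "u \<in> U" using U(2) by (cases "U = {}") auto
    then obtain y where "partner u x y" using ex_partner x(1) by blast
    hence "y \<in> E" using disjD x(1) by (auto simp: E_def partner_def differ_def D_def dest: disjD)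
    thus ?thesis by blast
  qed
  have lc: "lift (cis \<tau>') \<tau>'" by (simp add: lift_def)
  have pos: "Im (cnj (cis \<tau>') * y) > 0" if y: "y \<in> E" for y
  proof -
    have yD: "y \<in> D" using dE[OF y] by (auto simp: differ_def)
    obtain \<sigma> where \<sigma>: "lift y \<sigma>" "\<tau>' \<le> \<sigma>" "\<sigma> < \<tau>' + 2 * pi" using ex_lift_from by blast
    have odd: "odd (F x \<tau> + F y \<sigma>)" using F_parity[of x y \<tau> \<sigma>] dE[OF y] x yD \<sigma>(1) by blast
    have "\<sigma> \<noteq> \<tau>'"
    proof
      assume "\<sigma> = \<tau>'"
      hence "F y \<sigma> = F x' \<tau>'" using F_mono[OF x(3) yD x(4) \<sigma>(1)] F_mono[OF yD x(3) \<sigma>(1) x(4)] by simp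
      thus False using odd x(5) by simp
    qed
    moreover have "\<sigma> < \<tau> + 2 * pi"
    proof (rule ccontr)
      assume "\<not> \<sigma> < \<tau> + 2 * pi"
      hence "F x (\<tau> + 2 * pi * of_int 1) \<le> F y \<sigma>"
        using F_mono[OF x(1) yD _ \<sigma>(1), of "\<tau> + 2 * pi * of_int 1"] lift_add_2pi_iff[of x \<tau> 1] x(2) by simp
      moreover have "F y \<sigma> \<le> F x' (\<tau>' + 2 * pi * of_int 1)"
        using F_mono[OF yD x(3) \<sigma>(1), of "\<tau>' + 2 * pi * of_int 1"] lift_add_2pi_iff[of x' \<tau>' 1] x(4) \<sigma>(3) by simp
      ultimately have "F y \<sigma> = F x \<tau> + N" unfolding F_period using x(5) by simp
      thus False using odd N(2) by simp
    qed
    ultimately have "sin (\<sigma> - \<tau>') > 0" using \<sigma> ge by (intro sin_gt_zero) auto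
    thus ?thesis using nonzero[OF yD] unfolding lift_cross[OF lc \<sigma>(1)] by simp
  qed
  have "(\<Sum>y\<in>E. Im (cnj (cis \<tau>') * y)) > 0" by (rule sum_pos[OF E(2) \<open>E \<noteq> {}\<close> pos])
  moreover have "(\<Sum>y\<in>E. Im (cnj (cis \<tau>') * y)) = Im (cnj (cis \<tau>') * (\<Sum>y\<in>E. y))"
    by (simp only: sum_distrib_left Im_sum)
  ultimately show False using E(1) by simp
qed

lemma ex_line_matching:
  assumes "u \<in> U"
  obtains g where "bij_betw g D1 D2" "\<And>x. x \<in> D1 \<Longrightarrow> partner u x (g x)"
proof -
  obtain g where g: "bij_betw g D1 D2" "\<And>x. x \<in> D1 \<Longrightarrow> Im (cnj u * g x) = Im (cnj u * x)"
    using bij_betw_equal_fibres[OF fin lines[OF assms]] by blast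
  have "partner u x (g x)" if "x \<in> D1" for x
    using g(2)[OF that] bij_betwE[OF g(1)] that by (auto simp: partner_def differ_def D_def)
  thus ?thesis using that g(1) by blast
qed

definition blk :: "complex \<Rightarrow> int" where "blk x = F x (Arg2pi x)"

lemma blk_mod: "x \<in> D \<Longrightarrow> lift x \<tau> \<Longrightarrow> F x \<tau> mod N = blk x mod N"
  unfolding blk_def by (rule F_lift_cong[OF _ _ lift_Arg2pi])

lemma ex_lift_in_block:
  assumes "x \<in> D" "blk x mod N = i mod N"
  obtains \<tau> where "lift x \<tau>" "F x \<tau> = i"
proof -
  obtain k where "i = blk x + N * k" using assms(2) mod_eqE by metis
  hence "F x (Arg2pi x + 2 * pi * of_int k) = i" by (simp add: F_period blk_def)
  thus ?thesis using that lift_add_2pi_iff lift_Arg2pi by blast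
qed

text \<open>If two directions act on the blocks by the same reflection, then corresponding blocks have the
  same vector sum, which is impossible for sectors of angle less than \<open>pi\<close>.\<close>

lemma axis_inj:
  assumes uv: "u \<in> U" "v \<in> U" "u \<noteq> v"
  shows "axis u mod N \<noteq> axis v mod N"
proof
  assume eq: "axis u mod N = axis v mod N"
  obtain x0 where x0: "x0 \<in> D1" using ne by blast
  define i j where "i = blk x0" and "j = axis u - blk x0"
  define Bi Bj where "Bi = {x \<in> D1. blk x mod N = i mod N}" and "Bj = {y \<in> D2. blk y mod N = j mod N}"
  have sum: "(\<Sum>x\<in>Bi. Im (cnj a * x)) = (\<Sum>y\<in>Bj. Im (cnj a * y))" and Bj0: "Bj \<noteq> {}"
    if a: "a \<in> U" "axis a mod N = axis u mod N" for a
  proof -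
    obtain g where g: "bij_betw g D1 D2" "\<And>x. x \<in> D1 \<Longrightarrow> partner a x (g x)"
      using ex_line_matching[OF a(1)] by blast
    have ax: "(blk x + blk (g x)) mod N = axis u mod N" if "x \<in> D1" for x
      using partner_axis[OF a(1) g(2)[OF that] lift_Arg2pi lift_Arg2pi] a(2) by (simp add: blk_def)
    have iff: "blk x mod N = i mod N \<longleftrightarrow> blk (g x) mod N = j mod N" if "x \<in> D1" for x
    proof
      assume "blk x mod N = i mod N"
      from mod_diff_cong[OF ax[OF that] this] show "blk (g x) mod N = j mod N"
        by (simp add: i_def j_def)
    next
      assume "blk (g x) mod N = j mod N"
      from mod_diff_cong[OF ax[OF that] this] show "blk x mod N = i mod N"
        by (simp add: i_def j_def)
    qed
    have bb: "bij_betw g Bi Bj"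
    proof (rule bij_betw_subset[OF g(1)])
      show "Bi \<subseteq> D1" by (auto simp: Bi_def)
      show "g ` Bi = Bj" using bij_betw_imp_surj_on[OF g(1)] iff by (auto simp: Bi_def Bj_def)
    qed
    have "(\<Sum>x\<in>Bi. Im (cnj a * g x)) = (\<Sum>y\<in>Bj. Im (cnj a * y))" by (rule sum.reindex_bij_betw[OF bb])
    moreover have "(\<Sum>x\<in>Bi. Im (cnj a * g x)) = (\<Sum>x\<in>Bi. Im (cnj a * x))"
      by (rule sum.cong) (use g(2) in \<open>auto simp: Bi_def partner_def\<close>)
    ultimately show "(\<Sum>x\<in>Bi. Im (cnj a * x)) = (\<Sum>y\<in>Bj. Im (cnj a * y))" by simp
    have "x0 \<in> Bi" using x0 by (simp add: Bi_def i_def)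
    thus "Bj \<noteq> {}" using bb by (auto simp: bij_betw_def)
  qed
  define s where "s = (\<Sum>x\<in>Bi. x)"
  \<comment> \<open>Two independent directions see equal sums over both blocks, so the vector sums
    agree.\<close>
  have ss: "(\<Sum>y\<in>Bj. y) = s"
  proof -
    define d where "d = (\<Sum>y\<in>Bj. y) - s"
    have "Im (cnj a * d) = 0" if "a \<in> U" "axis a mod N = axis u mod N" for a
    proof -
      have "Im (cnj a * d) = (\<Sum>y\<in>Bj. Im (cnj a * y)) - (\<Sum>x\<in>Bi. Im (cnj a * x))"
        unfolding d_def s_def right_diff_distrib sum_distrib_left minus_complex.sel Im_sum ..
      thus ?thesis using sum[OF that] by simp
    qed
    hence "Im (cnj u * d) = 0" "Im (cnj v * d) = 0" using uv eq by auto
    hence "d = 0" using U(4)[OF uv] by (rule zero_if_two_determinants_0)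
    thus ?thesis by (simp add: d_def)
  qed
  have B: "finite Bi" "Bi \<noteq> {}" "finite Bj" "Bj \<noteq> {}" "Bi \<subseteq> D" "Bj \<subseteq> D"
    using fin x0 Bj0[OF uv(1)] by (auto simp: Bi_def Bj_def i_def D_def)
  have "\<exists>\<tau>. lift x \<tau> \<and> F x \<tau> = i" if "x \<in> Bi" for x
    using ex_lift_in_block[of x i] that B(5) unfolding Bi_def by blast
  then obtain t where t: "\<And>x. x \<in> Bi \<Longrightarrow> lift x (t x)" "\<And>x. x \<in> Bi \<Longrightarrow> F x (t x) = i" by metis
  have "\<exists>\<tau>. lift x \<tau> \<and> F x \<tau> = j" if "x \<in> Bj" for x
    using ex_lift_in_block[of x j] that B(6) unfolding Bj_def by blast
  then obtain r where r: "\<And>x. x \<in> Bj \<Longrightarrow> lift x (r x)" "\<And>x. x \<in> Bj \<Longrightarrow> F x (r x) = j" by metis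
  have mx: "Min (t ` Bi) \<in> t ` Bi" "Max (t ` Bi) \<in> t ` Bi" "Min (r ` Bj) \<in> r ` Bj" "Max (r ` Bj) \<in> r ` Bj"
    using B by simp_all
  from mx(1) obtain xmin where xmin: "xmin \<in> Bi" "Min (t ` Bi) = t xmin" by blast
  from mx(2) obtain xmax where xmax: "xmax \<in> Bi" "Max (t ` Bi) = t xmax" by blast
  from mx(3) obtain ymin where ymin: "ymin \<in> Bj" "Min (r ` Bj) = r ymin" by blast
  from mx(4) obtain ymax where ymax: "ymax \<in> Bj" "Max (r ` Bj) = r ymax" by blast
  note x = xmin(1) xmax(1) xmin(2) xmax(2) and y = ymin(1) ymax(1) ymin(2) ymax(2)
  have "\<exists>\<psi>. \<psi> \<in> {t xmin..t xmax} \<and> lift s \<psi> \<and> s \<noteq> 0" unfolding s_def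
  proof (rule lift_sum[OF B(1,2), of t])
    show "z \<noteq> 0 \<and> lift z (t z) \<and> t z \<in> {t xmin..t xmax}" if "z \<in> Bi" for z
      using that t(1) nonzero B(1,5) Min_le[of "t ` Bi" "t z"] Max_ge[of "t ` Bi" "t z"] by (auto simp: x)
    show "t xmax - t xmin < pi"
      by (rule block_width[of xmin _ xmax]) (use x(1,2) t B(5) in auto)
  qed blast
  then obtain \<psi> where \<psi>: "\<psi> \<in> {t xmin..t xmax}" "lift s \<psi>" "s \<noteq> 0" by blast
  have "\<exists>\<phi>. \<phi> \<in> {r ymin..r ymax} \<and> lift s \<phi>" unfolding ss[symmetric]
  proof (rule lift_sum[OF B(3,4), of r])
    show "z \<noteq> 0 \<and> lift z (r z) \<and> r z \<in> {r ymin..r ymax}" if "z \<in> Bj" for z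
      using that r(1) nonzero B(3,6) Min_le[of "r ` Bj" "r z"] Max_ge[of "r ` Bj" "r z"] by (auto simp: y)
    show "r ymax - r ymin < pi"
      by (rule block_width[of ymin _ ymax]) (use y(1,2) r B(6) in auto)
  qed blast
  then obtain \<phi> where \<phi>: "\<phi> \<in> {r ymin..r ymax}" "lift s \<phi>" by blast
  \<comment> \<open>The common sum \<open>s\<close> lies in the angular range of block
    \<open>i\<close> and, up to \<open>k\<close> turns, of block \<open>j\<close>. Monotonicity
    gives \<open>i = j + N * k\<close>, so \<open>axis u = i + j\<close> would be even; but partners
    differ in colour, so it is odd.\<close>
  obtain k :: int where k: "\<psi> = \<phi> + 2 * pi * of_int k" using lift_unique[OF \<psi>(2) \<phi>(2) \<psi>(3)] by blast
  have l: "lift ymax (r ymax + 2 * pi * of_int k)" "lift ymin (r ymin + 2 * pi * of_int k)"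
    unfolding lift_add_2pi_iff by (rule r(1)[OF y(2)], rule r(1)[OF y(1)])
  have le: "t xmin \<le> r ymax + 2 * pi * of_int k" "r ymin + 2 * pi * of_int k \<le> t xmax"
    using \<psi>(1) \<phi>(1) unfolding k by auto
  have "xmin \<in> D" "xmax \<in> D" "ymin \<in> D" "ymax \<in> D" using x(1,2) y(1,2) B(5,6) by blast+
  note mem = this
  have "F xmin (t xmin) \<le> F ymax (r ymax + 2 * pi * of_int k)"
    by (rule F_mono[OF mem(1,4) t(1)[OF x(1)] l(1) le(1)])
  moreover have "F ymin (r ymin + 2 * pi * of_int k) \<le> F xmax (t xmax)"
    by (rule F_mono[OF mem(3,2) l(2) t(1)[OF x(2)] le(2)])
  ultimately have "i \<le> j + N * k" "j + N * k \<le> i"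
    unfolding F_period t(2)[OF x(1)] t(2)[OF x(2)] r(2)[OF y(1)] r(2)[OF y(2)] .
  moreover have "i + j = axis u" by (simp add: i_def j_def)
  ultimately have "axis u = 2 * j + N * k" by linarith
  moreover have "2 dvd 2 * j + N * k" by (rule dvd_add[OF dvd_triv_left dvd_mult2[OF N(2)]])
  ultimately show False using axis_odd[OF uv(1)] by argo
qed

text \<open>The values \<open>axis u\<close> are odd and distinct modulo the even \<open>N\<close>,
  so only N / 2 residues are available for at least three directions.\<close>

lemma N_gt_4: "N > 4"
proof (rule ccontr)
  assume "\<not> N > 4"
  moreover have "N \<noteq> 1" "N \<noteq> 3" using N(2) by auto
  ultimately have N24: "N = 2 \<or> N = 4" using N(1) by linarith
  have "axis u mod N \<in> {1, 3}" if "u \<in> U" for u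
  proof -
    have "b mod 2 = 1 \<and> (b mod 4 = 1 \<or> b mod 4 = 3)" if "odd b" for b :: int
      using that by presburger
    from this[OF axis_odd[OF that]] show ?thesis using N24 by (elim disjE) simp_all
  qed
  hence "(\<lambda>u. axis u mod N) ` U \<subseteq> {1, 3}" by (rule image_subsetI)
  hence "card ((\<lambda>u. axis u mod N) ` U) \<le> card {1, 3 :: int}" by (rule card_mono[rotated]) simp
  moreover have "inj_on (\<lambda>u. axis u mod N) U"
    by (rule inj_onI, rule ccontr) (erule (3) notE[OF axis_inj, rotated 3])
  ultimately show False using U(2) by (simp add: card_image)
qed

end

lemma cos_le_cos_outside:
  assumes "0 \<le> a" "a \<le> pi" "a \<le> t" "t \<le> 2 * pi - a"
  shows "cos t \<le> cos a" "cos t = cos a \<Longrightarrow> t = a \<or> t = 2 * pi - a"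
proof -
  define s where "s = (if t \<le> pi then t else 2 * pi - t)"
  have s: "a \<le> s" "s \<le> pi" "cos s = cos t" using assms by (auto simp: s_def cos_diff)
  show "cos t \<le> cos a" using cos_monotone_0_pi_le[OF assms(1) s(1,2)] s(3) by simp
  assume "cos t = cos a"
  hence "s = a" using cos_inj_pi[of s a] s assms by simp
  thus "t = a \<or> t = 2 * pi - a" by (auto simp: s_def split: if_splits)
qed

lemma cos_ge_cos_inside:
  assumes "a \<le> pi" "\<bar>t\<bar> \<le> a"
  shows "cos t \<ge> cos a" "cos t = cos a \<Longrightarrow> \<bar>t\<bar> = a"
  using cos_monotone_0_pi_le[of "\<bar>t\<bar>" a] cos_inj_pi[of "\<bar>t\<bar>" a] assms by auto

context tomography_blocks
begin

lemma cis_block_cong: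
  assumes "a mod N = b mod N"
  shows "cis (2 * pi * of_int a / of_int N) = cis (2 * pi * of_int b / of_int N)"
proof -
  obtain k where k: "a = b + N * k" using assms mod_eqE by metis
  have "2 * pi * of_int a / of_int N = 2 * pi * of_int b / of_int N + 2 * pi * of_int k"
    using N(1) by (simp add: k field_simps)
  thus ?thesis using cis_multiple_2pi[of "of_int k"] by (simp add: mult_ac flip: cis_mult)
qed

definition W where "W x = cis (2 * pi * of_int (blk x) / of_int N)"

definition \<Phi> where "\<Phi> u = (\<Sum>x\<in>D. of_real (Im (cnj u * x)) * W x)"

lemma Phi_linear: "\<Phi> u = of_real (Re u) * \<Phi> 1 + of_real (Im u) * \<Phi> \<i>"
  unfolding \<Phi>_def sum_distrib_left sum.distrib [symmetric]
  by (rule sum.cong) (simp_all add: algebra_simps)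

text \<open>Partners have equal determinants with \<open>u\<close>, and their unimodular weights
  multiply to the root of unity of \<open>axis u\<close>. So the sum over \<open>D1\<close> is that
  root times the conjugate of the sum over \<open>D2\<close>, and vice versa.\<close>

lemma Phi_axis:
  assumes "u \<in> U"
  shows "\<Phi> u = cis (2 * pi * of_int (axis u) / of_int N) * cnj (\<Phi> u)"
proof -
  define \<omega> where "\<omega> = cis (2 * pi * of_int (axis u) / of_int N)"
  define h where "h x = complex_of_real (Im (cnj u * x))" for x
  obtain g where g: "bij_betw g D1 D2" "\<And>x. x \<in> D1 \<Longrightarrow> partner u x (g x)"
    using ex_line_matching[OF assms] by blast
  have W1: "W x * W (g x) = \<omega>" if "x \<in> D1" for x
  proof -
    have "W x * W (g x) = cis (2 * pi * of_int (blk x + blk (g x)) / of_int N)"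
      by (simp add: W_def cis_mult ring_distribs add_divide_distrib)
    also have "\<dots> = \<omega>" unfolding \<omega>_def
      using partner_axis[OF assms g(2)[OF that] lift_Arg2pi lift_Arg2pi]
      by (intro cis_block_cong) (simp add: blk_def)
    finally show ?thesis .
  qed
  have unit: "W x * cnj (W x) = 1" for x by (simp add: W_def cis_cnj cis_mult)
  have Wa: "W x = \<omega> * cnj (W (g x))" and Wb: "W (g x) = \<omega> * cnj (W x)" if "x \<in> D1" for x
  proof -
    have "\<omega> * cnj (W (g x)) = W x * (W (g x) * cnj (W (g x)))" using W1[OF that] by simp
    thus "W x = \<omega> * cnj (W (g x))" by (simp add: unit)
    have "\<omega> * cnj (W x) = W (g x) * (W x * cnj (W x))" using W1[OF that] by (simp add: mult_ac)
    thus "W (g x) = \<omega> * cnj (W x)" by (simp add: unit)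
  qed
  have hg: "h (g x) = h x" if "x \<in> D1" for x using g(2)[OF that] by (simp add: h_def partner_def)
  have re: "(\<Sum>x\<in>D1. f (g x)) = (\<Sum>y\<in>D2. f y)" for f :: "complex \<Rightarrow> complex"
    by (rule sum.reindex_bij_betw[OF g(1)])
  have "(\<Sum>x\<in>D1. h x * W x) = (\<Sum>x\<in>D1. \<omega> * (h (g x) * cnj (W (g x))))"
    by (rule sum.cong[OF refl]) (metis Wa hg mult.left_commute)
  also have "\<dots> = \<omega> * (\<Sum>y\<in>D2. h y * cnj (W y))" unfolding sum_distrib_left by (rule re)
  finally have A: "(\<Sum>x\<in>D1. h x * W x) = \<omega> * (\<Sum>y\<in>D2. h y * cnj (W y))" .
  have "(\<Sum>y\<in>D2. h y * W y) = (\<Sum>x\<in>D1. h (g x) * W (g x))" by (rule re[symmetric])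
  also have "\<dots> = (\<Sum>x\<in>D1. \<omega> * (h x * cnj (W x)))"
    by (rule sum.cong[OF refl]) (metis Wb hg mult.left_commute)
  finally have B: "(\<Sum>y\<in>D2. h y * W y) = \<omega> * (\<Sum>x\<in>D1. h x * cnj (W x))"
    by (simp add: sum_distrib_left)
  have dj: "D1 \<inter> D2 = {}" using disjD by blast
  have P: "\<Phi> u = (\<Sum>x\<in>D1. h x * W x) + (\<Sum>y\<in>D2. h y * W y)"
    unfolding \<Phi>_def D_def h_def by (rule sum.union_disjoint[OF fin dj])
  have "cnj (\<Phi> u) = (\<Sum>x\<in>D1. h x * cnj (W x)) + (\<Sum>y\<in>D2. h y * cnj (W y))"
    unfolding P by (simp add: cnj_sum h_def)
  thus ?thesis unfolding P A B \<omega>_def [symmetric] by (simp add: algebra_simps)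
qed

text \<open>If \<open>\<Phi> v = 0\<close>, a trigonometric polynomial of degree 1 in the block index whose signs agree with the
  sides of the line through 0 in direction \<open>v\<close> has only zero terms; all blocks off this line then
  have one of two indices, and at most two more blocks lie on the line.\<close>

lemma Phi_nonzero:
  assumes v: "v \<in> U"
  shows "\<Phi> v \<noteq> 0"
proof
  assume P0: "\<Phi> v = 0"
  have v0: "v \<noteq> 0" using v U(3) by blast
  \<comment> \<open>Arguments are measured from \<open>v\<close>, so the two sides of the line are
    given by values below and above \<open>pi\<close>, and each side occupies a range of block
    indices.\<close>
  define a where "a x = Arg2pi (x / v)" for x
  define \<tau> where "\<tau> x = Arg2pi v + a x" for x
  define f where "f x = F x (\<tau> x)" for x
  define H where "H x = Im (cnj v * x)" for x
  have lt: "lift x (\<tau> x)" for x unfolding \<tau>_def a_def by (rule lift_relative[OF v0])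
  have ar: "0 \<le> a x" "a x < 2 * pi" for x using Arg2pi[of "x / v"] by (auto simp: a_def)
  have Hs: "H x = cmod v * cmod x * sin (a x)" for x
    unfolding H_def lift_cross[OF lift_Arg2pi lt] by (simp add: \<tau>_def)
  have cv: "cmod v > 0" using v0 by simp
  have cx: "cmod x > 0" if "x \<in> D" for x using nonzero[OF that] by simp
  have W: "W x = cis (2 * pi * of_int (f x) / of_int N)" if "x \<in> D" for x
    unfolding W_def f_def by (rule cis_block_cong) (simp add: blk_mod[OF that lt])
  have fm: "f x \<le> f y" if "x \<in> D" "y \<in> D" "a x \<le> a y" for x y
    unfolding f_def by (rule F_mono[OF that(1,2) lt lt]) (use that in \<open>simp add: \<tau>_def\<close>)
  have fm2: "f x \<le> f y + N" if "x \<in> D" "y \<in> D" for x y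
  proof -
    have "F x (\<tau> x) \<le> F y (\<tau> y + 2 * pi * of_int 1)"
      by (rule F_mono[OF that(1,2) lt]) (use lt ar[of x] ar[of y] in \<open>auto simp: lift_add_2pi_iff \<tau>_def simp del: of_int_1\<close>)
    thus ?thesis unfolding F_period f_def by simp
  qed
  define Pos Neg where "Pos = {x\<in>D. H x > 0}" and "Neg = {x\<in>D. H x < 0}"
  have sumH: "(\<Sum>x\<in>D. H x) = 0"
  proof -
    have dj: "D1 \<inter> D2 = {}" using disjD by blast
    have "(\<Sum>x\<in>D. x) = 0" unfolding D_def sum.union_disjoint[OF fin dj] using sums by simp
    moreover have "(\<Sum>x\<in>D. H x) = Im (cnj v * (\<Sum>x\<in>D. x))"
      by (simp only: H_def sum_distrib_left Im_sum)
    ultimately show ?thesis by simp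
  qed
  have notall0: "\<exists>x\<in>D. H x \<noteq> 0"
  proof (rule ccontr)
    assume "\<not> ?thesis"
    hence all: "H x = 0" if "x \<in> D" for x using that by blast
    obtain u where u: "u \<in> U" "u \<noteq> v"
    proof -
      have "\<not> U \<subseteq> {v}" using U(2) card_mono[of "{v}" U] by auto
      thus ?thesis using that by blast
    qed
    obtain x where x: "x \<in> D" using ne by (auto simp: D_def)
    obtain y where y: "partner u x y" using ex_partner[OF u(1) x] by blast
    have yD: "y \<in> D" using y by (auto simp: partner_def differ_def)
    define d where "d = x - y"
    have "Im (cnj u * d) = 0" "Im (cnj v * d) = 0"
      using y all[OF x] all[OF yD] by (simp_all add: d_def partner_def H_def right_diff_distrib)
    hence "d = 0" using U(4)[OF u(1) v u(2)] by (rule zero_if_two_determinants_0)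
    hence "x = y" by (simp add: d_def)
    thus False using y disjD by (auto simp: partner_def differ_def D_def)
  qed
  have Pos0: "Pos \<noteq> {}"
  proof
    assume "Pos = {}"
    hence "\<forall>x\<in>D. - H x \<ge> 0" by (force simp: Pos_def)
    moreover have "(\<Sum>x\<in>D. - H x) = 0" using sumH by (simp add: sum_negf)
    ultimately have "\<forall>x\<in>D. - H x = 0" using sum_nonneg_eq_0_iff[OF finD, of "\<lambda>x. - H x"] by blast
    thus False using notall0 by simp
  qed
  have Neg0: "Neg \<noteq> {}"
  proof
    assume "Neg = {}"
    hence "\<forall>x\<in>D. H x \<ge> 0" by (force simp: Neg_def)
    hence "\<forall>x\<in>D. H x = 0" using sum_nonneg_eq_0_iff[OF finD, of H] sumH by blast
    thus False using notall0 by simp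
  qed
  have fin': "finite Pos" "finite Neg" using finD by (auto simp: Pos_def Neg_def)
  have aPos: "a x < pi" if "x \<in> Pos" for x
  proof (rule ccontr)
    assume "\<not> a x < pi"
    hence "sin (a x) \<le> 0" using ar[of x] by (intro sin_le_zero) auto
    hence "H x \<le> 0" unfolding Hs by (intro mult_nonneg_nonpos) auto
    thus False using that by (simp add: Pos_def)
  qed
  have aNeg: "pi < a x" if "x \<in> Neg" for x
  proof (rule ccontr)
    assume "\<not> pi < a x"
    hence "sin (a x) \<ge> 0" using ar[of x] by (intro sin_ge_zero) auto
    hence "H x \<ge> 0" unfolding Hs by simp
    thus False using that by (simp add: Neg_def)
  qed
  define m1 M1 where "m1 = Min (f ` Pos)" and "M1 = Max (f ` Pos)"
  have "m1 \<in> f ` Pos" "M1 \<in> f ` Pos" using Pos0 fin' by (simp_all add: m1_def M1_def)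
  then obtain p1 p2 where p: "p1 \<in> Pos" "f p1 = m1" "p2 \<in> Pos" "f p2 = M1" by auto
  have pD: "p1 \<in> D" "p2 \<in> D" using p by (auto simp: Pos_def)
  have fPos: "m1 \<le> f x" "f x \<le> M1" if "x \<in> Pos" for x
    using that fin' by (auto simp: m1_def M1_def)
  have fNeg: "M1 \<le> f x" "f x \<le> m1 + N" if "x \<in> Neg" for x
  proof -
    have xD: "x \<in> D" using that by (auto simp: Neg_def)
    show "M1 \<le> f x" using fm[OF pD(2) xD] aPos[OF p(3)] aNeg[OF that] p(4) by simp
    show "f x \<le> m1 + N" using fm2[OF xD pD(1)] p(2) by simp
  qed
  have m1M1: "m1 \<le> M1" using fPos[OF p(1)] by simp
  obtain q where q: "q \<in> Neg" using Neg0 by blast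
  have M1N: "M1 \<le> m1 + N" using fNeg[OF q] by simp
  \<comment> \<open>With these constants \<open>G\<close> vanishes at the extreme indices
    \<open>m1\<close> and \<open>M1\<close> of the positive side, is nonnegative between them and
    nonpositive on the rest of the period, matching the signs of \<open>H\<close>.\<close>
  define mid where "mid = (real_of_int m1 + M1) / 2"
  define \<alpha> where "\<alpha> = pi * (M1 - m1) / N"
  define \<theta> where "\<theta> x = 2 * pi * (f x - mid) / N" for x
  define G where "G x = cos (\<theta> x) - cos \<alpha>" for x
  have Np: "real_of_int N > 0" using N(1) by simp
  have \<alpha>: "0 \<le> \<alpha>" "\<alpha> \<le> pi"
  proof -
    show "0 \<le> \<alpha>" using m1M1 Np by (simp add: \<alpha>_def)
    have "real_of_int (M1 - m1) \<le> N" using M1N by (simp only: of_int_le_iff) 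
    hence "pi * (M1 - m1) \<le> pi * N" by (intro mult_left_mono) auto
    thus "\<alpha> \<le> pi" using Np by (simp add: \<alpha>_def divide_simps)
  qed
  have scale: "2 * pi * c / N \<le> 2 * pi * d / N \<longleftrightarrow> c \<le> d" "2 * pi * c / N = 2 * pi * d / N \<longleftrightarrow> c = d" for c d :: real
    using Np by (simp_all add: divide_simps)
  have \<alpha>': "\<alpha> = 2 * pi * ((real_of_int M1 - m1) / 2) / N" "2 * pi - \<alpha> = 2 * pi * (N - (real_of_int M1 - m1) / 2) / N"
    "- \<alpha> = 2 * pi * (- ((real_of_int M1 - m1) / 2)) / N"
    using Np by (simp_all add: \<alpha>_def field_simps)
  have posG: "G x \<ge> 0 \<and> (G x = 0 \<longrightarrow> f x = m1 \<or> f x = M1)" if "x \<in> Pos" for x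
  proof -
    have "\<theta> x \<le> \<alpha>" unfolding \<alpha>'(1) \<theta>_def scale
      using fPos[OF that] by (simp add: mid_def field_simps)
    moreover have "- \<alpha> \<le> \<theta> x" unfolding \<alpha>'(3) \<theta>_def scale
      using fPos[OF that] by (simp add: mid_def field_simps)
    ultimately have ab: "\<bar>\<theta> x\<bar> \<le> \<alpha>" by simp
    have "\<theta> x = \<alpha> \<longleftrightarrow> f x = M1" unfolding \<alpha>'(1) \<theta>_def scale
      by (simp add: mid_def field_simps)
    moreover have "\<theta> x = - \<alpha> \<longleftrightarrow> f x = m1" unfolding \<alpha>'(3) \<theta>_def scale
      by (simp add: mid_def field_simps)
    ultimately show ?thesis using cos_ge_cos_inside[OF \<alpha>(2) ab] by (auto simp: G_def abs_if split: if_splits)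
  qed
  have negG: "G x \<le> 0 \<and> (G x = 0 \<longrightarrow> f x = M1 \<or> f x = m1 + N)" if "x \<in> Neg" for x
  proof -
    have b1: "\<alpha> \<le> \<theta> x" unfolding \<alpha>'(1) \<theta>_def scale
      using fNeg[OF that] by (simp add: mid_def field_simps)
    have b2: "\<theta> x \<le> 2 * pi - \<alpha>" unfolding \<alpha>'(2) \<theta>_def scale
      using fNeg[OF that] by (simp add: mid_def field_simps)
    have "\<theta> x = \<alpha> \<longleftrightarrow> f x = M1" unfolding \<alpha>'(1) \<theta>_def scale
      by (simp add: mid_def field_simps)
    moreover have "\<theta> x = 2 * pi - \<alpha> \<longleftrightarrow> real_of_int (f x) = real_of_int (m1 + N)" unfolding \<alpha>'(2) \<theta>_def scale
      by (simp add: mid_def field_simps) (rule iffI; linarith)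
    ultimately show ?thesis using cos_le_cos_outside[OF \<alpha> b1 b2] by (auto simp: G_def)
  qed
  \<comment> \<open>\<open>\<Phi> v = 0\<close>, rotated by the angle of \<open>mid\<close>, kills
    the cosine part of \<open>G\<close>; the constant part is killed by the centroid.\<close>
  have "(\<Sum>x\<in>D. H x * cos (\<theta> x)) = 0"
  proof -
    have "cis (- 2 * pi * mid / N) * \<Phi> v = (\<Sum>x\<in>D. of_real (H x) * cis (\<theta> x))"
      unfolding \<Phi>_def sum_distrib_left
    proof (rule sum.cong[OF refl])
      fix x assume x: "x \<in> D"
      have "cis (- 2 * pi * mid / N) * W x = cis (\<theta> x)"
        unfolding W[OF x] cis_mult \<theta>_def by (simp add: field_simps diff_divide_distrib)
      thus "cis (- 2 * pi * mid / N) * (of_real (Im (cnj v * x)) * W x) = of_real (H x) * cis (\<theta> x)"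
        by (simp add: H_def mult.left_commute)
    qed
    hence "(\<Sum>x\<in>D. of_real (H x) * cis (\<theta> x)) = 0" using P0 by simp
    from arg_cong[OF this, of Re] show ?thesis by simp
  qed
  moreover have "(\<Sum>x\<in>D. H x * G x) = (\<Sum>x\<in>D. H x * cos (\<theta> x)) - (\<Sum>x\<in>D. H x) * cos \<alpha>"
    by (simp add: G_def right_diff_distrib sum_subtractf sum_distrib_right)
  ultimately have "(\<Sum>x\<in>D. H x * G x) = 0" using sumH by simp
  moreover have nn: "H x * G x \<ge> 0" if xD: "x \<in> D" for x
  proof -
    consider "x \<in> Pos" | "x \<in> Neg" | "H x = 0"
      using xD linorder_less_linear[of "H x" 0] by (auto simp: Pos_def Neg_def)
    thus ?thesis
    proof cases
      case 1 thus ?thesis using posG by (simp add: Pos_def)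
    next
      case 2 thus ?thesis using negG by (simp add: Neg_def mult_nonpos_nonpos)
    qed simp
  qed
  ultimately have zero: "H x * G x = 0" if "x \<in> D" for x
    using sum_nonneg_eq_0_iff[OF finD, of "\<lambda>x. H x * G x"] that by blast
  have res: "f x mod N \<in> {m1 mod N, M1 mod N}" if "x \<in> D" "H x \<noteq> 0" for x
  proof -
    have "G x = 0" using zero[OF that(1)] that(2) by simp
    hence "f x \<in> {m1, M1, m1 + N}" using posG[of x] negG[of x] that by (fastforce simp: Pos_def Neg_def)
    thus ?thesis by auto
  qed
  \<comment> \<open>Points on the line lie on two rays, each inside one block. With the two residues
    from \<open>res\<close>, at most four residues modulo \<open>N\<close> would occur.\<close>
  define Z where "Z c = {x\<in>D. a x = c}" for c
  have one: "\<exists>c. f ` Z b \<subseteq> {c}" for b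
  proof (cases "Z b = {}")
    case False
    then obtain z where z: "z \<in> Z b" by blast
    have "f x = f z" if "x \<in> Z b" for x
      using fm[of x z] fm[of z x] that z by (simp add: Z_def)
    thus ?thesis by blast
  qed simp
  obtain c0 where c0: "f ` Z 0 \<subseteq> {c0}" using one by blast
  obtain c1 where c1: "f ` Z pi \<subseteq> {c1}" using one by blast
  have "{0..<N} \<subseteq> {m1 mod N, M1 mod N, c0 mod N, c1 mod N}"
  proof
    fix w assume w: "w \<in> {0..<N}"
    obtain x \<sigma> where x: "x \<in> D" "lift x \<sigma>" "F x \<sigma> = w" using F_onto by blast
    have fw: "f x mod N = w" using F_lift_cong[OF x(1) lt x(2)] x(3) w by (simp add: f_def)
    show "w \<in> {m1 mod N, M1 mod N, c0 mod N, c1 mod N}"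
    proof (cases "H x = 0")
      case False
      thus ?thesis using res[OF x(1)] fw by auto
    next
      case True
      hence "sin (a x) = 0" unfolding Hs using cv cx[OF x(1)] by simp
      then obtain i :: int where i: "a x = of_int i * pi" using sin_zero_iff_int2 by blast
      have "0 * pi \<le> of_int i * pi" "of_int i * pi < of_int 2 * pi" using ar[of x] unfolding i by simp_all
      hence "0 \<le> i" "i < 2" using pi_gt_zero by (auto simp: mult_less_cancel_right zero_le_mult_iff)
      hence "i = 0 \<or> i = 1" by linarith
      hence "x \<in> Z 0 \<or> x \<in> Z pi" using i x(1) by (auto simp: Z_def)
      hence "f x = c0 \<or> f x = c1" using c0 c1 by blast
      thus ?thesis using fw by blast
    qed
  qed
  hence "card {0..<N} \<le> card {m1 mod N, M1 mod N, c0 mod N, c1 mod N}" by (rule card_mono[rotated]) simp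
  also have "\<dots> \<le> 4" by (simp add: card_insert_if)
  finally show False using N_gt_4 by simp
qed

text \<open>On \<open>U\<close> the root is \<open>\<Phi> u / cnj (\<Phi> u)\<close>. A difference
  of two roots is thus the determinant of two values of the real-linear \<open>\<Phi>\<close>, hence
  \<open>\<kappa>\<close> times that of the directions, over conjugate factors. Each such factor
  occurs once on either side and cancels.\<close>

lemma ex_root_directions:
  "\<exists>z :: complex \<Rightarrow> complex. inj_on z U \<and> (\<forall>u\<in>U. z u ^ nat N = 1) \<and>
     (\<forall>a\<in>U. \<forall>b\<in>U. \<forall>c\<in>U. \<forall>d\<in>U.
        of_real (Im (cnj a * b) * Im (cnj c * d)) * ((z a - z c) * (z b - z d)) =
        of_real (Im (cnj a * c) * Im (cnj b * d)) * ((z a - z b) * (z c - z d)))"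
proof -
  define z where "z u = cis (2 * pi * of_int (axis u) / of_int N)" for u
  define \<kappa> where "\<kappa> = Im (cnj (\<Phi> 1) * \<Phi> \<i>)"
  have "inj_on z U"
  proof (rule inj_onI, rule ccontr)
    fix u v assume uv: "u \<in> U" "v \<in> U" "z u = z v" "u \<noteq> v"
    have "cis (2 * pi * of_int (axis u - axis v) / of_int N) = z u / z v"
      by (simp add: z_def cis_divide diff_divide_distrib right_diff_distrib)
    also have "\<dots> = 1" using uv(3) by (simp add: z_def)
    finally have "cos (2 * pi * of_int (axis u - axis v) / of_int N) = 1" by (simp add: complex_eq_iff)
    then obtain k :: int where "2 * pi * of_int (axis u - axis v) / of_int N = of_int k * 2 * pi"
      using cos_one_2pi_int by blast
    hence "2 * pi * of_int (axis u - axis v) = 2 * pi * of_int (k * N)"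
      using N(1) by (simp add: field_simps)
    hence "real_of_int (axis u - axis v) = of_int (k * N)" by (simp only: mult_cancel_left) simp
    hence "axis u - axis v = k * N" by (simp only: of_int_eq_iff)
    hence "axis u mod N = axis v mod N" by (metis dvd_triv_right mod_eq_dvd_iff)
    thus False using axis_inj[OF uv(1,2,4)] by simp
  qed
  moreover have "z u ^ nat N = 1" for u
  proof -
    have "z u ^ nat N = cis (2 * pi * of_int (axis u))" using N(1) by (simp add: z_def Complex.DeMoivre)
    thus ?thesis using cis_multiple_2pi[of "of_int (axis u)"] by simp
  qed
  moreover have "of_real (Im (cnj a * b) * Im (cnj c * d)) * ((z a - z c) * (z b - z d)) =
        of_real (Im (cnj a * c) * Im (cnj b * d)) * ((z a - z b) * (z c - z d))"
    if U: "a \<in> U" "b \<in> U" "c \<in> U" "d \<in> U" for a b c d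
  proof -
    have nz: "cnj (\<Phi> u) \<noteq> 0" if "u \<in> U" for u using Phi_nonzero[OF that] by simp
    have zu: "z u = \<Phi> u / cnj (\<Phi> u)" if "u \<in> U" for u
      using Phi_axis[OF that] nz[OF that] by (simp add: z_def field_simps)
    have det: "\<Phi> u * cnj (\<Phi> v) - \<Phi> v * cnj (\<Phi> u) = - 2 * \<i> * of_real (\<kappa> * Im (cnj u * v))" for u v
      unfolding Phi_linear[of u] Phi_linear[of v] by (simp add: \<kappa>_def complex_eq_iff algebra_simps)
    have diff: "z u - z v = - 2 * \<i> * of_real (\<kappa> * Im (cnj u * v)) / (cnj (\<Phi> u) * cnj (\<Phi> v))"
      if "u \<in> U" "v \<in> U" for u v
      unfolding det [symmetric] zu[OF that(1)] zu[OF that(2)] using nz[OF that(1)] nz[OF that(2)]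
      by (simp add: field_simps)
    define I where "I u v = Im (cnj u * v)" for u v
    show ?thesis unfolding diff[OF U(1,3)] diff[OF U(2,4)] diff[OF U(1,2)] diff[OF U(3,4)] I_def [symmetric]
      by (simp add: mult_ac)
  qed
  ultimately show ?thesis by blast
qed

end

theorem (in tomography) ex_roots_of_unity_for_directions:
  obtains M :: nat and z :: "complex \<Rightarrow> complex" where "M > 0" "inj_on z U" "\<And>u. u \<in> U \<Longrightarrow> z u ^ M = 1"
    "\<And>a b c d. a \<in> U \<Longrightarrow> b \<in> U \<Longrightarrow> c \<in> U \<Longrightarrow> d \<in> U \<Longrightarrow>
        of_real (Im (cnj a * b) * Im (cnj c * d)) * ((z a - z c) * (z b - z d)) =
        of_real (Im (cnj a * c) * Im (cnj b * d)) * ((z a - z b) * (z c - z d))"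
proof (rule ex_block_index)
  fix N :: int and F :: "complex \<Rightarrow> real \<Rightarrow> int"
  assume NF: "N > 0" "even N"
    "\<And>x \<tau> y \<sigma>. x \<in> D \<Longrightarrow> y \<in> D \<Longrightarrow> lift x \<tau> \<Longrightarrow> lift y \<sigma> \<Longrightarrow> \<tau> \<le> \<sigma> \<Longrightarrow> F x \<tau> \<le> F y \<sigma>"
    "\<And>x \<tau> k. F x (\<tau> + 2 * pi * of_int k) = F x \<tau> + N * k"
    "\<And>x \<tau> y \<sigma>. x \<in> D \<Longrightarrow> y \<in> D \<Longrightarrow> lift x \<tau> \<Longrightarrow> lift y \<sigma> \<Longrightarrow> differ x y \<longleftrightarrow> odd (F x \<tau> + F y \<sigma>)"
    "\<And>v. \<exists>x\<in>D. \<exists>\<tau>. lift x \<tau> \<and> F x \<tau> = v"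
  interpret tomography_blocks D1 D2 P1 P2 U N F
  proof (unfold_locales, goal_cases)
    case 1 show ?case by (fact NF(1))
  next
    case 2 show ?case by (fact NF(2))
  next
    case 3 thus ?case by (rule NF(3))
  next
    case 4 show ?case by (fact NF(4))
  next
    case 5 thus ?case by (rule NF(5))
  next
    case 6 show ?case by (fact NF(6))
  qed
  from ex_root_directions obtain z :: "complex \<Rightarrow> complex" where z: "inj_on z U" "\<forall>u\<in>U. z u ^ nat N = 1"
     "\<forall>a\<in>U. \<forall>b\<in>U. \<forall>c\<in>U. \<forall>d\<in>U.
        of_real (Im (cnj a * b) * Im (cnj c * d)) * ((z a - z c) * (z b - z d)) =
        of_real (Im (cnj a * c) * Im (cnj b * d)) * ((z a - z b) * (z c - z d))"
    by (elim exE conjE) (rule that)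
  show ?thesis
  proof (rule that[of "nat N" z])
    show "nat N > 0" using NF(1) by simp
    show "inj_on z U" by (fact z(1))
  qed (rule z(2)[rule_format] z(3)[rule_format]; assumption)+
qed

section \<open>Dihedral orbits\<close>

text \<open>The quotient of \<open>a + x\<close> by its conjugate is injective in the integer
  \<open>a\<close>, so it avoids the finitely many N-th roots of unity for some \<open>a\<close>:
  that point lies on no mirror line of the dihedral group.\<close>

lemma ex_generic_translate:
  assumes "Im x \<noteq> 0" "N > 0"
  obtains a :: int where "\<And>z. z ^ N = 1 \<Longrightarrow> of_int a + x \<noteq> z * (of_int a + cnj x)"
proof -
  define f where "f a = (of_int a + x) / (of_int a + cnj x)" for a :: int
  have nz: "of_int a + cnj x \<noteq> 0" for a :: int using assms(1) by (auto simp: complex_eq_iff)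
  have xc: "x - cnj x \<noteq> 0" using assms(1) by (auto simp: complex_eq_iff)
  have "inj f"
  proof (rule injI)
    fix a b assume "f a = f b"
    hence "(of_int a + x) * (of_int b + cnj x) = (of_int b + x) * (of_int a + cnj x)"
      using nz[of a] nz[of b] by (simp add: f_def field_simps)
    hence "(of_int b - of_int a) * (x - cnj x) = 0" by (simp add: algebra_simps)
    hence "of_int b - (of_int a :: complex) = 0" using xc by simp
    thus "a = b" by simp
  qed
  hence "infinite (range f)" using infinite_UNIV_int finite_imageD by blast
  hence "\<not> range f \<subseteq> {z. z ^ N = 1}" using finite_roots_unity[of N] assms(2) finite_subset
    by (metis One_nat_def Suc_leI)
  then obtain a where a: "f a ^ N \<noteq> 1" by blast
  have "of_int a + x \<noteq> z * (of_int a + cnj x)" if "z ^ N = 1" for z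
  proof
    assume "of_int a + x = z * (of_int a + cnj x)"
    hence "f a = z" using nz[of a] by (simp add: f_def)
    thus False using a that by simp
  qed
  thus ?thesis by (rule that)
qed

lemma xray_swap:
  assumes "finite D1" "finite D2" "D1 \<inter> D2 = {}" "D1 \<subseteq> G" "D2 \<subseteq> G"
    and eq: "\<And>l. l \<in> lines_in_direction u \<Longrightarrow> card (D1 \<inter> l) = card (D2 \<inter> l)"
  shows "xray u (G - D2) = xray u (G - D1)"
  unfolding xray_def
proof (rule restrict_ext)
  fix l assume l: "l \<in> lines_in_direction u"
  define R where "R = (G - D1 - D2) \<inter> l"
  have s: "(G - D2) \<inter> l = R \<union> (D1 \<inter> l)" "(G - D1) \<inter> l = R \<union> (D2 \<inter> l)"
    using assms(3-5) by (auto simp: R_def)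
  show "card ((G - D2) \<inter> l) = card ((G - D1) \<inter> l)"
  proof (cases "finite R")
    case True
    have "card (R \<union> (D1 \<inter> l)) = card R + card (D1 \<inter> l)" "card (R \<union> (D2 \<inter> l)) = card R + card (D2 \<inter> l)"
      by (rule card_Un_disjoint; use True assms(1,2) in \<open>auto simp: R_def\<close>)+
    thus ?thesis unfolding s using eq[OF l] by simp
  next
    \<comment> \<open>\<open>card\<close> of an infinite set is 0, so both sides vanish.\<close>
    case False
    thus ?thesis unfolding s by simp
  qed
qed

text \<open>An orbit of the dihedral group of order \<open>2 * N\<close> on a circle is the vertex set of a convex
  polygon; the reflections of the group pair its points along lines in \<open>N\<close> directions and
  exchange the two orbits of the rotation subgroup.\<close>

lemma not_directions_suffice_if_dihedral_orbit:
  fixes L :: "complex \<Rightarrow> complex"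
  assumes L: "linear L" "inj L" and m: "m \<le> N" "m > 0"
    and \<alpha>: "\<And>z. z ^ N = 1 \<Longrightarrow> \<alpha> \<noteq> z * cnj \<alpha>"
    and pts: "\<And>k. k < N \<Longrightarrow> s + L (root_of_unity N ^ k * \<alpha>) \<in> \<Lambda>"
      "\<And>k. k < N \<Longrightarrow> s + L (root_of_unity N ^ k * cnj \<alpha>) \<in> \<Lambda>"
  shows "\<not> directions_suffice \<Lambda> m"
proof
  assume suff: "directions_suffice \<Lambda> m"
  have N: "N > 0" using m by simp
  define \<xi> where "\<xi> = root_of_unity N"
  define S where "S a = (\<lambda>k. \<xi> ^ k * a) ` {..<N}" for a
  have \<xi>N: "\<xi> ^ N = 1" using N by (simp add: \<xi>_def)
  have inS: "\<xi> ^ k * a \<in> S a" for k a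
  proof -
    have "\<xi> ^ k = (\<xi> ^ N) ^ (k div N) * \<xi> ^ (k mod N)" by (simp flip: power_mult power_add)
    hence "\<xi> ^ k = \<xi> ^ (k mod N)" by (simp add: \<xi>N)
    moreover have "k mod N \<in> {..<N}" using N by simp
    ultimately show ?thesis unfolding S_def by (intro image_eqI[of _ _ "k mod N"]) simp_all
  qed
  have cxi: "cnj \<xi> = \<xi> ^ (N - 1)"
  proof -
    have "\<xi> * \<xi> ^ (N - 1) = 1" using \<xi>N N by (metis power_Suc Suc_pred')
    hence "\<xi> ^ (N - 1) = inverse \<xi>" by (metis inverse_unique)
    thus ?thesis by (simp add: \<xi>_def cnj_root_of_unity)
  qed
  have refl: "\<xi> ^ k * cnj z \<in> S (cnj a)" if z: "z \<in> S a" for z a k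
  proof -
    obtain j where "z = \<xi> ^ j * a" using z by (auto simp: S_def)
    hence "\<xi> ^ k * cnj z = \<xi> ^ (k + (N - 1) * j) * cnj a" by (simp add: cxi power_add power_mult)
    thus ?thesis using inS by simp
  qed
  have refl2: "\<xi> ^ k * cnj (\<xi> ^ k * cnj z) = z" for k z
  proof -
    have "\<xi> * cnj \<xi> = 1" by (simp add: \<xi>_def complex_norm_square [symmetric])
    hence "\<xi> ^ k * cnj \<xi> ^ k = 1" by (metis power_mult_distrib power_one)
    thus ?thesis by (simp add: mult.assoc [symmetric])
  qed
  have finS: "finite (S a)" for a by (simp add: S_def)
  have disS: "S \<alpha> \<inter> S (cnj \<alpha>) = {}"
  proof (rule ccontr)
    assume "S \<alpha> \<inter> S (cnj \<alpha>) \<noteq> {}"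
    then obtain j k where jk: "\<xi> ^ j * \<alpha> = \<xi> ^ k * cnj \<alpha>" by (auto simp: S_def)
    have x0: "\<xi> \<noteq> 0" using norm_root_of_unity[of N] by (auto simp: \<xi>_def simp del: norm_root_of_unity)
    hence "\<alpha> = (\<xi> ^ k / \<xi> ^ j) * cnj \<alpha>" using jk by (simp add: field_simps)
    moreover have "(\<xi> ^ i) ^ N = 1" for i by (metis \<xi>N mult.commute power_mult power_one)
    hence "(\<xi> ^ k / \<xi> ^ j) ^ N = 1" by (simp only: power_divide div_by_1)
    ultimately show False using \<alpha> by blast
  qed
  define T where "T z = s + L z" for z
  have injT: "inj T" using L(2) by (auto simp: inj_on_def T_def)
  define D1 D2 where "D1 = T ` S \<alpha>" and "D2 = T ` S (cnj \<alpha>)"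
  have D: "finite D1" "finite D2" "D1 \<inter> D2 = {}" using finS disS injT
    by (auto simp: D1_def D2_def inj_on_def)
  define E where "E = T ` cball 0 (cmod \<alpha>)"
  define G where "G = \<Lambda> \<inter> E"
  have sph: "S \<alpha> \<subseteq> sphere 0 (cmod \<alpha>)" "S (cnj \<alpha>) \<subseteq> sphere 0 (cmod \<alpha>)"
    by (auto simp: S_def norm_mult norm_power \<xi>_def)
  have DG: "D1 \<subseteq> G" "D2 \<subseteq> G"
    using pts sph by (auto simp: D1_def D2_def G_def E_def T_def S_def \<xi>_def)
  \<comment> \<open>A disc is strictly convex, so deleting any boundary points leaves a convex set;
    its image under \<open>T\<close> cuts out a convex subset.\<close>
  have conv: "G - T ` Q \<in> convex_subsets \<Lambda>" if Q: "Q \<subseteq> sphere 0 (cmod \<alpha>)" for Q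
  proof -
    have "convex (cball 0 (cmod \<alpha>) - Q)"
      by (rule convex_intermediate_ball[of 0 "cmod \<alpha>"]) (use Q in auto)
    hence "convex (L ` (cball 0 (cmod \<alpha>) - Q))" by (rule convex_linear_image[OF L(1)])
    hence "convex ((+) s ` (L ` (cball 0 (cmod \<alpha>) - Q)))" by (rule convex_translation)
    moreover have "(+) s ` (L ` (cball 0 (cmod \<alpha>) - Q)) = E - T ` Q"
      using image_set_diff[OF injT, of "cball 0 (cmod \<alpha>)" Q] by (simp add: image_image T_def E_def)
    ultimately have c: "convex (E - T ` Q)" by simp
    have "bounded (L ` cball 0 (cmod \<alpha>))"
      by (rule bounded_linear_image[OF bounded_cball]) (use L(1) in \<open>simp add: linear_linear\<close>)
    hence "bounded ((+) s ` (L ` cball 0 (cmod \<alpha>)))" by (rule bounded_translation)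
    hence "bounded E" by (simp add: E_def T_def image_image)
    hence b: "bounded (G - T ` Q)" by (rule bounded_subset) (auto simp: G_def)
    have "convex hull (G - T ` Q) \<subseteq> E - T ` Q" by (rule hull_minimal) (use c in \<open>auto simp: G_def\<close>)
    hence "G - T ` Q = convex hull (G - T ` Q) \<inter> \<Lambda>" using hull_subset[of "G - T ` Q" convex] by (auto simp: G_def)
    thus ?thesis using b unfolding convex_subsets_def by (auto simp: G_def)
  qed
  \<comment> \<open>\<open>\<rho> k\<close> is a square root of \<open>\<xi> ^ k\<close>: the map
    \<open>z \<mapsto> \<xi> ^ k * cnj z\<close> reflects in the line through
    \<open>\<rho> k\<close> and so moves points along \<open>\<i> * \<rho> k\<close>.\<close>
  define \<rho> where "\<rho> k = cis (pi * real k / real N)" for k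
  define d where "d k = L (\<i> * \<rho> k)" for k
  define u where "u k = d k /\<^sub>R norm (d k)" for k
  have L0: "L z = 0 \<longleftrightarrow> z = 0" for z using L by (metis injD linear_0)
  have d0: "d k \<noteq> 0" for k by (simp add: d_def L0 \<rho>_def cis_neq_zero)
  have \<xi>\<rho>: "\<xi> ^ k = \<rho> k * \<rho> k" for k
    by (simp add: \<xi>_def root_of_unity_power \<rho>_def cis_mult mult.assoc)
  have difference: "T z - T (\<xi> ^ k * cnj z) = (2 * Im (cnj (\<rho> k) * z) * norm (d k)) *\<^sub>R u k" for z k
  proof -
    have "\<rho> k * cnj (\<rho> k) = 1" by (simp add: \<rho>_def cis_cnj cis_mult)
    hence "z - \<xi> ^ k * cnj z = \<rho> k * (cnj (\<rho> k) * z - cnj (cnj (\<rho> k) * z))"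
      by (simp add: \<xi>\<rho> algebra_simps)
    also have "\<dots> = (2 * Im (cnj (\<rho> k) * z)) *\<^sub>R (\<i> * \<rho> k)"
      by (simp only: complex_diff_cnj) (simp add: scaleR_conv_of_real)
    finally have "L (z - \<xi> ^ k * cnj z) = (2 * Im (cnj (\<rho> k) * z)) *\<^sub>R d k"
      by (simp add: d_def linear_scale[OF L(1)])
    thus ?thesis using d0[of k] by (simp add: T_def linear_diff[OF L(1)] u_def)
  qed
  define U where "U = u ` {..<m}"
  have npar: "\<not> parallel (u j) (u k)" if jk: "j < N" "k < N" "j \<noteq> k" for j k
  proof
    assume "parallel (u j) (u k)"
    then obtain r where r: "u k = r *\<^sub>R u j" by (auto simp: parallel_def)
    have "d k = norm (d k) *\<^sub>R u k" using d0 by (simp add: u_def)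
    also have "\<dots> = (norm (d k) * r / norm (d j)) *\<^sub>R d j" using r by (simp add: u_def divide_inverse)
    finally obtain c where "d k = c *\<^sub>R d j" by blast
    hence "L (\<i> * \<rho> k) = L (c *\<^sub>R (\<i> * \<rho> j))" by (simp add: d_def linear_scale[OF L(1)])
    hence "\<i> * \<rho> k = c *\<^sub>R (\<i> * \<rho> j)" using L(2) by (meson injD)
    hence "\<i> * \<rho> k = \<i> * (c *\<^sub>R \<rho> j)" by (simp add: scaleR_conv_of_real mult_ac)
    hence "\<rho> k = c *\<^sub>R \<rho> j" by (subst (asm) mult_cancel_left) simp
    hence "Im (cnj (\<rho> j) * \<rho> k) = 0" by (simp add: scaleR_conv_of_real algebra_simps)
    hence "sin (pi * real k / real N - pi * real j / real N) = 0"
      by (simp add: \<rho>_def cis_cnj cis_mult)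
    then obtain i :: int where "pi * real k / real N - pi * real j / real N = of_int i * pi"
      using sin_zero_iff_int2 by blast
    hence "pi * (real k - real j) = pi * (of_int i * real N)" using N by (simp add: field_simps)
    hence "real k - real j = of_int i * real N" by (simp only: mult_cancel_left) simp
    hence "real_of_int (int k - int j) = real_of_int (i * int N)" by simp
    hence "int k - int j = i * int N" by (simp only: of_int_eq_iff)
    hence "int N dvd int k - int j" by simp
    moreover have "\<bar>int k - int j\<bar> < int N" using jk by auto
    ultimately have "int k - int j = 0" using zdvd_imp_le[of "int N" "\<bar>int k - int j\<bar>"] by fastforce
    thus False using jk by simp
  qed
  have "inj_on u {..<m}"
  proof (rule inj_onI, rule ccontr)
    fix j k assume jk: "j \<in> {..<m}" "k \<in> {..<m}" "u j = u k" "j \<noteq> k"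
    have "parallel (u j) (u k)" unfolding parallel_def by (rule exI[of _ 1]) (simp add: jk(3))
    thus False using npar[of j k] jk m by auto
  qed
  hence "card U = m" by (simp add: U_def card_image)
  moreover have "finite U" by (simp add: U_def)
  moreover have "set_direction \<Lambda> v" if "v \<in> U" for v
  proof -
    obtain k where k: "v = u k" using \<open>v \<in> U\<close> by (auto simp: U_def)
    have a1: "\<alpha> \<in> S \<alpha>" using inS[of 0 \<alpha>] by simp
    have a2: "\<xi> ^ k * cnj \<alpha> \<in> S (cnj \<alpha>)" using inS .
    have "T \<alpha> \<in> \<Lambda>" "T (\<xi> ^ k * cnj \<alpha>) \<in> \<Lambda>" using DG a1 a2 by (auto simp: D1_def D2_def G_def)
    moreover have "T \<alpha> \<noteq> T (\<xi> ^ k * cnj \<alpha>)" using a1 a2 D(3) unfolding D1_def D2_def by auto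
    moreover have "parallel v (T \<alpha> - T (\<xi> ^ k * cnj \<alpha>))"
    proof -
      have "2 * Im (cnj (\<rho> k) * \<alpha>) * norm (d k) \<noteq> 0"
        using difference[of \<alpha> k] calculation(3) by auto
      thus ?thesis unfolding parallel_def k using difference[of \<alpha> k] by blast
    qed
    moreover have "v \<in> sphere 0 1" using d0 by (simp add: k u_def)
    ultimately show ?thesis unfolding set_direction_def by auto
  qed
  moreover have "pairwise (\<lambda>u v. \<not> parallel u v) U"
  proof (rule pairwiseI)
    fix v w assume "v \<in> U" "w \<in> U" "v \<noteq> w"
    then obtain j k where "v = u j" "w = u k" "j < m" "k < m" "j \<noteq> k" by (auto simp: U_def)
    thus "\<not> parallel v w" using npar m by simp
  qed
  ultimately have det: "determined_by_xrays (convex_subsets \<Lambda>) U"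
    using suff unfolding directions_suffice_def by blast
  have "xray v (G - D2) = xray v (G - D1)" if "v \<in> U" for v
  proof (rule xray_swap[OF D DG])
    obtain k where k: "v = u k" using \<open>v \<in> U\<close> by (auto simp: U_def)
    fix l assume "l \<in> lines_in_direction v"
    then obtain a where l: "l = range (\<lambda>r::real. a + r *\<^sub>R u k)" by (auto simp: lines_in_direction_def k)
    have shift: "p + c *\<^sub>R u k \<in> l" if p: "p \<in> l" for p c
    proof -
      obtain r where "p = a + r *\<^sub>R u k" using p l by blast
      hence "p + c *\<^sub>R u k = a + (r + c) *\<^sub>R u k" by (simp add: scaleR_add_left add.assoc)
      thus ?thesis using l by blast
    qed
    define \<phi> where "\<phi> z = \<xi> ^ k * cnj z" for z
    have \<phi>l: "T (\<phi> z) \<in> l" if z: "T z \<in> l" for z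
    proof -
      have "T (\<phi> z) = T z + (- (2 * Im (cnj (\<rho> k) * z) * norm (d k))) *\<^sub>R u k"
        using difference[of z k] by (simp add: \<phi>_def algebra_simps)
      thus ?thesis using shift[OF z] by metis
    qed
    have "bij_betw \<phi> {z \<in> S \<alpha>. T z \<in> l} {z \<in> S (cnj \<alpha>). T z \<in> l}"
    proof (rule bij_betw_byWitness[where f' = \<phi>])
      show "\<forall>z\<in>{z \<in> S \<alpha>. T z \<in> l}. \<phi> (\<phi> z) = z" "\<forall>z\<in>{z \<in> S (cnj \<alpha>). T z \<in> l}. \<phi> (\<phi> z) = z"
        unfolding \<phi>_def using refl2 by blast+
      show "\<phi> ` {z \<in> S \<alpha>. T z \<in> l} \<subseteq> {z \<in> S (cnj \<alpha>). T z \<in> l}"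
        using \<phi>l refl[of _ \<alpha>] by (auto simp: \<phi>_def)
      show "\<phi> ` {z \<in> S (cnj \<alpha>). T z \<in> l} \<subseteq> {z \<in> S \<alpha>. T z \<in> l}"
        using \<phi>l refl[of _ "cnj \<alpha>"] by (auto simp: \<phi>_def)
    qed
    hence "card {z \<in> S \<alpha>. T z \<in> l} = card {z \<in> S (cnj \<alpha>). T z \<in> l}" by (rule bij_betw_same_card)
    moreover have "card (T ` S a \<inter> l) = card {z \<in> S a. T z \<in> l}" for a
    proof -
      have "T ` S a \<inter> l = T ` {z \<in> S a. T z \<in> l}" by auto
      thus ?thesis using injT by (simp add: card_image inj_on_def)
    qed
    ultimately show "card (D1 \<inter> l) = card (D2 \<inter> l)" by (simp add: D1_def D2_def)
  qed
  moreover have "G - D2 \<in> convex_subsets \<Lambda>" "G - D1 \<in> convex_subsets \<Lambda>"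
    unfolding D1_def D2_def using conv sph by blast+
  ultimately have "G - D2 = G - D1" using det unfolding determined_by_xrays_def by blast
  moreover have "T \<alpha> \<in> D1" using inS[of 0 \<alpha>] by (simp add: D1_def)
  ultimately show False using D(3) DG(1) by blast
qed

section \<open>Cyclotomic model sets\<close>

lemma finite_bounded_int_polys:
  "finite {p :: int poly. degree p < d \<and> (\<forall>i. \<bar>coeff p i\<bar> \<le> C)}"
proof (rule finite_subset)
  show "{p :: int poly. degree p < d \<and> (\<forall>i. \<bar>coeff p i\<bar> \<le> C)} \<subseteq> Poly ` {xs. set xs \<subseteq> {-C..C} \<and> length xs = d}"
  proof
    fix p :: "int poly" assume p: "p \<in> {p. degree p < d \<and> (\<forall>i. \<bar>coeff p i\<bar> \<le> C)}"
    have "p = Poly (map (coeff p) [0..<d])"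
    proof (rule poly_eqI)
      fix i show "coeff p i = coeff (Poly (map (coeff p) [0..<d])) i"
        using p by (cases "i < d") (auto simp: nth_default_def coeff_eq_0)
    qed
    moreover have "set (map (coeff p) [0..<d]) \<subseteq> {-C..C}" using p by (auto simp: abs_le_iff minus_le_iff)
    ultimately show "p \<in> Poly ` {xs. set xs \<subseteq> {-C..C} \<and> length xs = d}"
      by (intro image_eqI[of _ _ "map (coeff p) [0..<d]"]) auto
  qed
  show "finite (Poly ` {xs :: int list. set xs \<subseteq> {-C..C} \<and> length xs = d})"
    by (intro finite_imageI finite_lists_length_eq) simp
qed

lemma lagrange_interpolation:
  fixes p :: "complex poly"
  assumes Z: "finite Z" "degree p < card Z"
  shows "p = (\<Sum>z\<in>Z. smult (poly p z) (\<Prod>w\<in>Z - {z}. smult (1 / (z - w)) [:- w, 1:]))" (is "p = ?q")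
proof (rule poly_eqI_degree[of Z])
  fix x assume x: "x \<in> Z"
  have "poly ?q x = (\<Sum>z\<in>Z. poly p z * (\<Prod>w\<in>Z - {z}. (x - w) / (z - w)))"
    by (simp add: poly_sum poly_prod diff_divide_distrib)
  also have "\<dots> = (\<Sum>z\<in>Z. if z = x then poly p x else 0)"
  proof (rule sum.cong[OF refl])
    fix z assume "z \<in> Z"
    show "poly p z * (\<Prod>w\<in>Z - {z}. (x - w) / (z - w)) = (if z = x then poly p x else 0)"
    proof (cases "z = x")
      case False
      hence "(\<Prod>w\<in>Z - {z}. (x - w) / (z - w)) = 0" using Z x by (intro prod_zero) auto
      thus ?thesis using False by simp
    next
      case True
      hence "(\<Prod>w\<in>Z - {z}. (x - w) / (z - w)) = 1" by (intro prod.neutral) auto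
      thus ?thesis using True by simp
    qed
  qed
  also have "\<dots> = poly p x" using Z x by simp
  finally show "poly p x = poly ?q x" ..
next
  have "degree ?q \<le> card Z - 1"
  proof (rule degree_sum_le[OF Z(1)])
    fix z assume z: "z \<in> Z"
    have "degree (\<Prod>w\<in>Z - {z}. smult (1 / (z - w)) [:- w, 1:]) \<le>
        (\<Sum>w\<in>Z - {z}. degree (smult (1 / (z - w)) [:- w, 1:]))"
      using degree_prod_sum_le[of "Z - {z}" "\<lambda>w. smult (1 / (z - w)) [:- w, 1:]"] Z(1)
      by (simp only: o_def finite_Diff)
    also have "\<dots> \<le> (\<Sum>w\<in>Z - {z}. 1)" by (rule sum_mono) simp
    also have "\<dots> = card Z - 1" using z Z by simp
    finally show "degree (smult (poly p z) (\<Prod>w\<in>Z - {z}. smult (1 / (z - w)) [:- w, 1:])) \<le> card Z - 1"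
      using degree_smult_le order_trans by blast
  qed
  thus "degree ?q < card Z" using Z by linarith
qed (use Z in simp)

text \<open>Reduced modulo the monic \<open>P\<close>, a polynomial has degree below
  \<open>card Z\<close>, so Lagrange interpolation recovers it from its values on \<open>Z\<close>.
  Bounded values bound the integer coefficients.\<close>

lemma finite_bounded_conjugates:
  assumes P: "lead_coeff P = 1" "degree P = card Z" and Z: "finite Z" "\<And>z. z \<in> Z \<Longrightarrow> ipoly P z = 0"
    and x: "x \<in> Z"
  shows "finite {ipoly p x | p. \<forall>z\<in>Z. cmod (ipoly p z) \<le> B}"
proof -
  define L where "L z = (\<Prod>w\<in>Z - {z}. smult (1 / (z - w)) [:- w, 1:])" for z
  define C where "C = (\<Sum>i<card Z. \<Sum>z\<in>Z. B * cmod (coeff (L z) i))"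
  have "{ipoly p x | p. \<forall>z\<in>Z. cmod (ipoly p z) \<le> B} \<subseteq>
      (\<lambda>r. ipoly r x) ` {r. degree r < card Z \<and> (\<forall>i. \<bar>coeff r i\<bar> \<le> \<lceil>C\<rceil>)}"
  proof
    fix y assume "y \<in> {ipoly p x | p. \<forall>z\<in>Z. cmod (ipoly p z) \<le> B}"
    then obtain p where p: "y = ipoly p x" "\<And>z. z \<in> Z \<Longrightarrow> cmod (ipoly p z) \<le> B" by blast
    have P0: "P \<noteq> 0" using P(1) by auto
    have cZ: "card Z > 0" using x Z(1) by (auto simp: card_gt_0_iff)
    have B0: "B \<ge> 0" using p(2)[OF x] norm_ge_zero order_trans by blast
    obtain q r where qr: "pseudo_divmod p P = (q, r)" by fastforce
    have e: "p = P * q + r" "r = 0 \<or> degree r < degree P"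
      using pseudo_divmod[OF P0 qr] P(1) by auto
    have rz: "ipoly r z = ipoly p z" if "z \<in> Z" for z
      using arg_cong[OF e(1), of "\<lambda>p. ipoly p z"] Z(2)[OF that] by simp
    have dr: "degree r < card Z" using e(2) P(2) cZ by auto
    let ?r = "map_poly complex_of_int r"
    have "degree ?r < card Z" using dr by (simp add: degree_map_poly)
    hence "?r = (\<Sum>z\<in>Z. smult (poly ?r z) (L z))"
      unfolding L_def by (rule lagrange_interpolation[OF Z(1)])
    also have "\<dots> = (\<Sum>z\<in>Z. smult (ipoly p z) (L z))"
      by (rule sum.cong) (simp_all add: rz flip: ipoly_def)
    finally have r: "?r = (\<Sum>z\<in>Z. smult (ipoly p z) (L z))" .
    have "\<bar>coeff r i\<bar> \<le> \<lceil>C\<rceil>" for i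
    proof (cases "i < card Z")
      case True
      have "complex_of_int (coeff r i) = (\<Sum>z\<in>Z. ipoly p z * coeff (L z) i)"
        using arg_cong[OF r, of "\<lambda>p. coeff p i"] by (simp add: coeff_map_poly coeff_sum)
      hence "cmod (complex_of_int (coeff r i)) \<le> (\<Sum>z\<in>Z. cmod (ipoly p z * coeff (L z) i))"
        using norm_sum by metis
      also have "\<dots> \<le> (\<Sum>z\<in>Z. B * cmod (coeff (L z) i))"
        using p(2) by (intro sum_mono) (simp add: norm_mult mult_right_mono)
      also have "\<dots> \<le> C" unfolding C_def
        by (rule member_le_sum) (use True B0 in \<open>auto intro!: sum_nonneg\<close>)
      finally have "real_of_int \<bar>coeff r i\<bar> \<le> C" by simp
      thus ?thesis by linarith
    next
      case False
      have "C \<ge> 0" unfolding C_def using B0 by (intro sum_nonneg) auto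
      thus ?thesis using False dr by (simp add: coeff_eq_0)
    qed
    hence "r \<in> {r. degree r < card Z \<and> (\<forall>i. \<bar>coeff r i\<bar> \<le> \<lceil>C\<rceil>)}" using dr by blast
    moreover have "y = ipoly r x" using p(1) rz[OF x] by simp
    ultimately show "y \<in> (\<lambda>r. ipoly r x) ` {r. degree r < card Z \<and> (\<forall>i. \<bar>coeff r i\<bar> \<le> \<lceil>C\<rceil>)}" by blast
  qed
  thus ?thesis using finite_bounded_int_polys finite_imageI finite_subset by blast
qed

section \<open>Embeddings of the cyclotomic field\<close>

lemma root_of_unity_in_field: "root_of_unity n \<in> cyclotomic_field n"
  by (simp add: cyclotomic_field_def)

lemma is_subfield_cyclotomic_field: "is_subfield (cyclotomic_field n)"
  unfolding is_subfield_def cyclotomic_field_def by auto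

lemma subfield_minus: "is_subfield F \<Longrightarrow> x \<in> F \<Longrightarrow> y \<in> F \<Longrightarrow> x - y \<in> F"
  and subfield_times: "is_subfield F \<Longrightarrow> x \<in> F \<Longrightarrow> y \<in> F \<Longrightarrow> x * y \<in> F"
  and subfield_0: "is_subfield F \<Longrightarrow> 0 \<in> F"
  and subfield_1: "is_subfield F \<Longrightarrow> 1 \<in> F"
  and subfield_inverse: "is_subfield F \<Longrightarrow> x \<in> F \<Longrightarrow> inverse x \<in> F"
  by (auto simp: is_subfield_def)

lemma subfield_plus: "is_subfield F \<Longrightarrow> x \<in> F \<Longrightarrow> y \<in> F \<Longrightarrow> x + y \<in> F"
  using subfield_minus[of F x "0 - y"] subfield_minus[of F 0 y] subfield_0 by simp

lemma subfield_of_int: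
  assumes "is_subfield F"
  shows "of_int k \<in> F"
proof (induction k rule: int_induct[where k = 0])
  case base thus ?case using subfield_0[OF assms] by simp
next
  case (step1 i) thus ?case using subfield_plus[OF assms _ subfield_1[OF assms]] by simp
next
  case (step2 i) thus ?case using subfield_minus[OF assms _ subfield_1[OF assms]] by simp
qed

lemma ipoly_in_field: "ipoly p (root_of_unity n) \<in> cyclotomic_field n"
proof (induction p)
  case 0 thus ?case using subfield_0[OF is_subfield_cyclotomic_field] by simp
next
  case (pCons a p)
  thus ?case unfolding ipoly_pCons
    by (intro subfield_plus subfield_times subfield_of_int is_subfield_cyclotomic_field root_of_unity_in_field)
qed

lemma cyclotomic_field_induct:
  assumes "is_subfield {z \<in> cyclotomic_field n. Q z}" "Q (root_of_unity n)" "z \<in> cyclotomic_field n"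
  shows "Q z"
  using assms root_of_unity_in_field[of n] unfolding cyclotomic_field_def[of n] by blast

context
  fixes n \<sigma>
  assumes emb: "field_embedding n \<sigma>"
begin

lemma emb_add: "x \<in> cyclotomic_field n \<Longrightarrow> y \<in> cyclotomic_field n \<Longrightarrow> \<sigma> (x + y) = \<sigma> x + \<sigma> y"
  and emb_mult: "x \<in> cyclotomic_field n \<Longrightarrow> y \<in> cyclotomic_field n \<Longrightarrow> \<sigma> (x * y) = \<sigma> x * \<sigma> y"
  and emb_1: "\<sigma> 1 = 1"
  using emb by (auto simp: field_embedding_def)

lemma emb_0: "\<sigma> 0 = 0"
  using emb_add[of 0 0] subfield_0[OF is_subfield_cyclotomic_field] by simp

lemma emb_diff:
  assumes "x \<in> cyclotomic_field n" "y \<in> cyclotomic_field n"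
  shows "\<sigma> (x - y) = \<sigma> x - \<sigma> y"
  using emb_add[of "x - y" y] assms subfield_minus[OF is_subfield_cyclotomic_field] by simp

lemma emb_inverse:
  assumes "x \<in> cyclotomic_field n"
  shows "\<sigma> (inverse x) = inverse (\<sigma> x)"
proof (cases "x = 0")
  case False
  have "\<sigma> x * \<sigma> (inverse x) = 1"
    using emb_mult[of x "inverse x"] assms False emb_1 subfield_inverse[OF is_subfield_cyclotomic_field] by simp
  thus ?thesis by (metis inverse_unique)
qed (simp add: emb_0)

lemma emb_of_int: "\<sigma> (of_int k) = of_int k"
proof -
  note F = is_subfield_cyclotomic_field[of n]
  show ?thesis
  proof (induction k rule: int_induct[where k = 0])
    case base thus ?case using emb_0 by simp
  next
    case (step1 i) thus ?case using emb_add[OF subfield_of_int[OF F, of i] subfield_1[OF F]] emb_1 by simp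
  next
    case (step2 i) thus ?case using emb_diff[OF subfield_of_int[OF F, of i] subfield_1[OF F]] emb_1 by simp
  qed
qed

lemma emb_ipoly: "\<sigma> (ipoly p (root_of_unity n)) = ipoly p (\<sigma> (root_of_unity n))"
proof (induction p)
  case 0 thus ?case using emb_0 by simp
next
  case (pCons a p)
  note F = is_subfield_cyclotomic_field[of n]
  have "\<sigma> (of_int a + root_of_unity n * ipoly p (root_of_unity n)) =
     \<sigma> (of_int a) + \<sigma> (root_of_unity n * ipoly p (root_of_unity n))"
    by (intro emb_add subfield_of_int subfield_times F root_of_unity_in_field ipoly_in_field)
  also have "\<sigma> (root_of_unity n * ipoly p (root_of_unity n)) = \<sigma> (root_of_unity n) * \<sigma> (ipoly p (root_of_unity n))"
    by (intro emb_mult root_of_unity_in_field ipoly_in_field)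
  finally show ?case by (simp add: emb_of_int pCons)
qed

text \<open>The elements on which an embedding agrees with the identity, or with conjugation, form a
  subfield; agreement at the root of unity would mean agreement everywhere.\<close>

lemma emb_root_ne:
  assumes "\<not> same_conjugate_pair n \<sigma> id"
  shows "\<sigma> (root_of_unity n) \<noteq> root_of_unity n" "\<sigma> (root_of_unity n) \<noteq> cnj (root_of_unity n)"
proof -
  note F = is_subfield_cyclotomic_field[of n]
  have "is_subfield {z \<in> cyclotomic_field n. \<sigma> z = z}"
    using F emb_0 emb_1 emb_diff emb_mult emb_inverse unfolding is_subfield_def by auto
  hence "\<sigma> (root_of_unity n) = root_of_unity n \<Longrightarrow> z \<in> cyclotomic_field n \<Longrightarrow> \<sigma> z = z" for z
    using cyclotomic_field_induct[of n "\<lambda>z. \<sigma> z = z"] by blast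
  thus "\<sigma> (root_of_unity n) \<noteq> root_of_unity n"
    using assms by (auto simp: same_conjugate_pair_def)
  have "is_subfield {z \<in> cyclotomic_field n. \<sigma> z = cnj z}"
    using F emb_0 emb_1 emb_diff emb_mult emb_inverse unfolding is_subfield_def by auto
  hence "\<sigma> (root_of_unity n) = cnj (root_of_unity n) \<Longrightarrow> z \<in> cyclotomic_field n \<Longrightarrow> \<sigma> z = cnj z" for z
    using cyclotomic_field_induct[of n "\<lambda>z. \<sigma> z = cnj z"] by blast
  thus "\<sigma> (root_of_unity n) \<noteq> cnj (root_of_unity n)"
    using assms by (auto simp: same_conjugate_pair_def)
qed

end

lemma star_indices_eq:
  "star_indices 3 = {}" "star_indices 4 = {}" "star_indices 5 = {2}" "star_indices 8 = {2}" "star_indices 12 = {2}"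
proof -
  have "totient 3 = 2" "totient 4 = 2" "totient 5 = 4" "totient 8 = 4" "totient 12 = 4"
    by code_simp+
  thus "star_indices 3 = {}" "star_indices 4 = {}" "star_indices 5 = {2}" "star_indices 8 = {2}" "star_indices 12 = {2}"
    by (simp_all add: star_indices_def)
qed

lemma root_of_unity_power_ne_1:
  assumes "0 < k" "k < n"
  shows "root_of_unity n ^ k \<noteq> 1"
proof
  assume "root_of_unity n ^ k = 1"
  hence "cos (2 * pi * real k / real n) = 1" by (simp add: root_of_unity_power complex_eq_iff)
  then obtain j :: int where "2 * pi * real k / real n = of_int j * 2 * pi" using cos_one_2pi_int by blast
  hence "2 * pi * real k = 2 * pi * (of_int j * real n)" using assms by (simp add: field_simps)
  hence "real k = of_int j * real n" by (simp only: mult_cancel_left) simp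
  hence "real_of_int (int k) = real_of_int (j * int n)" by simp
  hence "int k = j * int n" by (simp only: of_int_eq_iff)
  hence "int n dvd int k" by simp
  thus False using assms by (auto dest: dvd_imp_le)
qed

text \<open>The cyclotomic polynomials for 3, 4, 5, 8 and, in the last case, 12; no other index is meant.\<close>

definition cyclo :: "nat \<Rightarrow> int poly" where
  "cyclo n = (if n = 3 then [:1, 1, 1:] else if n = 4 then [:1, 0, 1:] else
     if n = 5 then [:1, 1, 1, 1, 1:] else if n = 8 then [:1, 0, 0, 0, 1:] else [:1, 0, -1, 0, 1:])"

lemma cyclo_root_of_unity:
  assumes "n \<in> {3, 4, 5, 8, 12}"
  shows "ipoly (cyclo n) (root_of_unity n) = 0"
proof -
  define x where "x = root_of_unity n"
  have x: "x ^ n = 1" using assms by (auto simp: x_def)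
  have ne: "x ^ k \<noteq> 1" if "0 < k" "k < n" for k
    unfolding x_def by (rule root_of_unity_power_ne_1[OF that])
  have nf: "x ^ 1 \<noteq> 1" using ne[of 1] assms by auto
  consider "n = 3" | "n = 4" | "n = 5" | "n = 8" | "n = 12" using assms by auto
  hence "ipoly (cyclo n) x = 0"
  proof cases
    case 1
    hence "(x - 1) * (1 + x * (1 + x)) = 0" using x by (simp add: algebra_simps power3_eq_cube)
    thus ?thesis using nf 1 by (simp add: cyclo_def)
  next
    case 2
    hence "(x ^ 2 - 1) * (1 + x * x) = 0" using x by (simp add: algebra_simps power2_eq_square power4_eq_xxxx)
    thus ?thesis using ne[of 2] 2 by (simp add: cyclo_def)
  next
    case 3
    have "x ^ 5 - 1 = (x - 1) * (1 + x * (1 + x * (1 + x * (1 + x))))" by algebra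
    thus ?thesis using nf x 3 by (simp add: cyclo_def)
  next
    case 4
    have "x ^ 8 - 1 = (x ^ 4 - 1) * (1 + x * (x * (x * x)))" by algebra
    thus ?thesis using ne[of 4] x 4 by (simp add: cyclo_def)
  next
    case 5
    have "x ^ 12 - 1 = (x ^ 6 - 1) * ((x ^ 2 + 1) * (1 + x * (x * (- 1 + x * x))))" by algebra
    moreover have "x ^ 2 + 1 \<noteq> 0"
    proof
      assume "x ^ 2 + 1 = 0"
      hence "x ^ 4 = 1" by algebra
      thus False using ne[of 4] 5 by simp
    qed
    ultimately show ?thesis using ne[of 6] x 5 by (simp add: cyclo_def)
  qed
  thus ?thesis by (simp add: x_def)
qed

section \<open>Conjugates of the roots of unity of order 5, 8 and 12\<close>

lemma cyclo_monic: "lead_coeff (cyclo n) = 1"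
  and degree_cyclo: "degree (cyclo n) = (if n = 3 \<or> n = 4 then 2 else 4)"
  by (auto simp: cyclo_def)

text \<open>120 is the least common multiple of 5, 8 and 12, so one exponent serves all three
  cases.\<close>

lemma cyclo_root_power:
  assumes "ipoly (cyclo n) x = 0" "n \<in> {5, 8, 12}"
  shows "x ^ 120 = 1"
proof -
    consider "n = 5" | "n = 8" | "n = 12" using assms by auto
    thus ?thesis
    proof cases
      case 1
      hence "1 + x * (1 + x * (1 + x * (1 + x))) = 0" using assms by (simp add: cyclo_def)
      hence "x ^ 5 = 1" by algebra
      hence "(x ^ 5) ^ 24 = 1" by simp
      thus ?thesis by (simp flip: power_mult)
    next
      case 2
      hence "1 + x * (x * (x * x)) = 0" using assms by (simp add: cyclo_def)
      hence "x ^ 8 = 1" by algebra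
      hence "(x ^ 8) ^ 15 = 1" by simp
      thus ?thesis by (simp flip: power_mult)
    next
      case 3
      hence "1 + x * (x * (- 1 + x * x)) = 0" using assms by (simp add: cyclo_def)
      hence "x ^ 12 = 1" by algebra
      hence "(x ^ 12) ^ 10 = 1" by simp
      thus ?thesis by (simp flip: power_mult)
    qed
qed

lemma cyclo_root_norm:
  assumes "ipoly (cyclo n) x = 0" "n \<in> {5, 8, 12}"
  shows "cmod x = 1"
proof -
  have "x ^ 120 = 1" by (rule cyclo_root_power[OF assms])
  hence "cmod x ^ 120 = 1" by (metis norm_one norm_power)
  thus ?thesis using power_eq_imp_eq_base[of "cmod x" 120 1] by simp
qed

text \<open>The quadratic equation of \<open>x + cnj x = x + 1 / x\<close>, obtained by dividing the
  quartic by the square of \<open>x\<close>.\<close>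

lemma cyclo_root_trace:
  assumes "ipoly (cyclo n) x = 0" "n \<in> {5, 8, 12}"
  shows "(if n = 5 then (2 * Re x)\<^sup>2 + 2 * Re x = 1 else (2 * Re x)\<^sup>2 = (if n = 8 then 2 else 3))"
proof -
  define c where "c = cnj x"
  have c: "x * c = 1" unfolding c_def using cyclo_root_norm[OF assms] by (simp add: complex_norm_square [symmetric])
  have s: "x + c = of_real (2 * Re x)" by (simp add: c_def complex_add_cnj)
  consider "n = 5" | "n = 8" | "n = 12" using assms by auto
  thus ?thesis
  proof cases
    case 1
    hence "1 + x * (1 + x * (1 + x * (1 + x))) = 0" using assms by (simp add: cyclo_def)
    hence "(x + c)\<^sup>2 + (x + c) = 1" using c by algebra
    hence "of_real ((2 * Re x)\<^sup>2 + 2 * Re x) = (1 :: complex)" unfolding s by simp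
    hence "(2 * Re x)\<^sup>2 + 2 * Re x = 1" by (simp only: of_real_eq_1_iff)
    thus ?thesis using 1 by simp
  next
    case 2
    hence "1 + x * (x * (x * x)) = 0" using assms by (simp add: cyclo_def)
    hence "(x + c)\<^sup>2 = 2" using c by algebra
    hence "of_real ((2 * Re x)\<^sup>2) = (of_real 2 :: complex)" unfolding s by simp
    hence "(2 * Re x)\<^sup>2 = 2" by (simp only: of_real_eq_iff)
    thus ?thesis using 2 by simp
  next
    case 3
    hence "1 + x * (x * (- 1 + x * x)) = 0" using assms by (simp add: cyclo_def)
    hence "(x + c)\<^sup>2 = 3" using c by algebra
    hence "of_real ((2 * Re x)\<^sup>2) = (of_real 3 :: complex)" unfolding s by simp
    hence "(2 * Re x)\<^sup>2 = 3" by (simp only: of_real_eq_iff)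
    thus ?thesis using 3 by simp
  qed
qed

text \<open>\<open>2 * Re \<eta>\<close> is the second root of the quadratic in
  \<open>cyclo_root_trace\<close>. The roots sum to -1 or 0 and the one of
  \<open>root_of_unity n\<close> is positive, so this one is negative; with
  \<open>\<bar>Re \<eta>\<bar> < 1\<close> the contraction factor follows.\<close>

lemma cyclo_conjugate_root:
  assumes \<eta>: "ipoly (cyclo n) \<eta> = 0" and n: "n \<in> {5, 8, 12}"
    and ne: "\<eta> \<noteq> root_of_unity n" "\<eta> \<noteq> cnj (root_of_unity n)"
  shows "Re \<eta> < 0" "Im \<eta> \<noteq> 0" "1 + 2 * Re \<eta> \<noteq> 0" "cmod \<eta> = 1" "\<bar>1 + 2 * Re \<eta>\<bar> < 1"
proof -
  define z where "z = root_of_unity n"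
  have z0: "ipoly (cyclo n) z = 0" using cyclo_root_of_unity[of n] n by (auto simp: z_def)
  have Rz: "Re z > 0"
  proof -
    have "2 * pi / n < pi / 2" using n by (auto simp: field_simps)
    moreover have "0 < 2 * pi / n" using n by auto
    ultimately have "cos (2 * pi / n) > 0" by (intro cos_gt_zero_pi) auto
    thus ?thesis by (simp add: z_def root_of_unity_cis)
  qed
  show norm: "cmod \<eta> = 1" by (rule cyclo_root_norm[OF \<eta> n])
  have sq: "(Re \<eta>)\<^sup>2 + (Im \<eta>)\<^sup>2 = 1" "(Re z)\<^sup>2 + (Im z)\<^sup>2 = 1"
    using norm cyclo_root_norm[OF z0 n] cmod_power2[of \<eta>] cmod_power2[of z] by auto
  have "Re \<eta> \<noteq> Re z"
  proof
    assume e: "Re \<eta> = Re z"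
    hence "(Im \<eta>)\<^sup>2 = (Im z)\<^sup>2" using sq by simp
    hence "Im \<eta> = Im z \<or> Im \<eta> = - Im z" by (simp add: power2_eq_iff)
    thus False using e ne by (auto simp: z_def complex_eq_iff)
  qed
  hence d: "2 * Re \<eta> - 2 * Re z \<noteq> 0" by simp
  note t = cyclo_root_trace[OF \<eta> n] cyclo_root_trace[OF z0 n]
  show neg: "Re \<eta> < 0"
  proof (cases "n = 5")
    case True
    hence "(2 * Re \<eta> - 2 * Re z) * (2 * Re \<eta> + 2 * Re z + 1) = 0"
      using t by (simp add: algebra_simps power2_eq_square)
    hence "2 * Re \<eta> + 2 * Re z + 1 = 0" using d by simp
    thus ?thesis using Rz by simp
  next
    case False
    hence "(2 * Re \<eta> - 2 * Re z) * (2 * Re \<eta> + 2 * Re z) = 0"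
      using t by (simp add: algebra_simps power2_eq_square)
    hence "2 * Re \<eta> + 2 * Re z = 0" using d by simp
    thus ?thesis using Rz by simp
  qed
  show Im: "Im \<eta> \<noteq> 0"
  proof
    assume "Im \<eta> = 0"
    hence "(Re \<eta>)\<^sup>2 = 1" using sq by simp
    hence "Re \<eta> = -1" using neg by (simp add: power2_eq_1_iff)
    thus False using t(1) n by (auto split: if_splits)
  qed
  show "1 + 2 * Re \<eta> \<noteq> 0"
  proof
    assume "1 + 2 * Re \<eta> = 0"
    hence "2 * Re \<eta> = -1" by simp
    thus False using t(1) n by (auto split: if_splits)
  qed
  have "(Im \<eta>)\<^sup>2 > 0" using Im by simp
  hence "(Re \<eta>)\<^sup>2 < 1" using sq(1) by linarith
  hence "\<bar>Re \<eta>\<bar> < 1" by (simp only: abs_square_less_1)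
  thus "\<bar>1 + 2 * Re \<eta>\<bar> < 1" using neg by auto
qed

text \<open>The totient is 4 here, so the internal space is a copy of the plane and the star map
  replaces the root of unity by its conjugate \<open>\<eta>\<close>. The window becomes a bounded
  set that contains a disc.\<close>

lemma quasicrystal_description:
  assumes n: "n \<in> {5, 8, 12}" and L: "cyclotomic_model_set n \<Lambda>"
  obtains t \<eta> V c e where "ipoly (cyclo n) \<eta> = 0" "\<eta> \<noteq> root_of_unity n" "\<eta> \<noteq> cnj (root_of_unity n)"
    "bounded V" "e > 0" "ball c e \<subseteq> V" "\<Lambda> = {t + ipoly p (root_of_unity n) | p. ipoly p \<eta> \<in> V}"
proof -
  have si: "star_indices n = {2}" using n star_indices_eq by auto
  obtain \<sigma> W t where W: "embedding_choice n \<sigma>" "W \<subseteq> topspace (internal_space n)"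
    "compactin (internal_space n) (internal_space n closure_of W)"
    "internal_space n interior_of W \<noteq> {}"
    "\<Lambda> = (\<lambda>z. t + z) ` {z \<in> cyclotomic_ring n. star_map n \<sigma> z \<in> W}"
    using L unfolding cyclotomic_model_set_def by blast
  have \<sigma>: "field_embedding n (\<sigma> 2)" "\<not> same_conjugate_pair n (\<sigma> 2) id"
    using conjunct1[OF W(1)[unfolded embedding_choice_def si]] by simp_all
  define \<eta> where "\<eta> = \<sigma> 2 (root_of_unity n)"
  define V where "V = {w. (\<lambda>i\<in>{2}. w) \<in> W}"
  have "ipoly (cyclo n) \<eta> = \<sigma> 2 (ipoly (cyclo n) (root_of_unity n))"
    unfolding \<eta>_def by (rule emb_ipoly[OF \<sigma>(1), symmetric])
  hence 1: "ipoly (cyclo n) \<eta> = 0" using cyclo_root_of_unity[of n] n emb_0[OF \<sigma>(1)] by auto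
  have 2: "\<eta> \<noteq> root_of_unity n" "\<eta> \<noteq> cnj (root_of_unity n)"
    unfolding \<eta>_def by (rule emb_root_ne[OF \<sigma>])+
  have sm: "star_map n \<sigma> (ipoly p (root_of_unity n)) \<in> W \<longleftrightarrow> ipoly p \<eta> \<in> V" for p
  proof -
    have "star_map n \<sigma> (ipoly p (root_of_unity n)) = (\<lambda>i\<in>{2}. ipoly p \<eta>)"
      unfolding star_map_def si \<eta>_def by (rule restrict_ext) (simp add: emb_ipoly[OF \<sigma>(1)])
    thus ?thesis by (simp add: V_def)
  qed
  have 3: "\<Lambda> = {t + ipoly p (root_of_unity n) | p. ipoly p \<eta> \<in> V}"
  proof -
    have "cyclotomic_ring n = range (\<lambda>p. ipoly p (root_of_unity n))"
      by (simp add: cyclotomic_ring_def ipoly_def)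
    hence "{z \<in> cyclotomic_ring n. star_map n \<sigma> z \<in> W} = {ipoly p (root_of_unity n) | p. ipoly p \<eta> \<in> V}"
      using sm by fastforce
    thus ?thesis unfolding W(5) by (simp only: image_Collect Setcompr_eq_image) blast
  qed
  let ?X = "internal_space n"
  have X: "?X = product_topology (\<lambda>_. euclidean) {2}" by (simp add: internal_space_def si)
  have "continuous_map ?X euclidean (\<lambda>f. f 2)"
    unfolding X by (rule continuous_map_product_projection) simp
  hence "compactin euclidean ((\<lambda>f. f 2) ` (?X closure_of W))" by (rule image_compactin[OF W(3)])
  hence "bounded ((\<lambda>f. f 2) ` (?X closure_of W))"
    using compact_imp_bounded by (simp add: compactin_euclidean_iff)
  moreover have "V \<subseteq> (\<lambda>f. f 2) ` (?X closure_of W)"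
  proof
    fix w assume "w \<in> V"
    hence "(\<lambda>i\<in>{2}. w) \<in> W" by (simp only: V_def mem_Collect_eq)
    hence "(\<lambda>i\<in>{2}. w) \<in> ?X closure_of W" using closure_of_subset[OF W(2)] by blast
    thus "w \<in> (\<lambda>f. f 2) ` (?X closure_of W)" by (rule image_eqI[rotated]) simp
  qed
  ultimately have 4: "bounded V" using bounded_subset by blast
  obtain f where f: "f \<in> ?X interior_of W" using W(4) by blast
  \<comment> \<open>A basic open box around an interior point; its only factor is the one at index
    2.\<close>
  have "\<forall>f\<in>?X interior_of W. \<exists>T. finite {i \<in> {2}. T i \<noteq> topspace euclidean} \<and>
      (\<forall>i\<in>{2}. openin euclidean (T i)) \<and> f \<in> Pi\<^sub>E {2} T \<and> Pi\<^sub>E {2} T \<subseteq> ?X interior_of W"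
    using openin_interior_of[of ?X W] unfolding X openin_product_topology_alt .
  from bspec[OF this f] obtain T where
    T: "\<forall>i\<in>{2}. openin euclidean (T i)" "f \<in> Pi\<^sub>E {2} T" "Pi\<^sub>E {2} T \<subseteq> ?X interior_of W"
    by (elim exE conjE) (rule that)
  have "f 2 \<in> T 2" by (rule PiE_mem[OF T(2)]) simp
  moreover have "open (T 2)" using T(1) by simp
  ultimately obtain e where e: "e > 0" "ball (f 2) e \<subseteq> T 2" using open_contains_ball by blast
  have "ball (f 2) e \<subseteq> V"
  proof
    fix w assume "w \<in> ball (f 2) e"
    hence "w \<in> T 2" using e(2) by blast
    hence "(\<lambda>i\<in>{2}. w) \<in> Pi\<^sub>E {2} T" by (simp only: restrict_PiE_iff ball_simps)
    hence "(\<lambda>i\<in>{2}. w) \<in> W" using T(3) interior_of_subset[of ?X W] by blast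
    thus "w \<in> V" by (simp only: V_def mem_Collect_eq)
  qed
  thus ?thesis by (rule that[OF 1 2 4 e(1) _ 3])
qed

text \<open>The totient is 2 here, so the internal space is one point and a window with nonempty
  interior is all of it.\<close>

lemma crystal_description:
  assumes n: "n \<in> {3, 4}" and L: "cyclotomic_model_set n \<Lambda>"
  obtains t where "\<Lambda> = range (\<lambda>p. t + ipoly p (root_of_unity n))"
proof -
  have si: "star_indices n = {}" using n star_indices_eq by auto
  obtain \<sigma> W t where W: "W \<subseteq> topspace (internal_space n)"
    "internal_space n interior_of W \<noteq> {}"
    "\<Lambda> = (\<lambda>z. t + z) ` {z \<in> cyclotomic_ring n. star_map n \<sigma> z \<in> W}"
    using L unfolding cyclotomic_model_set_def by blast
  have "topspace (internal_space n) = {\<lambda>_. undefined}"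
    by (simp add: internal_space_def si)
  moreover have "W \<noteq> {}" using W(2) interior_of_subset[of "internal_space n" W] by blast
  ultimately have "W = {\<lambda>_. undefined}" using W(1) by (metis subset_singletonD)
  moreover have "star_map n \<sigma> z = (\<lambda>_. undefined)" for z by (simp add: star_map_def si restrict_def)
  ultimately have "{z \<in> cyclotomic_ring n. star_map n \<sigma> z \<in> W} = range (\<lambda>p. ipoly p (root_of_unity n))"
    by (simp add: cyclotomic_ring_def ipoly_def)
  hence "\<Lambda> = range (\<lambda>p. t + ipoly p (root_of_unity n))"
    unfolding W(3) by (simp only: image_image)
  thus ?thesis by (rule that)
qed

lemma root_of_unity_Im_pos:
  assumes "n \<ge> 3"
  shows "Im (root_of_unity n) > 0"
proof -
  have "0 < 2 * pi / n" "2 * pi / n < pi" using assms by (auto simp: field_simps)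
  thus ?thesis by (simp add: root_of_unity_cis sin_gt_zero)
qed

lemma model_set_differences:
  assumes n: "n \<in> {3, 4, 5, 8, 12}" and L: "cyclotomic_model_set n \<Lambda>" and x: "x \<in> \<Lambda>" "y \<in> \<Lambda>"
  obtains p where "x - y = ipoly p (root_of_unity n)"
proof -
  have "\<exists>t. \<forall>z\<in>\<Lambda>. \<exists>p. z = t + ipoly p (root_of_unity n)"
  proof (cases "n \<in> {3, 4}")
    case True
    obtain t where "\<Lambda> = range (\<lambda>p. t + ipoly p (root_of_unity n))" by (rule crystal_description[OF True L])
    thus ?thesis by blast
  next
    case False
    hence "n \<in> {5, 8, 12}" using n by blast
    from this L obtain t \<eta> V c e where
      \<eta>: "ipoly (cyclo n) \<eta> = 0" "\<eta> \<noteq> root_of_unity n" "\<eta> \<noteq> cnj (root_of_unity n)" and V: "bounded V"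
      "e > 0" "ball c e \<subseteq> V" "\<Lambda> = {t + ipoly p (root_of_unity n) | p. ipoly p \<eta> \<in> V}"
      by (rule quasicrystal_description)
    show ?thesis unfolding V(4) by blast
  qed
  then obtain t where "\<forall>z\<in>\<Lambda>. \<exists>p. z = t + ipoly p (root_of_unity n)" by (elim exE)
  then obtain p q where "x = t + ipoly p (root_of_unity n)" "y = t + ipoly q (root_of_unity n)"
    using x by blast
  hence "x - y = ipoly (p - q) (root_of_unity n)" by simp
  thus ?thesis by (rule that)
qed

text \<open>Complex conjugates share their modulus, so a bound on the element and the bounded window
  on its star image together bound all conjugates.\<close>

lemma model_set_locally_finite:
  assumes n: "n \<in> {3, 4, 5, 8, 12}" and L: "cyclotomic_model_set n \<Lambda>"
  shows "finite {z \<in> \<Lambda>. cmod z \<le> R}"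
proof -
  define x where "x = root_of_unity n"
  have n3: "n \<ge> 3" using n by auto
  have Im: "Im x > 0" unfolding x_def by (rule root_of_unity_Im_pos[OF n3])
  hence xc: "x \<noteq> cnj x" by (auto simp: complex_eq_iff)
  have root: "ipoly (cyclo n) x = 0" unfolding x_def by (rule cyclo_root_of_unity[OF n])
  have lc: "lead_coeff (cyclo n) = 1" by (rule cyclo_monic)
  show ?thesis
  proof (cases "n \<in> {3, 4}")
    case True
    obtain t where t: "\<Lambda> = range (\<lambda>p. t + ipoly p x)"
      unfolding x_def by (rule crystal_description[OF True L])
    have "finite {ipoly p x | p. \<forall>z\<in>{x, cnj x}. cmod (ipoly p z) \<le> R + cmod t}"
    proof (rule finite_bounded_conjugates[OF lc])
      have "card {x, cnj x} = 2" using xc by simp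
      thus "degree (cyclo n) = card {x, cnj x}" using True unfolding degree_cyclo by simp
      show "ipoly (cyclo n) z = 0" if "z \<in> {x, cnj x}" for z using that root ipoly_cnj[of "cyclo n" x] by auto
    qed simp_all
    moreover have "{z \<in> \<Lambda>. cmod z \<le> R} \<subseteq> (+) t ` {ipoly p x | p. \<forall>z\<in>{x, cnj x}. cmod (ipoly p z) \<le> R + cmod t}"
    proof
      fix z assume z: "z \<in> {z \<in> \<Lambda>. cmod z \<le> R}"
      then obtain p where p: "z = t + ipoly p x" using t by blast
      have "cmod (ipoly p x) \<le> cmod z + cmod t" using norm_triangle_ineq4[of z t] by (simp add: p)
      hence "\<forall>z\<in>{x, cnj x}. cmod (ipoly p z) \<le> R + cmod t" using z by (auto simp: ipoly_cnj)
      thus "z \<in> (+) t ` {ipoly p x | p. \<forall>z\<in>{x, cnj x}. cmod (ipoly p z) \<le> R + cmod t}"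
        using p by blast
    qed
    ultimately show ?thesis by (rule finite_subset[OF _ finite_imageI, rotated])
  next
    case False
    hence n5: "n \<in> {5, 8, 12}" using n by blast
    from n5 L obtain t \<eta> V c e where
      \<eta>: "ipoly (cyclo n) \<eta> = 0" "\<eta> \<noteq> root_of_unity n" "\<eta> \<noteq> cnj (root_of_unity n)" and V: "bounded V"
      "e > 0" "ball c e \<subseteq> V" "\<Lambda> = {t + ipoly p (root_of_unity n) | p. ipoly p \<eta> \<in> V}"
      by (rule quasicrystal_description)
    note \<eta> = \<eta>[folded x_def] and V = V(1) V(4)[folded x_def]
    have \<eta>c: "\<eta> \<noteq> cnj \<eta>" using cyclo_conjugate_root(2)[OF \<eta>(1) n5] \<eta>(2,3)
      by (auto simp: x_def complex_eq_iff)
    have "cnj \<eta> \<noteq> x" using \<eta>(3) by (metis complex_cnj_cnj)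
    hence card: "card {x, cnj x, \<eta>, cnj \<eta>} = 4" using \<eta>(2,3) xc \<eta>c by simp
    obtain C where C: "\<And>v. v \<in> V \<Longrightarrow> cmod v \<le> C" using V(1) bounded_iff by blast
    define B where "B = max (R + cmod t) C"
    define Z where "Z = {x, cnj x, \<eta>, cnj \<eta>}"
    have "finite {ipoly p x | p. \<forall>z\<in>Z. cmod (ipoly p z) \<le> B}"
    proof (rule finite_bounded_conjugates[OF lc])
      show "degree (cyclo n) = card Z" using n5 card unfolding degree_cyclo Z_def by auto
      show "ipoly (cyclo n) z = 0" if "z \<in> Z" for z
        using that root \<eta>(1) ipoly_cnj[of "cyclo n" x] ipoly_cnj[of "cyclo n" \<eta>] by (auto simp: Z_def)
    qed (simp_all add: Z_def)
    moreover have "{z \<in> \<Lambda>. cmod z \<le> R} \<subseteq> (+) t ` {ipoly p x | p. \<forall>z\<in>Z. cmod (ipoly p z) \<le> B}"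
    proof
      fix z assume z: "z \<in> {z \<in> \<Lambda>. cmod z \<le> R}"
      then obtain p where p: "z = t + ipoly p x" "ipoly p \<eta> \<in> V" using V(2) by blast
      have "cmod (ipoly p x) \<le> cmod z + cmod t" using norm_triangle_ineq4[of z t] by (simp add: p)
      hence "cmod (ipoly p x) \<le> B" "cmod (ipoly p \<eta>) \<le> B" using z C[OF p(2)] by (auto simp: B_def)
      hence "\<forall>z\<in>Z. cmod (ipoly p z) \<le> B" by (auto simp: Z_def ipoly_cnj)
      thus "z \<in> (+) t ` {ipoly p x | p. \<forall>z\<in>Z. cmod (ipoly p z) \<le> B}" using p by blast
    qed
    ultimately show ?thesis by (rule finite_subset[OF _ finite_imageI, rotated])
  qed
qed

section \<open>Copies of finite configurations in model sets\<close>

lemma lattice_covering: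
  assumes "Im \<eta> \<noteq> 0" "cmod \<eta> = 1"
  obtains p where "cmod (ipoly p \<eta> - c) \<le> 2"
proof -
  define b where "b = \<lfloor>Im c / Im \<eta>\<rfloor>"
  define b' where "b' = Im c / Im \<eta> - b"
  define a where "a = \<lfloor>Re c - Im c / Im \<eta> * Re \<eta>\<rfloor>"
  define a' where "a' = Re c - Im c / Im \<eta> * Re \<eta> - a"
  have ab: "0 \<le> a'" "a' \<le> 1" "0 \<le> b'" "b' \<le> 1" unfolding a'_def b'_def a_def b_def by linarith+
  have "c - ipoly [:a, b:] \<eta> = of_real a' + of_real b' * \<eta>"
    using assms(1) by (simp add: complex_eq_iff a'_def b'_def field_simps)
  hence "cmod (ipoly [:a, b:] \<eta> - c) = cmod (of_real a' + of_real b' * \<eta>)" by (metis norm_minus_commute)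
  also have "\<dots> \<le> cmod (of_real a') + cmod (of_real b' * \<eta>)" by (rule norm_triangle_ineq)
  also have "\<dots> \<le> 2" using ab assms(2) by (simp add: norm_mult)
  finally show ?thesis by (rule that)
qed

text \<open>The real number \<open>1 + x + cnj x\<close> with \<open>x = root_of_unity n\<close> has a conjugate of modulus less than 1, so
  multiplying by its powers contracts the star image.\<close>

lemma model_set_contains_scaled_copy:
  assumes n: "n \<in> {3, 4, 5, 8, 12}" and L: "cyclotomic_model_set n \<Lambda>" and A: "finite A"
  obtains w and \<beta> :: real where "\<beta> \<noteq> 0"
    "\<And>p. p \<in> A \<Longrightarrow> w + of_real \<beta> * ipoly p (root_of_unity n) \<in> \<Lambda>"
proof (cases "n \<in> {3, 4}")
  case True
  obtain t where "\<Lambda> = range (\<lambda>p. t + ipoly p (root_of_unity n))" by (rule crystal_description[OF True L])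
  thus ?thesis using that[of 1 t] by simp
next
  case False
  define x where "x = root_of_unity n"
  have n5: "n \<in> {5, 8, 12}" using n False by blast
  obtain t \<eta> V c e where
    \<eta>: "ipoly (cyclo n) \<eta> = 0" "\<eta> \<noteq> root_of_unity n" "\<eta> \<noteq> cnj (root_of_unity n)" and V: "bounded V"
    "e > 0" "ball c e \<subseteq> V" "\<Lambda> = {t + ipoly p (root_of_unity n) | p. ipoly p \<eta> \<in> V}"
    by (rule quasicrystal_description[OF n5 L])
  note e\<eta> = cyclo_conjugate_root[OF \<eta>(1) n5 \<eta>(2,3)]
  have inv: "y ^ 119 = cnj y" if "ipoly (cyclo n) y = 0" for y
  proof -
    have c: "y * cnj y = 1" using cyclo_root_norm[OF that n5] by (simp add: complex_norm_square [symmetric])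
    have "y ^ 120 = 1" by (rule cyclo_root_power[OF that n5])
    hence y: "y * y ^ 119 = 1" by (simp flip: power_Suc)
    have "y ^ 119 = (y * cnj y) * y ^ 119" using c by simp
    also have "\<dots> = cnj y * (y * y ^ 119)" by (simp only: mult_ac)
    finally show ?thesis using y by simp
  qed
  \<comment> \<open>119 is -1 modulo 5, 8 and 12.\<close>
  define b :: "int poly" where "b = 1 + monom 1 1 + monom 1 119"
  have b: "ipoly b y = of_real (1 + 2 * Re y)" if "ipoly (cyclo n) y = 0" for y
  proof -
    have "ipoly b y = 1 + (y + cnj y)" using inv[OF that] by (simp add: b_def)
    thus ?thesis by (simp add: complex_add_cnj)
  qed
  define \<beta> \<gamma> where "\<beta> = 1 + 2 * Re x" and "\<gamma> = 1 + 2 * Re \<eta>"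
  have bx: "ipoly b x = of_real \<beta>" using b cyclo_root_of_unity[OF n] by (simp add: x_def \<beta>_def)
  have b\<eta>: "ipoly b \<eta> = of_real \<gamma>" using b[OF \<eta>(1)] by (simp add: \<gamma>_def)
  have \<gamma>: "\<gamma> \<noteq> 0" "\<bar>\<gamma>\<bar> < 1" using e\<eta> by (auto simp: \<gamma>_def)
  have "\<beta> \<noteq> 0"
  proof
    assume "\<beta> = 0"
    hence "2 * Re x = -1" by (simp add: \<beta>_def)
    thus False using cyclo_root_trace[OF cyclo_root_of_unity[OF n] n5] n5 by (auto simp: x_def split: if_splits)
  qed
  \<comment> \<open>Bounds every star image from \<open>A\<close> plus the covering radius 2, so
    that \<open>\<gamma> ^ k\<close> shrinks the whole configuration into the disc of radius
    \<open>e\<close>.\<close>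
  define B where "B = (\<Sum>p\<in>A. cmod (ipoly p \<eta>)) + 2"
  have B: "B > 0" unfolding B_def by (intro add_nonneg_pos sum_nonneg) auto
  have pB: "cmod (ipoly p \<eta>) + 2 \<le> B" if "p \<in> A" for p
    unfolding B_def using member_le_sum[of p A "\<lambda>p. cmod (ipoly p \<eta>)"] that A by simp
  obtain k where k: "\<bar>\<gamma>\<bar> ^ k < e / B" using real_arch_pow_inv[of "e / B" "\<bar>\<gamma>\<bar>"] V(2) B \<gamma> by auto
  \<comment> \<open>Dividing by \<open>\<gamma> ^ k\<close> beforehand makes the contracted copy
    land near the centre \<open>c\<close>.\<close>
  obtain q where q: "cmod (ipoly q \<eta> - c / of_real (\<gamma> ^ k)) \<le> 2"
    using lattice_covering[OF e\<eta>(2,4)] by blast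
  show ?thesis
  proof (rule that[of "\<beta> ^ k" "t + ipoly (b ^ k * q) x"])
    show "\<beta> ^ k \<noteq> 0" using \<open>\<beta> \<noteq> 0\<close> by simp
    fix p assume p: "p \<in> A"
    define r where "r = b ^ k * (q + p)"
    have "ipoly r \<eta> - c = of_real (\<gamma> ^ k) * ((ipoly q \<eta> - c / of_real (\<gamma> ^ k)) + ipoly p \<eta>)"
      using \<gamma>(1) by (simp add: r_def b\<eta> field_simps)
    hence "cmod (ipoly r \<eta> - c) = \<bar>\<gamma>\<bar> ^ k * cmod ((ipoly q \<eta> - c / of_real (\<gamma> ^ k)) + ipoly p \<eta>)"
      by (simp add: norm_mult norm_power)
    also have "cmod ((ipoly q \<eta> - c / of_real (\<gamma> ^ k)) + ipoly p \<eta>) \<le> B"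
      using norm_triangle_ineq[of "ipoly q \<eta> - c / of_real (\<gamma> ^ k)" "ipoly p \<eta>"] q pB[OF p] by linarith
    also have "\<bar>\<gamma>\<bar> ^ k * B < e" using k B by (simp add: pos_less_divide_eq)
    finally have "cmod (ipoly r \<eta> - c) < e" by (simp add: mult_left_mono)
    hence "ipoly r \<eta> \<in> V" using V(3) by (auto simp: dist_norm norm_minus_commute)
    hence "t + ipoly r (root_of_unity n) \<in> \<Lambda>" using V(4) by blast
    moreover have "ipoly r x = ipoly (b ^ k * q) x + of_real (\<beta> ^ k) * ipoly p x"
      by (simp add: r_def bx algebra_simps)
    ultimately show "t + ipoly (b ^ k * q) x + of_real (\<beta> ^ k) * ipoly p (root_of_unity n) \<in> \<Lambda>"
      by (simp add: x_def add.assoc)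
  qed
qed

lemma cnj_root_of_unity_power:
  assumes "n > 0"
  shows "cnj (root_of_unity n) = root_of_unity n ^ (n - 1)"
proof -
  have "root_of_unity n * root_of_unity n ^ (n - 1) = 1"
    using root_of_unity_power_self[OF assms] assms by (metis power_Suc Suc_pred')
  thus ?thesis unfolding cnj_root_of_unity by (metis inverse_unique)
qed

text \<open>Integer coordinates in the triangular lattice, needed to carry it linearly to the square
  lattice when n = 4.\<close>

lemma ipoly_cube_root_linear:
  obtains a b :: int where "ipoly p (root_of_unity 3) = of_int a + of_int b * root_of_unity 3"
proof -
  define x where "x = root_of_unity 3"
  have "1 + x * (1 + x) = 0"
    using cyclo_root_of_unity[of 3] by (simp add: cyclo_def x_def)
  hence x2: "x * x = - 1 - x" by (simp add: algebra_simps add_eq_0_iff)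
  have "\<exists>a b :: int. ipoly p x = of_int a + of_int b * x"
  proof (induction p)
    case 0
    show ?case by (intro exI[of _ 0]) simp
  next
    case (pCons c p)
    then obtain a b :: int where "ipoly p x = of_int a + of_int b * x" by blast
    hence "ipoly (pCons c p) x = of_int c + of_int a * x + of_int b * (x * x)"
      by (simp add: algebra_simps)
    also have "\<dots> = of_int (c - b) + of_int (a - b) * x" unfolding x2 by (simp add: algebra_simps)
    finally show ?case by blast
  qed
  thus ?thesis using that unfolding x_def by blast
qed

text \<open>For odd n the ring also contains the 2n-th roots of unity, which doubles the size of the
  dihedral group.\<close>

lemma root_of_unity_double:
  "root_of_unity 6 = - (root_of_unity 3 ^ 2)" "root_of_unity 10 = - (root_of_unity 5 ^ 3)"
proof -
  have c: "- cis (t + pi) = cis t" for t by (simp add: complex_eq_iff)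
  have "root_of_unity 3 ^ 2 = cis (2 * pi / real 6 + pi)" "root_of_unity 5 ^ 3 = cis (2 * pi / real 10 + pi)"
    unfolding root_of_unity_power by (rule arg_cong[where f = cis]; simp)+
  thus "root_of_unity 6 = - (root_of_unity 3 ^ 2)" "root_of_unity 10 = - (root_of_unity 5 ^ 3)"
    by (simp_all only: c root_of_unity_cis of_nat_numeral)
qed

lemma few_directions_do_not_suffice:
  assumes nN: "(n, N) \<in> {(3, 6), (4, 6), (5, 10), (8, 8), (12, 12)}"
    and L: "cyclotomic_model_set n \<Lambda>" and m: "0 < m" "m \<le> N"
  shows "\<not> directions_suffice \<Lambda> m"
proof -
  have n: "n \<in> {3, 4, 5, 8, 12}" and n0: "n > 0" and n3: "n \<ge> 3" and N: "N > 0" using nN by auto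
  \<comment> \<open>For n = 4 the orbit is built over the third root of unity, as the Gaussian
    integers contain no regular hexagon but do contain a linear image of one.\<close>
  define k where "k = (if n = 4 then 3 else n)"
  define x where "x = root_of_unity k"
  have k: "k > 0" "k \<ge> 3" using n3 by (auto simp: k_def)
  have Im: "Im x > 0" unfolding x_def by (rule root_of_unity_Im_pos[OF k(2)])
  obtain a :: int where a: "\<And>z. z ^ N = 1 \<Longrightarrow> of_int a + x \<noteq> z * (of_int a + cnj x)"
    using ex_generic_translate[of x N] Im N by auto
  define \<alpha> where "\<alpha> = of_int a + x"
  \<comment> \<open>\<open>q\<close> represents the N-th root of unity as an integer polynomial in
    \<open>x\<close>, and \<open>f\<close> and \<open>g\<close> below represent the two halves of
    the orbit.\<close>
  define q :: "int poly" where "q = (if k = 3 then - monom 1 2 else if k = 5 then - monom 1 3 else monom 1 1)"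
  have q: "ipoly q x = root_of_unity N"
    using nN by (auto simp: q_def x_def k_def root_of_unity_double)
  define f g where "f j = q ^ j * [:a, 1:]" and "g j = q ^ j * ([:a:] + monom 1 (k - 1))" for j
  have fj: "ipoly (f j) x = root_of_unity N ^ j * \<alpha>" for j
    by (simp add: f_def q \<alpha>_def algebra_simps)
  have cx: "cnj x = x ^ (k - 1)" unfolding x_def by (rule cnj_root_of_unity_power[OF k(1)])
  have gj: "ipoly (g j) x = root_of_unity N ^ j * cnj \<alpha>" for j
    by (simp add: g_def q \<alpha>_def cx algebra_simps)
  have \<alpha>: "\<alpha> \<noteq> z * cnj \<alpha>" if "z ^ N = 1" for z using a[OF that] by (simp add: \<alpha>_def)
  define B where "B = f ` {..<N} \<union> g ` {..<N}"
  have B: "finite B" by (simp add: B_def)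
  have "\<exists>L0 h. linear L0 \<and> inj L0 \<and> (\<forall>p. L0 (ipoly p x) = ipoly (h p) (root_of_unity n))"
  proof (cases "n = 4")
    case False
    thus ?thesis by (intro exI[of _ id] exI[of _ id]) (auto simp: x_def k_def linear_id)
  next
    case True
    \<comment> \<open>The real-linear map that fixes 1 and sends \<open>x\<close> to
      \<open>\<i>\<close>.\<close>
    define M where "M z = Complex (Re z - Re x * Im z / Im x) (Im z / Im x)" for z
    have "linear M"
      by (rule linearI) (simp_all add: M_def complex_eq_iff algebra_simps add_divide_distrib)
    moreover have "inj M"
      using Im by (auto intro!: injI simp: M_def complex_eq_iff)
    moreover have "\<forall>p. \<exists>r. M (ipoly p x) = ipoly r (root_of_unity n)"
    proof
      fix p
      obtain c d :: int where cd: "ipoly p x = of_int c + of_int d * x"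
        using ipoly_cube_root_linear[of p] True by (auto simp: x_def k_def)
      have "root_of_unity n = \<i>" using True by (simp add: root_of_unity_cis complex_eq_iff)
      hence "M (ipoly p x) = ipoly [:c, d:] (root_of_unity n)"
        using Im unfolding cd by (simp add: M_def complex_eq_iff)
      thus "\<exists>r. M (ipoly p x) = ipoly r (root_of_unity n)" by blast
    qed
    ultimately show ?thesis by metis
  qed
  then obtain L0 h where L0: "linear L0" "inj L0" "\<And>p. L0 (ipoly p x) = ipoly (h p) (root_of_unity n)"
    by blast
  obtain w and \<beta> :: real where \<beta>: "\<beta> \<noteq> 0"
    "\<And>p. p \<in> h ` B \<Longrightarrow> w + of_real \<beta> * ipoly p (root_of_unity n) \<in> \<Lambda>"
    using model_set_contains_scaled_copy[OF n L finite_imageI[OF B, of h]] by blast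
  have pt: "w + of_real \<beta> * L0 (ipoly p x) \<in> \<Lambda>" if "p \<in> B" for p
    using \<beta>(2)[of "h p"] that by (simp add: L0(3))
  show ?thesis
  proof (rule not_directions_suffice_if_dihedral_orbit[where L = "\<lambda>z. of_real \<beta> * L0 z" and s = w])
    show "linear (\<lambda>z. of_real \<beta> * L0 z)"
      using linear_compose_scale_right[OF L0(1), of \<beta>] by (simp add: scaleR_conv_of_real)
    show "inj (\<lambda>z. of_real \<beta> * L0 z)" using L0(2) \<beta>(1) by (auto simp: inj_on_def)
    show "m \<le> N" "m > 0" by (fact m)+
    show "\<alpha> \<noteq> z * cnj \<alpha>" if "z ^ N = 1" for z by (rule \<alpha>[OF that])
    fix j assume "j < N"
    hence "f j \<in> B" "g j \<in> B" by (auto simp: B_def)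
    from pt[OF this(1)] pt[OF this(2)]
    show "w + of_real \<beta> * L0 (root_of_unity N ^ j * \<alpha>) \<in> \<Lambda>"
      "w + of_real \<beta> * L0 (root_of_unity N ^ j * cnj \<alpha>) \<in> \<Lambda>"
      unfolding fj gj by auto
  qed
qed

section \<open>The magic numbers\<close>

lemma line_in_direction:
  assumes "cmod u = 1"
  shows "{z. Im (cnj u * z) = h} \<in> lines_in_direction u"
proof -
  have uu: "u * cnj u = 1" using assms by (simp add: complex_norm_square [symmetric])
  have "{z. Im (cnj u * z) = h} = range (\<lambda>r::real. \<i> * of_real h * u + r *\<^sub>R u)"
  proof (intro equalityI subsetI)
    fix z assume "z \<in> {z. Im (cnj u * z) = h}"
    hence "cnj u * z = of_real (Re (cnj u * z)) + \<i> * of_real h" by (simp add: complex_eq_iff)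
    hence "u * (cnj u * z) = u * (of_real (Re (cnj u * z)) + \<i> * of_real h)" by (rule arg_cong)
    moreover have "u * (cnj u * z) = z" using uu by (simp flip: mult.assoc)
    ultimately have "z = \<i> * of_real h * u + Re (cnj u * z) *\<^sub>R u"
      by (simp add: scaleR_conv_of_real algebra_simps)
    thus "z \<in> range (\<lambda>r::real. \<i> * of_real h * u + r *\<^sub>R u)" by blast
  next
    fix z assume "z \<in> range (\<lambda>r::real. \<i> * of_real h * u + r *\<^sub>R u)"
    then obtain r :: real where "z = \<i> * of_real h * u + r *\<^sub>R u" by blast
    hence "cnj u * z = (\<i> * of_real h + of_real r) * (u * cnj u)"
      by (simp add: scaleR_conv_of_real algebra_simps)
    hence "cnj u * z = \<i> * of_real h + of_real r" using uu by simp
    hence "Im (cnj u * z) = Im (\<i> * of_real h + of_real r)" by (rule arg_cong)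
    thus "z \<in> {z. Im (cnj u * z) = h}" by simp
  qed
  thus ?thesis unfolding lines_in_direction_def by blast
qed

lemma parallel_if_Im_0:
  assumes "cmod u = 1" "cmod v = 1" "Im (cnj u * v) = 0"
  shows "parallel u v"
proof -
  have uu: "u * cnj u = 1" using assms by (simp add: complex_norm_square [symmetric])
  have "cnj u * v = of_real (Re (cnj u * v))" using assms(3) by (simp add: complex_eq_iff)
  hence "u * (cnj u * v) = u * of_real (Re (cnj u * v))" by (rule arg_cong)
  moreover have "u * (cnj u * v) = v" using uu by (simp flip: mult.assoc)
  ultimately have "v = u * of_real (Re (cnj u * v))" by (rule trans[OF sym, rotated])
  hence v: "v = Re (cnj u * v) *\<^sub>R u" unfolding scaleR_conv_of_real by (subst mult.commute)
  moreover have "Re (cnj u * v) \<noteq> 0"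
  proof
    assume "Re (cnj u * v) = 0"
    hence "v = 0" using v by simp
    thus False using assms(2) by simp
  qed
  ultimately show ?thesis unfolding parallel_def by blast
qed

text \<open>Each direction matches the differences point by point, so they have equal size, and two
  independent directions make their sums equal. The common centroid lies in both hulls and is
  translated to 0.\<close>

lemma tomography_of_convex_subsets:
  assumes C: "C \<in> convex_subsets \<Lambda>" "C' \<in> convex_subsets \<Lambda>" "finite C" "finite C'" "C \<noteq> C'"
    and U: "finite U" "card U \<ge> 3" "\<And>u. u \<in> U \<Longrightarrow> cmod u = 1" "pairwise (\<lambda>u v. \<not> parallel u v) U"
    and x: "\<And>u. u \<in> U \<Longrightarrow> xray u C = xray u C'"
  obtains D1 D2 P1 P2 where "tomography D1 D2 P1 P2 U"
proof -
  define D1 D2 where "D1 = C - C'" and "D2 = C' - C"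
  have fin: "finite D1" "finite D2" using C by (auto simp: D1_def D2_def)
  have indep: "Im (cnj u * v) \<noteq> 0" if "u \<in> U" "v \<in> U" "u \<noteq> v" for u v
    using parallel_if_Im_0[of u v] U(3)[OF that(1)] U(3)[OF that(2)] U(4) that unfolding pairwise_def by blast
  have lines: "card {z\<in>D1. Im (cnj u * z) = h} = card {z\<in>D2. Im (cnj u * z) = h}" if u: "u \<in> U" for u h
  proof -
    define l where "l = {z. Im (cnj u * z) = h}"
    have l: "l \<in> lines_in_direction u" unfolding l_def by (rule line_in_direction[OF U(3)[OF u]])
    have "card (C \<inter> l) = card (C' \<inter> l)"
      using fun_cong[OF x[OF u], of l] l by (simp add: xray_def)
    moreover have "card (C \<inter> l) = card {z\<in>D1. Im (cnj u * z) = h} + card (C \<inter> C' \<inter> l)"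
      by (subst card_Un_disjoint[symmetric]) (use C fin in \<open>auto intro!: arg_cong[where f = card] simp: D1_def l_def\<close>)
    moreover have "card (C' \<inter> l) = card {z\<in>D2. Im (cnj u * z) = h} + card (C \<inter> C' \<inter> l)"
      by (subst card_Un_disjoint[symmetric]) (use C fin in \<open>auto intro!: arg_cong[where f = card] simp: D2_def l_def\<close>)
    ultimately show ?thesis by simp
  qed
  obtain u where u: "u \<in> U" using U(2) by (cases "U = {}") auto
  obtain v where v: "v \<in> U" "u \<noteq> v"
  proof -
    have "\<not> U \<subseteq> {u}" using U(2) card_mono[of "{u}" U] by auto
    thus ?thesis using that by blast
  qed
  have match: "card D1 = card D2 \<and> Im (cnj a * (\<Sum>z\<in>D1. z)) = Im (cnj a * (\<Sum>z\<in>D2. z))" if a: "a \<in> U" for a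
  proof -
    obtain g where g: "bij_betw g D1 D2" "\<And>x. x \<in> D1 \<Longrightarrow> Im (cnj a * g x) = Im (cnj a * x)"
      using bij_betw_equal_fibres[OF fin lines[OF a]] by blast
    have "(\<Sum>z\<in>D1. Im (cnj a * z)) = (\<Sum>z\<in>D1. Im (cnj a * g z))" using g(2) by (intro sum.cong) auto
    also have "\<dots> = (\<Sum>z\<in>D2. Im (cnj a * z))" by (rule sum.reindex_bij_betw[OF g(1)])
    finally have "(\<Sum>z\<in>D1. Im (cnj a * z)) = (\<Sum>z\<in>D2. Im (cnj a * z))" .
    thus ?thesis using bij_betw_same_card[OF g(1)] by (simp only: sum_distrib_left Im_sum)
  qed
  have card: "card D1 = card D2" using match[OF u] by simp
  have sum: "(\<Sum>z\<in>D1. z) = (\<Sum>z\<in>D2. z)"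
  proof -
    define d where "d = (\<Sum>z\<in>D1. z) - (\<Sum>z\<in>D2. z)"
    have "Im (cnj u * d) = 0" "Im (cnj v * d) = 0"
      using match[OF u] match[OF v(1)] by (simp_all add: d_def right_diff_distrib)
    hence "d = 0" using indep[OF u v] by (rule zero_if_two_determinants_0)
    thus ?thesis by (simp add: d_def)
  qed
  have ne: "D1 \<noteq> {}" "D2 \<noteq> {}"
  proof -
    have "D1 \<noteq> {} \<or> D2 \<noteq> {}" using C(5) by (auto simp: D1_def D2_def)
    thus "D1 \<noteq> {}" "D2 \<noteq> {}" using card fin by auto
  qed
  define c where "c = real (card D1)"
  have c: "c > 0" using ne(1) fin(1) by (simp add: c_def card_gt_0_iff)
  define s where "s = (1 / c) *\<^sub>R (\<Sum>z\<in>D1. z)"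
  have mean: "s \<in> convex hull C" "s \<in> convex hull C'"
  proof -
    have m: "(\<Sum>z\<in>E. (1 / c) *\<^sub>R z) \<in> convex hull K" if "finite E" "E \<subseteq> K" "real (card E) = c" for E K
      using that c by (intro convex_sum convex_convex_hull) (auto intro: hull_inc)
    show "s \<in> convex hull C" unfolding s_def scaleR_sum_right
      by (rule m[OF fin(1)]) (auto simp: D1_def c_def)
    show "s \<in> convex hull C'" unfolding s_def sum scaleR_sum_right
      by (rule m[OF fin(2)]) (use card in \<open>auto simp: D2_def c_def\<close>)
  qed
  have hull: "convex hull C \<inter> \<Lambda> = C" "convex hull C' \<inter> \<Lambda> = C'" "C \<subseteq> \<Lambda>" "C' \<subseteq> \<Lambda>"
    using C(1,2) unfolding convex_subsets_def by auto
  define T where "T z = z - s" for z :: complex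
  have injT: "inj T" by (auto simp: inj_on_def T_def)
  have sum0: "(\<Sum>x\<in>T ` E. x) = 0" if "(\<Sum>z\<in>E. z) = (\<Sum>z\<in>D1. z)" "card E = card D1" for E
  proof -
    have "(\<Sum>x\<in>T ` E. x) = (\<Sum>z\<in>E. z) - of_real c * s"
      using injT that(2) by (subst sum.reindex) (auto simp: inj_on_def T_def sum_subtractf c_def)
    thus ?thesis using c that(1) by (simp add: s_def scaleR_conv_of_real)
  qed
  have "tomography (T ` D1) (T ` D2) (T ` (convex hull C)) (T ` (convex hull C')) U"
  proof
    show "finite (T ` D1)" "finite (T ` D2)" using fin by auto
    show "convex (T ` (convex hull C))" "convex (T ` (convex hull C'))"
      unfolding T_def by (simp_all add: convex_translation_subtract)
    show "0 \<in> T ` (convex hull C)" "0 \<in> T ` (convex hull C')" using mean by (auto simp: T_def image_iff)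
    show "T ` D1 \<subseteq> T ` (convex hull C)" "T ` D2 \<subseteq> T ` (convex hull C')"
      using hull_subset[of C convex] hull_subset[of C' convex] by (auto simp: D1_def D2_def)
    have "D1 \<inter> convex hull C' = {}" "D2 \<inter> convex hull C = {}" using hull by (auto simp: D1_def D2_def)
    thus "T ` D1 \<inter> T ` (convex hull C') = {}" "T ` D2 \<inter> T ` (convex hull C) = {}"
      using image_Int[OF injT] by (metis image_empty)+
    show "card {x \<in> T ` D1. Im (cnj u * x) = h} = card {x \<in> T ` D2. Im (cnj u * x) = h}" if "u \<in> U" for u h
    proof -
      have "{x \<in> T ` E. Im (cnj u * x) = h} = T ` {z \<in> E. Im (cnj u * z) = h + Im (cnj u * s)}" for E
        by (auto simp: T_def right_diff_distrib)
      moreover have "card (T ` E) = card E" for E using injT by (simp add: card_image inj_on_def)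
      ultimately show ?thesis using lines[OF that] by simp
    qed
    show "(\<Sum>x\<in>T ` D1. x) = 0" "(\<Sum>x\<in>T ` D2. x) = 0" using sum0 sum card by simp_all
    show "T ` D1 \<noteq> {}" using ne by simp
    show "u \<noteq> 0" if "u \<in> U" for u using U(3)[OF that] by auto
    show "Im (cnj u * v) \<noteq> 0" if "u \<in> U" "v \<in> U" "u \<noteq> v" for u v by (rule indep[OF that])
  qed (fact U)+
  thus ?thesis by (rule that)
qed

lemma many_directions_suffice:
  assumes n: "n \<in> {3, 4, 5, 8, 12}" and L: "cyclotomic_model_set n \<Lambda>"
    and p: "prime p" "\<not> p dvd n" "e > 0" "n dvd p ^ e - 1 \<or> n dvd p ^ e + 1" "p \<ge> 5 \<or> p = 3 \<and> e \<ge> 2"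
  shows "directions_suffice \<Lambda> (p ^ e + 2)"
  unfolding directions_suffice_def
proof (intro allI impI, elim conjE)
  fix U assume U: "finite U" "card U = p ^ e + 2" "\<forall>u\<in>U. set_direction \<Lambda> u" "pairwise (\<lambda>u v. \<not> parallel u v) U"
  let ?\<zeta> = "root_of_unity n"
  have n0: "n > 0" using n by auto
  have unit: "cmod u = 1" if "u \<in> U" for u using U(3) that by (auto simp: set_direction_def)
  have "\<exists>g r. r \<noteq> 0 \<and> ipoly g ?\<zeta> = r *\<^sub>R u" if u: "u \<in> U" for u
  proof -
    have "set_direction \<Lambda> u" using U(3) u by blast
    then obtain v w where vw: "v \<in> \<Lambda>" "w \<in> \<Lambda>" "parallel u (v - w)"
      unfolding set_direction_def by blast
    obtain g where g: "v - w = ipoly g ?\<zeta>" by (rule model_set_differences[OF n L vw(1,2)])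
    obtain r :: real where "r \<noteq> 0" "v - w = r *\<^sub>R u" using vw(3) unfolding parallel_def by blast
    thus ?thesis unfolding g by (intro exI conjI)
  qed
  hence "\<exists>g r. \<forall>u\<in>U. r u \<noteq> 0 \<and> ipoly (g u) ?\<zeta> = r u *\<^sub>R u" by metis
  then obtain g r where "\<forall>u\<in>U. r u \<noteq> 0 \<and> ipoly (g u) ?\<zeta> = r u *\<^sub>R u" by (elim exE)
  hence g: "\<And>u. u \<in> U \<Longrightarrow> r u \<noteq> 0" "\<And>u. u \<in> U \<Longrightarrow> ipoly (g u) ?\<zeta> = r u *\<^sub>R u" by blast+
  show "determined_by_xrays (convex_subsets \<Lambda>) U"
    unfolding determined_by_xrays_def
  proof (intro ballI impI, rule ccontr)
    fix C C' assume C: "C \<in> convex_subsets \<Lambda>" "C' \<in> convex_subsets \<Lambda>"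
      and x: "\<forall>u\<in>U. xray u C = xray u C'" and ne: "C \<noteq> C'"
    have fin: "finite E" if "E \<in> convex_subsets \<Lambda>" for E
    proof -
      have E: "E \<subseteq> \<Lambda>" "bounded E" using that unfolding convex_subsets_def by auto
      obtain R where "\<And>z. z \<in> E \<Longrightarrow> cmod z \<le> R" using E(2) bounded_iff by blast
      hence "E \<subseteq> {z \<in> \<Lambda>. cmod z \<le> R}" using E(1) by blast
      thus ?thesis using model_set_locally_finite[OF n L] by (rule finite_subset)
    qed
    have c3: "card U \<ge> 3" using U(2) p(1) prime_gt_0_nat[of p] by simp
    obtain D1 D2 P1 P2 where "tomography D1 D2 P1 P2 U"
      by (rule tomography_of_convex_subsets[OF C fin[OF C(1)] fin[OF C(2)] ne U(1) c3 unit U(4)]) (use x in auto)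
    then interpret tomography D1 D2 P1 P2 U .
    show False
    proof (rule ex_roots_of_unity_for_directions)
    fix M :: nat and z :: "complex \<Rightarrow> complex"
    assume z: "M > 0" "inj_on z U" "\<And>u. u \<in> U \<Longrightarrow> z u ^ M = 1"
      "\<And>a b c d. a \<in> U \<Longrightarrow> b \<in> U \<Longrightarrow> c \<in> U \<Longrightarrow> d \<in> U \<Longrightarrow>
        of_real (Im (cnj a * b) * Im (cnj c * d)) * ((z a - z c) * (z b - z d)) =
        of_real (Im (cnj a * c) * Im (cnj b * d)) * ((z a - z b) * (z c - z d))"
    obtain u0 where u0: "u0 \<in> U" using c3 by (cases "U = {}") auto
    have z0: "z u0 \<noteq> 0" using z(3)[OF u0] z(1) by (auto simp: power_0_left)
    \<comment> \<open>Division by one of the roots keeps cross ratios and puts 1 into the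
      set.\<close>
    define S where "S = (\<lambda>u. z u / z u0) ` U"
    have "card S = card U"
      unfolding S_def by (rule card_image) (use z(2) z0 in \<open>auto simp: inj_on_def\<close>)
    have "card S \<le> p ^ e + 1"
    proof (rule card_roots_with_rational_cross_ratios[OF p(1,2) n0 p(3,4,5)])
      show "M * n > 0" "n dvd M * n" using z(1) n0 by auto
      show "y ^ (M * n) = 1" if "y \<in> S" for y
        using that z(3) u0 by (auto simp: S_def power_mult power_divide)
      show "1 \<in> S" unfolding S_def by (rule image_eqI[OF _ u0]) (use z0 in simp)
      show "rational_cross_ratios n S"
        unfolding rational_cross_ratios_def
      proof (intro ballI impI)
        fix z1 z2 z3 z4 assume zs: "z1 \<in> S" "z2 \<in> S" "z3 \<in> S" "z4 \<in> S" "distinct [z1, z2, z3, z4]"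
        obtain a b c d where abcd: "a \<in> U" "z1 = z a / z u0" "b \<in> U" "z2 = z b / z u0"
          "c \<in> U" "z3 = z c / z u0" "d \<in> U" "z4 = z d / z u0" using zs(1-4) unfolding S_def by blast
        have dist: "a \<noteq> c" "b \<noteq> d" using zs(5) abcd by auto
        \<comment> \<open>The determinant of two directions as an integer polynomial value: conj(a)
          b - a conj(b) is \<open>2 * \<i>\<close> times the determinant of a and b, and the power
          \<open>n - 1\<close> conjugates the root of unity.\<close>
        define h where "h u v = pcompose (g u) (monom 1 (n - 1)) * g v - g u * pcompose (g v) (monom 1 (n - 1))" for u v
        have e: "ipoly p (?\<zeta> ^ (n - 1)) = cnj (ipoly p ?\<zeta>)" for p
          by (simp only: cnj_root_of_unity_power[OF n0, symmetric] ipoly_cnj)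
        have h: "ipoly (h u v) ?\<zeta> = of_real (2 * r u * r v * Im (cnj u * v)) * \<i>" if "u \<in> U" "v \<in> U" for u v
        proof -
          have "ipoly (h u v) ?\<zeta> = cnj (r u *\<^sub>R u) * (r v *\<^sub>R v) - r u *\<^sub>R u * cnj (r v *\<^sub>R v)"
            by (simp only: h_def ipoly_diff ipoly_mult ipoly_pcompose ipoly_monom of_int_1 mult_1 e
                g(2)[OF that(1)] g(2)[OF that(2)])
          thus ?thesis by (simp add: complex_eq_iff algebra_simps)
        qed
        \<comment> \<open>A product of two such values loses the factor \<open>\<i>\<close> and is
          real.\<close>
        have hh: "ipoly (h u v * h u' v') ?\<zeta> =
            of_real (- 4 * r u * r v * r u' * r v' * (Im (cnj u * v) * Im (cnj u' * v')))"
          if "u \<in> U" "v \<in> U" "u' \<in> U" "v' \<in> U" for u v u' v'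
        proof -
          define I where "I u v = Im (cnj u * v)" for u v
          show ?thesis unfolding ipoly_mult h[OF that(1,2)] h[OF that(3,4)] I_def [symmetric]
            by (simp add: complex_eq_iff)
        qed
        show "\<exists>a b. ipoly a ?\<zeta> \<in> \<real> \<and> ipoly b ?\<zeta> \<in> \<real> - {0} \<and>
          ipoly a ?\<zeta> * ((z1 - z3) * (z2 - z4)) = ipoly b ?\<zeta> * ((z1 - z2) * (z3 - z4))"
        proof (rule exI[of _ "h a b * h c d"], rule exI[of _ "h a c * h b d"], intro conjI)
          show "ipoly (h a b * h c d) ?\<zeta> \<in> \<real>" unfolding hh[OF abcd(1,3,5,7)] by (rule Reals_of_real)
          have "- 4 * r a * r c * r b * r d * (Im (cnj a * c) * Im (cnj b * d)) \<noteq> 0"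
            using g(1) abcd(1,3,5,7) U(4)[OF abcd(1,5) dist(1)] U(4)[OF abcd(3,7) dist(2)] by simp
          thus "ipoly (h a c * h b d) ?\<zeta> \<in> \<real> - {0}" unfolding hh[OF abcd(1,5,3,7)]
            by (simp only: Diff_iff Reals_of_real singleton_iff of_real_eq_0_iff simp_thms)
          define \<kappa> where "\<kappa> = of_real (- 4 * r a * r b * r c * r d) / (z u0 * z u0)"
          have "ipoly (h a b * h c d) ?\<zeta> * ((z1 - z3) * (z2 - z4)) =
            \<kappa> * (of_real (Im (cnj a * b) * Im (cnj c * d)) * ((z a - z c) * (z b - z d)))"
            unfolding hh[OF abcd(1,3,5,7)] abcd(2,4,6,8) diff_divide_distrib[symmetric] \<kappa>_def
            by (simp only: of_real_mult times_divide_times_eq times_divide_eq_left times_divide_eq_right divide_divide_eq_left mult_ac)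
          also have "\<dots> = \<kappa> * (of_real (Im (cnj a * c) * Im (cnj b * d)) * ((z a - z b) * (z c - z d)))"
            by (simp only: z(4)[OF abcd(1,3,5,7)])
          also have "\<dots> = ipoly (h a c * h b d) ?\<zeta> * ((z1 - z2) * (z3 - z4))"
            unfolding hh[OF abcd(1,5,3,7)] abcd(2,4,6,8) diff_divide_distrib[symmetric] \<kappa>_def
            by (simp only: of_real_mult times_divide_times_eq times_divide_eq_left times_divide_eq_right divide_divide_eq_left mult_ac)
          finally show "ipoly (h a b * h c d) ?\<zeta> * ((z1 - z3) * (z2 - z4)) =
            ipoly (h a c * h b d) ?\<zeta> * ((z1 - z2) * (z3 - z4))" .
        qed
      qed
    qed
    thus False using \<open>card S = card U\<close> \<open>card U = p ^ e + 2\<close> by simp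
    qed
  qed
qed

theorem mainTheorem3:
  fixes n c :: nat and \<Lambda> :: "complex set"
  assumes "(n, c) \<in> {(3, 7), (4, 7), (5, 11), (8, 9), (12, 13)}"
    and "cyclotomic_model_set n \<Lambda>"
  shows "directions_suffice \<Lambda> c \<and> (\<forall>m>0. directions_suffice \<Lambda> m \<longrightarrow> c \<le> m)"
proof -
  have nN: "(n, c - 1) \<in> {(3, 6), (4, 6), (5, 10), (8, 8), (12, 12)}" and n: "n \<in> {3, 4, 5, 8, 12}"
    and c: "c > 0" using assms(1) by auto
  have "c \<le> m" if "m > 0" "directions_suffice \<Lambda> m" for m
  proof (rule ccontr)
    assume "\<not> c \<le> m"
    hence "m \<le> c - 1" by simp
    thus False using few_directions_do_not_suffice[OF nN assms(2) that(1)] that(2) by blast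
  qed
  moreover have "directions_suffice \<Lambda> c"
  proof -
    have pr: "prime (3::nat)" "prime (5::nat)" "prime (7::nat)" "prime (11::nat)"
      by (simp_all add: prime_nat_numeral_eq)
    \<comment> \<open>\<open>c = p ^ e + 2\<close>: 5 is -1 modulo 3 and 1 modulo 4, 9 is -1 modulo
      5, 7 is -1 modulo 8, and 11 is -1 modulo 12.\<close>
    note suff = many_directions_suffice[OF n assms(2)]
    consider "n = 3" "c = 7" | "n = 4" "c = 7" | "n = 5" "c = 11" | "n = 8" "c = 9" | "n = 12" "c = 13"
      using assms(1) by auto
    thus ?thesis
    proof cases
      case 1 show ?thesis using suff[of 5 1] pr 1 by simp
    next
      case 2 show ?thesis using suff[of 5 1] pr 2 by simp
    next
      case 3 show ?thesis using suff[of 3 2] pr 3 by simp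
    next
      case 4 show ?thesis using suff[of 7 1] pr 4 by simp
    next
      case 5 show ?thesis using suff[of 11 1] pr 5 by simp
    qed
  qed
  ultimately show ?thesis by blast
qed

end
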